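(* Let $\mathbb{F}$ be a field. Suppose that $n = dk$, where $k > 1$. Let $G_1 = H_1 \wr K_1 \leq \operatorname{GL}_n(\mathbb{F})$, where $H_1 \leq \operatorname{GL}_d(\mathbb{F})$ is nontrivial irreducible primitive and $K_1 \leq S_k$ is transitive. Suppose that it is not the case that all of the following hold: $d = 1$, $n = k$ is even, $|H_1| = 2$, and $K_1$ is a subgroup of $C_2 \wr S_{n/2}$. Then $G_1$ is contained in an imprimitive subgroup $H_2 \wr K_2$ of $\operatorname{GL}_n(\mathbb{F})$ if and only if all of the following conditions hold: (i) $n = e\ell$, $H_2 \leq \operatorname{GL}_e(\mathbb{F})$ and $K_2 \leq S_{\ell}$ with $\ell > 1$ dividing $k$; (ii) $K_1 \leq X \wr Y$, where $X \leq S_{k/\ell}$ and $Y \leq K_2$; (iii) $H_1 \wr X \leq H_2$.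
   Context: Here $n, d, k, e, \ell$ are positive integers. An irreducible subgroup $G \leq \operatorname{GL}(V)$ ($V$ finite-dimensional over $\mathbb{F}$) is imprimitive if there is a decomposition $V = W_1 \oplus \cdots \oplus W_m$ with $m > 1$ such that $G$ acts on the set $\{W_1, \ldots, W_m\}$ of summands; otherwise it is primitive. For $H \leq \operatorname{GL}_d(\mathbb{F})$ and $K \leq S_k$, the wreath product $H \wr K = H^k \rtimes K$ is regarded as a subgroup of $\operatorname{GL}_{dk}(\mathbb{F})$ acting on $(\mathbb{F}^d)^k$: the $i$th factor of $H^k$ acts on the $i$th summand as $H$ and trivially on the others, and $K$ permutes the summands. For $X \leq S_a$ and $Y \leq S_b$, the wreath product $X \wr Y = X^b \rtimes Y$ is regarded as a subgroup of $S_{ab}$ in its imprimitive action on $b$ blocks of size $a$. If $\ell$ divides $k$ and $n = dk = e\ell$, then $e = d(k/\ell)$, so $H_1 \wr X \leq \operatorname{GL}_e(\mathbb{F})$ for $X \leq S_{k/\ell}$. $C_2$ denotes the cyclic group of order $2$; "$K_1$ is a subgroup of $C_2 \wr S_{n/2}$" means that $K_1$ preserves some partition of $\{1, \ldots, n\}$ into $n/2$ blocks of size $2$.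
   Formalization: The containment side is read with ℓ > 1 for the imprimitive subgroup H_2 ≀ K_2, since for ℓ = 1 and H_2 = G_1 the containment holds while (i) fails; the equivalence is stated both for standard blocks and up to conjugacy. *)

theory Defs
  imports
    "HOL-Algebra.Sym_Groups"
    "HOL-Library.Disjoint_Sets"
    "Jordan_Normal_Form.VS_Connect"
begin

definition GL :: "nat \<Rightarrow> 'a::field mat monoid"
  where "GL n = units_of (ring_mat TYPE('a) n ())"

definition conj_set :: "('g, 'm) monoid_scheme \<Rightarrow> 'g \<Rightarrow> 'g set \<Rightarrow> 'g set"
  where "conj_set G g A = (g <#\<^bsub>G\<^esub> A) #>\<^bsub>G\<^esub> (inv\<^bsub>G\<^esub> g)"


definition linear_subspace :: "nat \<Rightarrow> 'a::field vec set \<Rightarrow> bool"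
  where "linear_subspace n W \<longleftrightarrow> VectorSpace.subspace class_ring W (module_vec TYPE('a) n)"

definition irreducible_group :: "nat \<Rightarrow> 'a::field mat set \<Rightarrow> bool"
  where "irreducible_group n G \<longleftrightarrow>
    subgroup G (GL n) \<and> 0 < n \<and>
    (\<forall>W. linear_subspace n W \<and> (\<forall>g\<in>G. (\<lambda>v. g *\<^sub>v v) ` W \<subseteq> W)
       \<longrightarrow> W = {0\<^sub>v n} \<or> W = carrier_vec n)"

(* The summands must be nonzero: otherwise V = V + 0 would make every group imprimitive. *)
definition direct_decomposition :: "nat \<Rightarrow> nat \<Rightarrow> (nat \<Rightarrow> 'a::field vec set) \<Rightarrow> bool"
  where "direct_decomposition n m W \<longleftrightarrow>
    (\<forall>i\<in>{1..m}. linear_subspace n (W i) \<and> W i \<noteq> {0\<^sub>v n}) \<and>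
    (\<forall>v\<in>carrier_vec n. \<exists>!w. w \<in> (\<Pi>\<^sub>E i\<in>{1..m}. W i) \<and> v = finsum_vec TYPE('a) n w {1..m})"

definition imprimitive_group :: "nat \<Rightarrow> 'a::field mat set \<Rightarrow> bool"
  where "imprimitive_group n G \<longleftrightarrow>
    irreducible_group n G \<and>
    (\<exists>m W. 1 < m \<and> direct_decomposition n m W \<and>
       (\<forall>g\<in>G. \<forall>i\<in>{1..m}. (\<lambda>v. g *\<^sub>v v) ` W i \<in> W ` {1..m}))"

definition primitive_group :: "nat \<Rightarrow> 'a::field mat set \<Rightarrow> bool"
  where "primitive_group n G \<longleftrightarrow> irreducible_group n G \<and> \<not> imprimitive_group n G"


(* Points of sym_group k run from 1 to k, but matrix indices start at 0, so the q-th of the k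
   summands F^d is spanned by the unit vectors with indices (q - 1) * d, ..., q * d - 1.
   The matrix A below first acts on the q-th summand by h q and then moves it to the
   p q-th summand. *)
definition wreath_GL :: "nat \<Rightarrow> nat \<Rightarrow> 'a::field mat set \<Rightarrow> (nat \<Rightarrow> nat) set \<Rightarrow> 'a mat set"
  where "wreath_GL d k H K =
    {A \<in> carrier_mat (d * k) (d * k).
       \<exists>h p. (\<forall>q\<in>{1..k}. h q \<in> H) \<and> p \<in> K \<and>
         (\<forall>q\<in>{1..k}. \<forall>q'\<in>{1..k}. \<forall>i<d. \<forall>j<d.
            A $$ ((q' - 1) * d + i, (q - 1) * d + j) = (if q' = p q then h q $$ (i, j) else 0))}"

(* The imprimitive action on b consecutive blocks of size a: the q-th block is
   {(q - 1) * a + 1, ..., q * a}. *)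
definition wreath_Sym ::
    "nat \<Rightarrow> nat \<Rightarrow> (nat \<Rightarrow> nat) set \<Rightarrow> (nat \<Rightarrow> nat) set \<Rightarrow> (nat \<Rightarrow> nat) set"
  where "wreath_Sym a b X Y =
    {\<sigma> \<in> carrier (sym_group (a * b)).
       \<exists>x y. (\<forall>q\<in>{1..b}. x q \<in> X) \<and> y \<in> Y \<and>
         (\<forall>q\<in>{1..b}. \<forall>r\<in>{1..a}. \<sigma> ((q - 1) * a + r) = (y q - 1) * a + x q r)}"

definition transitive_perms :: "nat \<Rightarrow> (nat \<Rightarrow> nat) set \<Rightarrow> bool"
  where "transitive_perms k K \<longleftrightarrow> (\<forall>i\<in>{1..k}. \<forall>j\<in>{1..k}. \<exists>p\<in>K. p i = j)"

(* For even n: K is contained in C_2 wr S_(n/2) for some labelling of the points. *)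
definition preserves_pairing :: "nat \<Rightarrow> (nat \<Rightarrow> nat) set \<Rightarrow> bool"
  where "preserves_pairing n K \<longleftrightarrow>
    (\<exists>P. partition_on {1..n} P \<and> card P = n div 2 \<and> (\<forall>B\<in>P. card B = 2) \<and>
       (\<forall>p\<in>K. \<forall>B\<in>P. p ` B \<in> P))"

end

theory Submission
  imports Defs "HOL-Library.Function_Algebras" "Jordan_Normal_Form.Determinant"
begin

text \<open>
  Let \<open>U\<^sub>1, \<dots>, U\<^sub>k\<close> be the standard summands, let \<open>B\<^sub>i\<close> be the copy of \<open>H1\<close> acting on \<open>U\<^sub>i\<close>, and suppose
  that \<open>H1 wr K1\<close> permutes the summands \<open>W\<^sub>j\<close> of another decomposition.  If \<open>B\<^sub>i\<close> fixes every
  \<open>W\<^sub>j\<close>, then some \<open>h w - w \<noteq> 0\<close> lies in \<open>U\<^sub>i \<inter> W\<^sub>j\<close>, so \<open>U\<^sub>i \<subseteq> W\<^sub>j\<close> by irreducibility, and the \<open>W\<^sub>j\<close> are sums of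
  equally many \<open>U\<^sub>i\<close>.

  Otherwise, because every \<open>h w - w\<close> with \<open>h \<in> B\<^sub>i\<close> lies in \<open>U\<^sub>i\<close>, the \<open>W\<^sub>j\<close> moved by \<open>B\<^sub>i\<close> form a single orbit
  whose sum contains \<open>U\<^sub>i\<close>, and primitivity of \<open>H1\<close> forces \<open>U\<^sub>i \<inter> W\<^sub>j = 0\<close> for all \<open>j\<close>.  The orbits of
  different \<open>B\<^sub>i\<close> are equal or disjoint, as the \<open>B\<^sub>i\<close> commute.  They cannot all be disjoint, since
  then each \<open>U\<^sub>i\<close> would equal the sum of its orbit.  If \<open>B\<^sub>i\<close> and \<open>B\<^sub>i'\<close> share an orbit, comparing components
  of \<open>h (g w - w) = g w - w\<close> for \<open>g \<in> B\<^sub>i\<close> and \<open>h \<in> B\<^sub>i'\<close> shows that it has two elements; then \<open>U\<^sub>i\<close> and \<open>U\<^sub>i'\<close>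
  are the lines through \<open>w - g w\<close> and \<open>w + g w\<close>, the group \<open>H1\<close> has order 2, and no third \<open>B\<^sub>i\<close> shares the
  orbit, so that sharing an orbit is the pairing of the excluded case.

  In the first case a permutation \<open>s\<close> makes the blocks consecutive.  Choosing it by means of coset
  representatives \<open>\<sigma>\<^sub>j \<in> K1\<close> that carry the first block to the \<open>j\<close>-th one, the change of basis
  becomes a block diagonal matrix with entries \<open>h\<^sub>j b\<close>, where \<open>h\<^sub>j \<in> H2\<close> and \<open>b\<close> does not depend on \<open>j\<close>.
  Hence one conjugating element \<open>t = b\<^sup>-\<^sup>1\<close> suffices for (iii).
\<close>

section \<open>Permuted direct decompositions\<close>

text \<open>A direct decomposition of \<open>V\<close> given by its projections; the summands are
  the images \<open>part i\<close> defined below. The maps are linear on the whole type, but the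
  projection identities are required only on \<open>V\<close>.\<close>

locale projections = vector_space scale
  for scale :: "'a::field \<Rightarrow> 'v::ab_group_add \<Rightarrow> 'v" +
  fixes V :: "'v set" and I :: "nat set" and P :: "nat \<Rightarrow> 'v \<Rightarrow> 'v"
  assumes finite_index: "finite I"
    and subspace_V: "subspace V"
    and P_hom: "i \<in> I \<Longrightarrow> module_hom scale scale (P i)"
    and P_in: "i \<in> I \<Longrightarrow> v \<in> V \<Longrightarrow> P i v \<in> V"
    and P_sum: "v \<in> V \<Longrightarrow> (\<Sum>i\<in>I. P i v) = v"
    and P_orth: "i \<in> I \<Longrightarrow> j \<in> I \<Longrightarrow> v \<in> V \<Longrightarrow> P i (P j v) = (if i = j then P j v else 0)"
begin

definition part :: "nat \<Rightarrow> 'v set"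
  where "part i = P i ` V"

lemma P_add: "i \<in> I \<Longrightarrow> P i (x + y) = P i x + P i y"
  and P_diff: "i \<in> I \<Longrightarrow> P i (x - y) = P i x - P i y"
  and P_zero: "i \<in> I \<Longrightarrow> P i 0 = 0"
  and P_scale: "i \<in> I \<Longrightarrow> P i (scale c x) = scale c (P i x)"
  and P_sum_distrib: "i \<in> I \<Longrightarrow> P i (sum f A) = (\<Sum>a\<in>A. P i (f a))"
  using P_hom module_hom.add module_hom.diff module_hom.zero module_hom.scale module_hom.sum
  by metis+

lemma P_part [simp]: "i \<in> I \<Longrightarrow> v \<in> part i \<Longrightarrow> P i v = v"
  unfolding part_def using P_orth by auto

lemma P_other_part: "i \<in> I \<Longrightarrow> j \<in> I \<Longrightarrow> i \<noteq> j \<Longrightarrow> v \<in> part j \<Longrightarrow> P i v = 0"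
  unfolding part_def using P_orth by auto

lemma part_V: "i \<in> I \<Longrightarrow> v \<in> part i \<Longrightarrow> v \<in> V"
  unfolding part_def using P_in by auto

lemma P_in_part: "v \<in> V \<Longrightarrow> P i v \<in> part i"
  unfolding part_def by auto

lemma partI: "v \<in> V \<Longrightarrow> P i v = v \<Longrightarrow> v \<in> part i"
  unfolding part_def by (metis imageI)

lemma subspace_part: "i \<in> I \<Longrightarrow> subspace (part i)"
  unfolding part_def
  by (intro module_hom.subspace_image[OF P_hom] subspace_V)

lemma part_disjoint: "i \<in> I \<Longrightarrow> j \<in> I \<Longrightarrow> i \<noteq> j \<Longrightarrow> v \<in> part i \<Longrightarrow> v \<in> part j \<Longrightarrow> v = 0"
  using P_other_part P_part by metis

lemma eqI_P: "x \<in> V \<Longrightarrow> y \<in> V \<Longrightarrow> (\<And>i. i \<in> I \<Longrightarrow> P i x = P i y) \<Longrightarrow> x = y"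
  using P_sum[of x] P_sum[of y] by (metis (no_types, lifting) sum.cong)

end

text \<open>In the application \<open>U.part i\<close> is the i-th standard summand,
  \<open>G\<close> the wreath product, \<open>H i\<close> the copy of \<open>H1\<close> acting on
  that summand and \<open>L p\<close> the permutation matrix of \<open>p\<close>. Group elements are
  functions on the whole type of which only the values on \<open>V\<close> matter, so inverses and
  products are asserted pointwise there.\<close>

locale transitive_blocks = vector_space scale + U: projections scale V I P
  for scale :: "'a::field \<Rightarrow> 'v::ab_group_add \<Rightarrow> 'v" and V I P +
  fixes H :: "nat \<Rightarrow> ('v \<Rightarrow> 'v) set" and G :: "('v \<Rightarrow> 'v) set"
    and K :: "(nat \<Rightarrow> nat) set" and L :: "(nat \<Rightarrow> nat) \<Rightarrow> 'v \<Rightarrow> 'v"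
  assumes G_hom: "g \<in> G \<Longrightarrow> module_hom scale scale g"
    and G_V: "g \<in> G \<Longrightarrow> v \<in> V \<Longrightarrow> g v \<in> V"
    and G_inv: "g \<in> G \<Longrightarrow> \<exists>g'\<in>G. \<forall>v\<in>V. g' (g v) = v \<and> g (g' v) = v"
    and H_G: "i \<in> I \<Longrightarrow> h \<in> H i \<Longrightarrow> h \<in> G"
    and H_inv: "i \<in> I \<Longrightarrow> h \<in> H i \<Longrightarrow> \<exists>h'\<in>H i. \<forall>v\<in>V. h' (h v) = v \<and> h (h' v) = v"
    and H_comp: "i \<in> I \<Longrightarrow> h \<in> H i \<Longrightarrow> h' \<in> H i \<Longrightarrow> \<exists>h''\<in>H i. \<forall>v\<in>V. h'' v = h (h' v)"
    and H_move: "i \<in> I \<Longrightarrow> h \<in> H i \<Longrightarrow> v \<in> V \<Longrightarrow> h v - v \<in> U.part i"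
    and H_fix: "i \<in> I \<Longrightarrow> j \<in> I \<Longrightarrow> i \<noteq> j \<Longrightarrow> h \<in> H i \<Longrightarrow> v \<in> U.part j \<Longrightarrow> h v = v"
    and H_nontrivial: "i \<in> I \<Longrightarrow> \<exists>h\<in>H i. \<exists>v\<in>V. h v \<noteq> v"
    and H_irreducible: "i \<in> I \<Longrightarrow> subspace S \<Longrightarrow> S \<subseteq> U.part i \<Longrightarrow> (\<And>h v. h \<in> H i \<Longrightarrow> v \<in> S \<Longrightarrow> h v \<in> S)
      \<Longrightarrow> S = {0} \<or> S = U.part i"
    and K_perm: "p \<in> K \<Longrightarrow> p permutes I"
    and K_trans: "i \<in> I \<Longrightarrow> j \<in> I \<Longrightarrow> \<exists>p\<in>K. p i = j"
    and L_G: "p \<in> K \<Longrightarrow> L p \<in> G"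
    and L_U: "p \<in> K \<Longrightarrow> i \<in> I \<Longrightarrow> v \<in> U.part i \<Longrightarrow> L p v \<in> U.part (p i)"
    and L_H: "p \<in> K \<Longrightarrow> i \<in> I \<Longrightarrow> h \<in> H i \<Longrightarrow> \<exists>h'\<in>H (p i). \<forall>v\<in>V. L p (h v) = h' (L p v)"
begin

lemma G_add: "g \<in> G \<Longrightarrow> g (x + y) = g x + g y"
  and G_diff: "g \<in> G \<Longrightarrow> g (x - y) = g x - g y"
  and G_zero: "g \<in> G \<Longrightarrow> g 0 = 0"
  and G_scale: "g \<in> G \<Longrightarrow> g (scale c x) = scale c (g x)"
  and G_sum: "g \<in> G \<Longrightarrow> g (sum f A) = (\<Sum>a\<in>A. g (f a))"
  using G_hom module_hom.add module_hom.diff module_hom.zero module_hom.scale module_hom.sum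
  by metis+

lemma G_inj: "g \<in> G \<Longrightarrow> x \<in> V \<Longrightarrow> y \<in> V \<Longrightarrow> g x = g y \<Longrightarrow> x = y"
  using G_inv by metis

lemma G_nonzero: "g \<in> G \<Longrightarrow> x \<in> V \<Longrightarrow> x \<noteq> 0 \<Longrightarrow> g x \<noteq> 0"
  using G_inj[of g x 0] G_zero subspace_0[OF U.subspace_V] by auto

text \<open>The vector \<open>h v - v\<close> lies in \<open>U.part j\<close>, which
  \<open>g\<close> fixes, and symmetrically \<open>h\<close> fixes \<open>g v - v\<close>; so both
  sides equal \<open>g v + h v - v\<close>.\<close>

lemma H_commute:
  assumes "i \<in> I" "j \<in> I" "i \<noteq> j" "g \<in> H i" "h \<in> H j" "v \<in> V"
  shows "g (h v) = h (g v)"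
proof -
  have "g (h v - v) = h v - v" "h (g v - v) = g v - v"
    using assms H_move H_fix by metis+
  then have "g (h v) - g v = h v - v" "h (g v) - h v = g v - v"
    using assms G_diff H_G by metis+
  then have "g (h v) = h v - v + g v" "h (g v) = g v - v + h v" by (metis diff_add_cancel)+
  then show ?thesis by simp
qed

lemma H_in_U:
  assumes "i \<in> I" "h \<in> H i" "v \<in> U.part i" shows "h v \<in> U.part i"
proof -
  have "h v - v \<in> U.part i" using assms H_move U.part_V by blast
  then have "(h v - v) + v \<in> U.part i" using assms subspace_add U.subspace_part by blast
  then show ?thesis by simp
qed

text \<open>All components of \<open>v\<close> outside \<open>U.part i\<close> are fixed by
  \<open>h\<close> and cancel.\<close>

lemma H_proj:
  assumes "i \<in> I" "h \<in> H i" "v \<in> V"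
  shows "h v - v = h (P i v) - P i v"
proof -
  have "v - P i v = (\<Sum>j\<in>I - {i}. P j v)"
    using U.P_sum[OF assms(3)] U.finite_index assms(1)
    by (metis add_diff_cancel_left' sum.remove)
  moreover have "h (P j v) = P j v" if "j \<in> I - {i}" for j
    using H_fix[of i j h "P j v"] U.P_in_part[OF assms(3)] assms that by blast
  then have "h (\<Sum>j\<in>I - {i}. P j v) = (\<Sum>j\<in>I - {i}. P j v)"
    using assms by (simp add: G_sum[OF H_G])
  ultimately have "h (v - P i v) = v - P i v" by simp
  then show ?thesis using assms by (simp add: G_diff H_G algebra_simps)
qed

lemma subspace_Int_part: "i \<in> I \<Longrightarrow> subspace S \<Longrightarrow> subspace (U.part i \<inter> S)"
  by (simp add: subspace_inter U.subspace_part)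

text \<open>Irreducibility of \<open>H i\<close> applied to the intersection of
  \<open>U.part i\<close> and \<open>S\<close>. Most later uses of irreducibility go through this
  form.\<close>

lemma part_subset_invariant:
  assumes "i \<in> I" "subspace S" "\<And>h v. h \<in> H i \<Longrightarrow> v \<in> S \<Longrightarrow> h v \<in> S" "x \<in> U.part i" "x \<in> S" "x \<noteq> 0"
  shows "U.part i \<subseteq> S"
proof -
  have "U.part i \<inter> S = {0} \<or> U.part i \<inter> S = U.part i"
    using assms H_in_U by (intro H_irreducible subspace_Int_part) auto
  then show ?thesis using assms by auto
qed

text \<open>The common fixed vectors of \<open>H i\<close> form an invariant subspace. If it
  contained \<open>u\<close>, it would contain \<open>U.part i\<close>, and \<open>H i\<close> would
  act trivially on all of \<open>V\<close>.\<close>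

lemma not_fixed:
  assumes "i \<in> I" "u \<in> U.part i" "u \<noteq> 0"
  shows "\<exists>h\<in>H i. h u \<noteq> u"
proof (rule ccontr)
  assume fixed: "\<not> ?thesis"
  define S where "S = {v. \<forall>h\<in>H i. h v = v}"
  have "subspace S"
    unfolding S_def subspace_def using assms by (auto simp: H_G G_zero G_add G_scale)
  moreover have Sfix: "h v = v" if "h \<in> H i" "v \<in> S" for h v using that by (simp add: S_def)
  moreover have "u \<in> S" using fixed by (simp add: S_def)
  ultimately have "U.part i \<subseteq> S"
    using part_subset_invariant[OF assms(1) _ _ assms(2) _ assms(3), of S] by (metis (no_types))
  moreover obtain h v where "h \<in> H i" "v \<in> V" "h v \<noteq> v" using H_nontrivial assms by blast
  moreover have "P i v \<in> U.part i" using U.P_in_part \<open>v \<in> V\<close> .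
  ultimately show False using H_proj[of i h v] Sfix[of h "P i v"] assms(1) by auto
qed

text \<open>If \<open>v\<close> in \<open>S\<close> has a nonzero component in
  \<open>U.part i\<close>, then some \<open>h v - v\<close> is a nonzero vector of \<open>S\<close>
  inside \<open>U.part i\<close>. The maps \<open>L p\<close> carry it into every other
  \<open>U.part j\<close>, so \<open>S\<close> contains all of them.\<close>

theorem irreducible:
  assumes "subspace S" "S \<subseteq> V" "\<And>g v. g \<in> G \<Longrightarrow> v \<in> S \<Longrightarrow> g v \<in> S"
  shows "S = {0} \<or> S = V"
proof (cases "S = {0}")
  case False
  then obtain v where v: "v \<in> S" "v \<noteq> 0" using subspace_0[OF assms(1)] by blast
  have vV: "v \<in> V" using v assms by blast
  obtain i where i: "i \<in> I" "P i v \<noteq> 0"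
    using U.P_sum[OF vV] v by (metis sum.neutral)
  obtain h where h: "h \<in> H i" "h (P i v) \<noteq> P i v"
    using not_fixed i U.P_in_part vV by metis
  define u where "u = h v - v"
  have u: "u \<in> S" "u \<noteq> 0" "u \<in> U.part i"
    using subspace_diff[OF assms(1) assms(3)[OF H_G[OF i(1) h(1)] v(1)] v(1)]
      H_proj[OF i(1) h(1) vV] h(2) H_move[OF i(1) h(1) vV] unfolding u_def by auto
  have "U.part j \<subseteq> S" if j: "j \<in> I" for j
  proof -
    obtain p where p: "p \<in> K" "p i = j" using K_trans i j by blast
    show ?thesis
      by (rule part_subset_invariant[OF j assms(1), of "L p u"])
        (use assms j p i u L_G L_U H_G G_nonzero U.part_V in \<open>blast+\<close>)
  qed
  then have "x \<in> S" if "x \<in> V" for x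
    using U.P_sum[OF that] U.P_in_part[OF that] subspace_sum[OF assms(1), of I "\<lambda>i. P i x"]
    by auto
  then show ?thesis using assms(2) by blast
qed simp

end

text \<open>The second decomposition, with projections \<open>R\<close> and index set
  \<open>J\<close>, is permuted by \<open>G\<close>. Primitivity of \<open>H i\<close> is stated for
  decompositions of \<open>U.part i\<close> cut out by the same maps \<open>R\<close>, which are the
  ones that arise below.\<close>

locale two_decompositions = transitive_blocks scale V I P H G K L + W: projections scale V J R
  for scale :: "'a::field \<Rightarrow> 'v::ab_group_add \<Rightarrow> 'v" and V I P H G K L J R +
  assumes W_nonzero: "j \<in> J \<Longrightarrow> \<exists>w\<in>W.part j. w \<noteq> 0"
    and G_W: "g \<in> G \<Longrightarrow> j \<in> J \<Longrightarrow> \<exists>c\<in>J. \<forall>w\<in>W.part j. g w \<in> W.part c"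
    and H_primitive: "i \<in> I \<Longrightarrow> projections scale (U.part i) M R
      \<Longrightarrow> (\<And>b. b \<in> M \<Longrightarrow> \<exists>v\<in>U.part i. R b v \<noteq> 0)
      \<Longrightarrow> (\<And>h b. h \<in> H i \<Longrightarrow> b \<in> M \<Longrightarrow> \<exists>c\<in>M. \<forall>v\<in>U.part i. h (R b v) = R c (h v))
      \<Longrightarrow> card M \<le> 1"
begin

text \<open>The permutation of \<open>J\<close> induced by \<open>g\<close>. \<open>G_W\<close>
  gives only the existence of a target, hence the choice; the target is unique because the summands
  are nonzero and independent.\<close>

definition tau :: "('v \<Rightarrow> 'v) \<Rightarrow> nat \<Rightarrow> nat"
  where "tau g j = (SOME c. c \<in> J \<and> (\<forall>w\<in>W.part j. g w \<in> W.part c))"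

lemma tau:
  assumes "g \<in> G" "j \<in> J"
  shows tau_in: "tau g j \<in> J" and tau_W: "w \<in> W.part j \<Longrightarrow> g w \<in> W.part (tau g j)"
  using someI_ex[of "\<lambda>c. c \<in> J \<and> (\<forall>w\<in>W.part j. g w \<in> W.part c)"] G_W[OF assms]
  unfolding tau_def by blast+

lemma tau_unique:
  assumes "g \<in> G" "j \<in> J" "c \<in> J" "w \<in> W.part j" "w \<noteq> 0" "g w \<in> W.part c"
  shows "tau g j = c"
  using assms tau_in tau_W W.part_disjoint G_nonzero W.part_V by metis

lemma tau_eqI:
  assumes "g \<in> G" "j \<in> J" "c \<in> J" "\<And>w. w \<in> W.part j \<Longrightarrow> g w \<in> W.part c"
  shows "tau g j = c"
  using W_nonzero[OF assms(2)] tau_unique assms by blast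

lemma tau_inverse:
  assumes "g \<in> G" "g' \<in> G" "\<forall>v\<in>V. g' (g v) = v" "j \<in> J"
  shows "tau g' (tau g j) = j"
proof -
  obtain w where w: "w \<in> W.part j" "w \<noteq> 0" using W_nonzero assms by blast
  have "g w \<noteq> 0" using G_nonzero assms w W.part_V by blast
  moreover have "g' (g w) \<in> W.part j" using w assms W.part_V by auto
  ultimately show ?thesis
    using tau_unique[of g' "tau g j" j "g w"] assms tau_in tau_W w by blast
qed

lemma tau_inj: "g \<in> G \<Longrightarrow> a \<in> J \<Longrightarrow> b \<in> J \<Longrightarrow> tau g a = tau g b \<Longrightarrow> a = b"
  using tau_inverse G_inv by metis

lemma tau_comp:
  assumes "g \<in> G" "h \<in> G" "f \<in> G" "\<forall>v\<in>V. f v = g (h v)" "j \<in> J"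
  shows "tau f j = tau g (tau h j)"
  using assms by (intro tau_eqI) (auto simp: tau_in tau_W W.part_V)

text \<open>Expand \<open>v\<close> into its components: \<open>g\<close> sends the one in
  \<open>W.part a\<close> into \<open>W.part (tau g a)\<close>, and \<open>tau g\<close> is
  injective, so only \<open>a = j\<close> survives.\<close>

lemma R_tau:
  assumes "g \<in> G" "j \<in> J" "v \<in> V"
  shows "R (tau g j) (g v) = g (R j v)"
proof -
  have "R (tau g j) (g v) = (\<Sum>a\<in>J. R (tau g j) (g (R a v)))"
    by (subst (1) W.P_sum[OF assms(3), symmetric]) (simp add: assms G_sum W.P_sum_distrib tau_in)
  also have "\<dots> = (\<Sum>a\<in>J. if a = j then g (R a v) else 0)"
  proof (rule sum.cong[OF refl])
    fix a assume a: "a \<in> J"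
    have "g (R a v) \<in> W.part (tau g a)" using tau_W a assms W.P_in_part by blast
    then show "R (tau g j) (g (R a v)) = (if a = j then g (R a v) else 0)"
      using W.P_other_part tau_in tau_inj a assms by (metis W.P_part)
  qed
  also have "\<dots> = g (R j v)" using W.finite_index assms by simp
  finally show ?thesis .
qed

text \<open>The previous identity with the target index prescribed; invertibility of
  \<open>g\<close> supplies the source index \<open>a\<close>.\<close>

lemma R_G_commute:
  assumes "g \<in> G" "c \<in> J" "v \<in> V"
  shows "\<exists>a\<in>J. tau g a = c \<and> R c (g v) = g (R a v)"
proof -
  obtain g' where g': "g' \<in> G" "\<forall>v\<in>V. g' (g v) = v \<and> g (g' v) = v" using G_inv assms by blast
  then have "tau g (tau g' c) = c" using tau_inverse[of g' g c] assms by blast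
  then show ?thesis using R_tau[of g "tau g' c" v] g' assms tau_in by metis
qed

section \<open>The summands moved by one base factor\<close>

definition moved :: "nat \<Rightarrow> nat set"
  where "moved i = {j\<in>J. \<exists>h\<in>H i. tau h j \<noteq> j}"

lemma movedI: "j \<in> J \<Longrightarrow> h \<in> H i \<Longrightarrow> tau h j \<noteq> j \<Longrightarrow> j \<in> moved i"
  unfolding moved_def by blast

lemma moved_J: "a \<in> moved i \<Longrightarrow> a \<in> J"
  by (simp add: moved_def)

text \<open>A nontrivial \<open>h\<close> changes some component \<open>R j v\<close>. As
  \<open>W.part j\<close> is invariant, the difference \<open>h (R j v) - R j v\<close> is a nonzero
  vector in both \<open>U.part i\<close> and \<open>W.part j\<close>, and irreducibility does the
  rest.\<close>

lemma moved_empty_part: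
  assumes i: "i \<in> I" and "moved i = {}"
  shows "\<exists>j\<in>J. U.part i \<subseteq> W.part j"
proof -
  obtain h v where hv: "h \<in> H i" "v \<in> V" "h v \<noteq> v" using H_nontrivial i by blast
  have "\<exists>j\<in>J. h (R j v) \<noteq> R j v"
  proof (rule ccontr)
    assume "\<not> ?thesis"
    then have "h (\<Sum>j\<in>J. R j v) = (\<Sum>j\<in>J. R j v)"
      using i hv by (simp add: G_sum[OF H_G])
    then show False using W.P_sum hv by simp
  qed
  then obtain j where j: "j \<in> J" "h (R j v) \<noteq> R j v" by blast
  have inv: "g w \<in> W.part j" if "g \<in> H i" "w \<in> W.part j" for g w
    using tau_W[of g j w] H_G i that j assms(2) by (auto simp: moved_def)
  have Rv: "R j v \<in> V" "R j v \<in> W.part j" using W.P_in W.P_in_part j hv by blast+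
  have "h (R j v) - R j v \<in> W.part j"
    using subspace_diff[OF W.subspace_part[OF j(1)] inv[OF hv(1) Rv(2)] Rv(2)] .
  then have "U.part i \<subseteq> W.part j"
    using part_subset_invariant[OF i W.subspace_part[OF j(1)], of "h (R j v) - R j v"]
      inv H_move[OF i hv(1) Rv(1)] j(2) by auto
  then show ?thesis using j by blast
qed

text \<open>The sum of the summands indexed by \<open>A\<close>, described through the vanishing of
  the other components.\<close>

definition supported :: "nat set \<Rightarrow> 'v set"
  where "supported A = {v\<in>V. \<forall>b\<in>J - A. R b v = 0}"

lemma subspace_supported: "subspace (supported A)"
  using U.subspace_V unfolding subspace_def supported_def
  by (auto simp: W.P_zero W.P_add W.P_scale)

text \<open>Let \<open>Orb\<close> be the orbit of \<open>a\<close>. For \<open>w\<close> in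
  \<open>W.part a\<close> and \<open>h\<close> moving \<open>a\<close>, the nonzero vector
  \<open>h w - w\<close> of \<open>U.part i\<close> is supported on \<open>Orb\<close>, so
  irreducibility puts all of \<open>U.part i\<close> there. This leaves no room for a second
  nontrivial orbit.\<close>

lemma moved_orbit:
  assumes i: "i \<in> I" and a: "a \<in> moved i"
  shows U_moved: "U.part i \<subseteq> supported (moved i)"
    and moved_transitive: "b \<in> moved i \<Longrightarrow> \<exists>h\<in>H i. tau h a = b"
proof -
  define Orb where "Orb = (\<lambda>h. tau h a) ` H i"
  obtain h where h: "h \<in> H i" "tau h a \<noteq> a" and aJ: "a \<in> J" using a by (auto simp: moved_def)
  obtain w where w: "w \<in> W.part a" "w \<noteq> 0" using W_nonzero aJ by blast
  have G: "\<And>h. h \<in> H i \<Longrightarrow> h \<in> G" using H_G i by blast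
  have Orb_J: "Orb \<subseteq> J" unfolding Orb_def using tau_in aJ G by blast
  have Orb_inv: "tau g b \<in> Orb" if g: "g \<in> H i" and b: "b \<in> Orb" for g b
  proof -
    obtain f where f: "f \<in> H i" "b = tau f a" using b unfolding Orb_def by blast
    obtain f' where f': "f' \<in> H i" "\<forall>v\<in>V. f' v = g (f v)" using H_comp[OF i g f(1)] by blast
    have "tau f' a = tau g b" using tau_comp[of g f f' a] f f' g G aJ by blast
    then show ?thesis using f' unfolding Orb_def by (metis imageI)
  qed
  have Orb_inv': "b \<in> Orb" if g: "g \<in> H i" and b: "b \<in> J" "tau g b \<in> Orb" for g b
  proof -
    obtain g' where g': "g' \<in> H i" "\<forall>v\<in>V. g' (g v) = v" using H_inv i g by meson
    have "tau g' (tau g b) = b" using tau_inverse g b g' G by blast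
    then show ?thesis using Orb_inv g' b by metis
  qed
  \<comment> \<open>The orbit contains its base point because an inverse of \<open>h\<close> brings
    \<open>tau h a\<close> back to \<open>a\<close>.\<close>
  have a_Orb: "a \<in> Orb" using Orb_inv'[OF h(1) aJ] h by (auto simp: Orb_def)
  have inv: "g v \<in> supported Orb" if g: "g \<in> H i" and v: "v \<in> supported Orb" for g v
  proof -
    have "R c (g v) = 0" if c: "c \<in> J - Orb" for c
    proof -
      obtain b where "b \<in> J" "tau g b = c" "R c (g v) = g (R b v)"
        using R_G_commute[of g c v] g v c G by (auto simp: supported_def)
      moreover from this have "R b v = 0" using Orb_inv[OF g, of b] c v by (auto simp: supported_def)
      ultimately show ?thesis using G_zero[OF G[OF g]] by simp
    qed
    then show ?thesis using v G_V G g by (auto simp: supported_def)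
  qed
  have w_V: "w \<in> V" "h w \<in> V" using w aJ W.part_V G_V G h by blast+
  have hw: "h w \<in> W.part (tau h a)" using tau_W G h aJ w by blast
  have "R b (h w - w) = 0" if "b \<in> J - Orb" for b
  proof -
    have "b \<noteq> a" "b \<noteq> tau h a" using a_Orb that h by (auto simp: Orb_def)
    then show ?thesis
      using that W.P_other_part[OF _ _ _ hw] W.P_other_part[OF _ aJ _ w(1)] tau_in[OF G[OF h(1)] aJ]
      by (simp add: W.P_diff)
  qed
  then have "h w - w \<in> supported Orb"
    using w_V subspace_diff[OF U.subspace_V] by (auto simp: supported_def)
  moreover have "h w - w \<noteq> 0"
    using W.part_disjoint[OF aJ tau_in[OF G[OF h(1)] aJ]] h hw w by (metis eq_iff_diff_eq_0)
  ultimately have U_Orb: "U.part i \<subseteq> supported Orb"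
    using part_subset_invariant[OF i subspace_supported, of "Orb" "h w - w"] inv
      H_move[OF i h(1) w_V(1)] by blast
  \<comment> \<open>If \<open>g\<close> moves an index \<open>b\<close> outside \<open>Orb\<close>,
    then \<open>g x - x\<close> has component \<open>- x\<close> at \<open>b\<close>, although it
    lies in \<open>U.part i\<close> and so is supported on \<open>Orb\<close>.\<close>
  have "b \<in> Orb" if b: "b \<in> moved i" for b
  proof (rule ccontr)
    assume nb: "b \<notin> Orb"
    obtain g where g: "g \<in> H i" "tau g b \<noteq> b" and bJ: "b \<in> J" using b by (auto simp: moved_def)
    obtain x where x: "x \<in> W.part b" "x \<noteq> 0" using W_nonzero bJ by blast
    have "R b (g x - x) = 0"
      using H_move[OF i g(1), of x] U_Orb x bJ W.part_V nb by (auto simp: supported_def)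
    moreover have "R b (g x) = 0"
      using W.P_other_part[of b "tau g b" "g x"] g bJ tau_in tau_W x G by metis
    ultimately show False using x bJ by (simp add: W.P_diff)
  qed
  moreover have "b \<in> moved i" if b: "b \<in> Orb" for b
  proof (rule ccontr)
    assume nb: "b \<notin> moved i"
    obtain f where f: "f \<in> H i" "b = tau f a" using b by (auto simp: Orb_def)
    obtain f' where f': "f' \<in> H i" "\<forall>v\<in>V. f' (f v) = v" using H_inv i f by meson
    have "tau f' b = a" using tau_inverse f f' G aJ by blast
    then have "a = b" using nb f' b Orb_J by (auto simp: moved_def)
    then show False using a nb by blast
  qed
  ultimately have Orb_eq: "Orb = moved i" by blast
  show "U.part i \<subseteq> supported (moved i)" using U_Orb Orb_eq by simp
  show "\<exists>h\<in>H i. tau h a = b" if "b \<in> moved i" using that Orb_eq unfolding Orb_def by (metis imageE)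
qed

lemma tau_moved:
  assumes "i \<in> I" "g \<in> H i" "b \<in> moved i" shows "tau g b \<in> moved i"
proof (rule ccontr)
  assume n: "tau g b \<notin> moved i"
  have b: "b \<in> J" "g \<in> G" using assms moved_J H_G by blast+
  have "tau g (tau g b) = tau g b" using n assms tau_in b by (auto simp: moved_def)
  then have "tau g b = b" using tau_inj b tau_in by blast
  then show False using n assms by simp
qed

lemma card_moved:
  assumes i: "i \<in> I" and a: "a \<in> moved i"
  shows "1 < card (moved i)"
proof -
  obtain h where h: "h \<in> H i" "tau h a \<noteq> a" using a by (auto simp: moved_def)
  have "{a, tau h a} \<subseteq> moved i" using a tau_moved i h by blast
  moreover have "finite (moved i)" using W.finite_index by (simp add: moved_def)
  ultimately have "card {a, tau h a} \<le> card (moved i)" using card_mono by blast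
  then show ?thesis using h by simp
qed

lemma R_unmoved: "i \<in> I \<Longrightarrow> a \<in> moved i \<Longrightarrow> v \<in> U.part i \<Longrightarrow> b \<in> J \<Longrightarrow> b \<notin> moved i \<Longrightarrow> R b v = 0"
  using U_moved by (auto simp: supported_def)

(* Otherwise the intersections with the summands W would be a system of imprimitivity for H i. *)
lemma U_W_trivial:
  assumes i: "i \<in> I" and a: "a \<in> moved i" and c: "c \<in> J"
    and x: "x \<in> U.part i" "x \<in> W.part c"
  shows "x = 0"
proof (rule ccontr)
  assume x0: "x \<noteq> 0"
  have G: "\<And>h. h \<in> H i \<Longrightarrow> h \<in> G" using H_G i by blast
  \<comment> \<open>The vector \<open>x\<close> lies in \<open>S\<close>, so irreducibility gives
    that every vector of \<open>U.part i\<close> has all its \<open>R\<close>-components inside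
    \<open>U.part i\<close>; the maps \<open>R\<close> then decompose
    \<open>U.part i\<close>.\<close>
  define S where "S = {v. \<forall>b\<in>J. R b v \<in> U.part i}"
  have S: "subspace S"
    using U.subspace_part[OF i] unfolding S_def subspace_def
    by (auto simp: W.P_zero W.P_add W.P_scale)
  have xS: "x \<in> S"
    unfolding S_def using W.P_other_part c x W.P_part subspace_0[OF U.subspace_part[OF i]] by fastforce
  have "U.part i \<inter> S = {0} \<or> U.part i \<inter> S = U.part i"
  proof (rule H_irreducible[OF i subspace_Int_part[OF i S]])
    fix h v assume h: "h \<in> H i" and v: "v \<in> U.part i \<inter> S"
    have "R b (h v) \<in> U.part i" if b: "b \<in> J" for b
    proof -
      have vV: "v \<in> V" using v U.part_V i by blast
      obtain a where "a \<in> J" "R b (h v) = h (R a v)"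
        using R_G_commute[OF G[OF h] b vV] by blast
      then show ?thesis using v h H_in_U i by (auto simp: S_def)
    qed
    then show "h v \<in> U.part i \<inter> S" using H_in_U i h v by (auto simp: S_def)
  qed auto
  then have US: "U.part i \<subseteq> S" using x x0 xS by blast
  have "x = R c x" using x c by simp
  then have cM: "c \<in> moved i" using R_unmoved i a x(1) c x0 by metis
  have sub: "moved i \<subseteq> J" using moved_J by blast
  have "projections scale (U.part i) (moved i) R"
  proof (intro projections.intro projections_axioms.intro)
    show "vector_space scale" by (rule vector_space_axioms)
    show "finite (moved i)" using W.finite_index sub finite_subset by blast
    show "subspace (U.part i)" using U.subspace_part i .
    show "module_hom scale scale (R b)" if "b \<in> moved i" for b using W.P_hom that moved_J by blast
    show "R b v \<in> U.part i" if "b \<in> moved i" "v \<in> U.part i" for b v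
      using US that moved_J by (auto simp: S_def)
    show "(\<Sum>b\<in>moved i. R b v) = v" if v: "v \<in> U.part i" for v
    proof -
      have "(\<Sum>b\<in>moved i. R b v) = (\<Sum>b\<in>J. R b v)"
        using R_unmoved i a v sub W.finite_index by (intro sum.mono_neutral_left) auto
      then show ?thesis using W.P_sum U.part_V i v by auto
    qed
    show "R b (R b' v) = (if b = b' then R b' v else 0)"
      if "b \<in> moved i" "b' \<in> moved i" "v \<in> U.part i" for b b' v
      using W.P_orth that moved_J U.part_V i by blast
  qed
  then have "card (moved i) \<le> 1"
  proof (rule H_primitive[OF i])
    \<comment> \<open>Transitivity on \<open>moved i\<close> carries the nonzero vector
      \<open>x\<close> into each summand of this decomposition.\<close>
    show "\<exists>v\<in>U.part i. R b v \<noteq> 0" if b: "b \<in> moved i" for b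
    proof -
      obtain h where h: "h \<in> H i" "tau h c = b" using moved_transitive[OF i cM b] by blast
      have "R b (h x) = h x" using h tau_W G c x b moved_J by fastforce
      then show ?thesis using h x x0 H_in_U i G G_nonzero U.part_V by metis
    qed
    show "\<exists>c\<in>moved i. \<forall>v\<in>U.part i. h (R b v) = R c (h v)" if "h \<in> H i" "b \<in> moved i" for h b
      using that tau_moved i R_tau G moved_J U.part_V by metis
  qed
  then show False using card_moved[OF i a] by simp
qed

text \<open>The difference \<open>h w - w\<close> lies in both \<open>U.part i\<close> and
  \<open>W.part b\<close>, which meet trivially.\<close>

lemma stabiliser_trivial:
  assumes i: "i \<in> I" and a: "a \<in> moved i" and "b \<in> J" "h \<in> H i" "tau h b = b" "w \<in> W.part b"
  shows "h w = w"
proof -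
  have "h w - w \<in> U.part i" using H_move assms W.part_V by blast
  moreover have "h w - w \<in> W.part b"
    using assms tau_W[of h b w] H_G subspace_diff W.subspace_part by metis
  ultimately have "h w - w = 0" using U_W_trivial assms by blast
  then show ?thesis by simp
qed

text \<open>Elements of different base factors commute, so if \<open>h\<close> moves
  \<open>a\<close>, it also moves every image \<open>tau g a\<close> under the other factor; that
  factor is transitive on the indices it moves.\<close>

lemma moved_eq:
  assumes i: "i \<in> I" and j: "j \<in> I" and a: "a \<in> moved i" "a \<in> moved j"
  shows "moved i = moved j"
proof -
  have sub: "moved j \<subseteq> moved i"
    if i: "i \<in> I" and j: "j \<in> I" and ij: "i \<noteq> j" and a: "a \<in> moved i" "a \<in> moved j" for i j
  proof
    fix b assume b: "b \<in> moved j"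
    obtain g where g: "g \<in> H j" "tau g a = b" using moved_transitive[OF j a(2) b] by blast
    obtain h where h: "h \<in> H i" "tau h a \<noteq> a" and aJ: "a \<in> J" using a by (auto simp: moved_def)
    have GG: "g \<in> G" "h \<in> G" using g h i j H_G by blast+
    have "tau h (tau g a) = tau g (tau h a)"
    proof (rule tau_eqI[OF GG(2)])
      show "tau g a \<in> J" "tau g (tau h a) \<in> J" using tau_in GG aJ by blast+
      fix w assume w: "w \<in> W.part (tau g a)"
      obtain g' where g': "g' \<in> G" "\<forall>v\<in>V. g' (g v) = v \<and> g (g' v) = v" using G_inv GG by blast
      have wV: "w \<in> V" using w W.part_V tau_in GG aJ by blast
      have g'w: "g' w \<in> W.part a" using tau_W[of g' "tau g a" w] tau_inverse[of g g' a] w g' GG aJ tau_in by metis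
      have "h w = h (g (g' w))" using g' wV by simp
      also have "\<dots> = g (h (g' w))"
        using H_commute[OF i j ij h(1) g(1), of "g' w"] g'w W.part_V aJ by blast
      finally show "h w \<in> W.part (tau g (tau h a))" using tau_W g'w GG aJ tau_in by metis
    qed
    then have "tau h b \<noteq> b" using g h tau_inj[OF GG(1)] tau_in GG aJ by metis
    then show "b \<in> moved i" using movedI[OF moved_J[OF b] h(1)] by blast
  qed
  show ?thesis
  proof (cases "i = j")
    case False
    then show ?thesis using sub[of i j] sub[of j i] assms by blast
  qed simp
qed

text \<open>Otherwise take a nonzero \<open>x\<close> in \<open>W.part a\<close>. At an index of
  \<open>moved i\<close> no component \<open>P j x\<close> with \<open>j \<noteq> i\<close>
  contributes, and elsewhere both \<open>x\<close> and \<open>P i x\<close> vanish. Hence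
  \<open>x = P i x\<close> lies in \<open>U.part i\<close>, contradicting
  \<open>U_W_trivial\<close>.\<close>

lemma moved_shared:
  assumes i: "i \<in> I" and a: "a \<in> moved i"
    and nonempty: "\<And>j. j \<in> I \<Longrightarrow> moved j \<noteq> {}"
  shows "\<exists>j\<in>I. j \<noteq> i \<and> moved j = moved i"
proof (rule ccontr)
  assume c: "\<not> ?thesis"
  have disj: "b \<notin> moved j" if "b \<in> moved i" "j \<in> I" "j \<noteq> i" for b j
    using c moved_eq[OF i, of j b] that by auto
  have aJ: "a \<in> J" using a moved_J by blast
  obtain x where x: "x \<in> W.part a" "x \<noteq> 0" using W_nonzero aJ by blast
  have xV: "x \<in> V" using x W.part_V aJ by blast
  have PV: "\<And>j. j \<in> I \<Longrightarrow> P j x \<in> V" using U.P_in xV by blast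
  have "x = P i x"
  proof (rule W.eqI_P[OF xV PV[OF i]])
    fix b assume b: "b \<in> J"
    show "R b x = R b (P i x)"
    proof (cases "b \<in> moved i")
      case True
      have "R b (P j x) = 0" if "j \<in> I" "j \<noteq> i" for j
        using nonempty[OF that(1)] disj[OF True that] R_unmoved that b U.P_in_part xV by blast
      then have "R b (\<Sum>j\<in>I. P j x) = (\<Sum>j\<in>I. if j = i then R b (P j x) else 0)"
        using b by (auto simp: W.P_sum_distrib intro!: sum.cong)
      then show ?thesis using U.P_sum[OF xV] U.finite_index i by simp
    next
      case False
      then have "b \<noteq> a" using a by blast
      then show ?thesis
        using R_unmoved[OF i a _ b False] U.P_in_part xV W.P_other_part[OF b aJ _ x(1)] by metis
    qed
  qed
  then have "x \<in> U.part i" using U.P_in_part xV by metis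
  then show False using U_W_trivial[OF i a aJ] x by blast
qed

text \<open>Every \<open>f\<close> in \<open>H i\<close> moving \<open>a\<close> satisfies
  \<open>tau h (tau f a) = a\<close>. Since \<open>tau h\<close> is injective, all such
  \<open>f\<close> send \<open>a\<close> to the same index, so the orbit has two elements.\<close>

lemma shared_swap:
  assumes i: "i \<in> I" and j: "j \<in> I" and ij: "i \<noteq> j" and eq: "moved j = moved i"
    and g: "g \<in> H i" "tau g a \<noteq> a" and h: "h \<in> H j" "tau h a \<noteq> a"
    and aJ: "a \<in> J" and w: "w \<in> W.part a" "w \<noteq> 0"
  shows "moved i = {a, tau g a}" and "h w = - g w"
proof -
  have GG: "\<And>h. h \<in> H i \<Longrightarrow> h \<in> G" "\<And>h. h \<in> H j \<Longrightarrow> h \<in> G" using H_G i j by blast+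
  have hG: "h \<in> G" using GG h by blast
  have wV: "w \<in> V" using w W.part_V aJ by blast
  have hw: "h w \<in> W.part (tau h a)" using tau_W hG aJ w by blast
  have aM: "a \<in> moved i" using movedI[OF aJ g] .
  \<comment> \<open>Compare components at \<open>a\<close> in \<open>h (f w - w) = f w - w\<close>:
    both \<open>f w\<close> and \<open>h w\<close> lie in other summands, so \<open>h (f w)\<close>
    has component \<open>- w\<close>. As it lies in a single summand, it equals
    \<open>- w\<close>.\<close>
  have *: "tau h (tau f a) = a \<and> h (f w) = - w \<and> h w = - f w"
    if f: "f \<in> H i" "tau f a \<noteq> a" for f
  proof -
    have fG: "f \<in> G" using f GG by blast
    have fw: "f w \<in> W.part (tau f a)" using tau_W fG aJ w by blast
    have fJ: "tau f a \<in> J" "tau h a \<in> J" "tau h (tau f a) \<in> J" using tau_in fG hG aJ by blast+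
    have hfw: "h (f w) \<in> W.part (tau h (tau f a))" using tau_W hG fJ fw by blast
    have "h (f w - w) = f w - w"
      using H_fix[of j i h] ij i j h H_move[OF i f(1) wV] by auto
    then have e: "h (f w) - h w = f w - w" using G_diff hG by metis
    then have "R a (h (f w)) = - w"
      using W.P_diff[OF aJ, of "h (f w)" "h w"] W.P_diff[OF aJ, of "f w" w] W.P_other_part[OF aJ fJ(1) _ fw] f(2)
        W.P_other_part[OF aJ fJ(2) _ hw] h(2) W.P_part[OF aJ w(1)]
      by auto
    moreover from this have "tau h (tau f a) = a"
      using W.P_other_part[OF aJ fJ(3) _ hfw] w by fastforce
    moreover from calculation have "h (f w) = - w"
      using hfw W.P_part[OF aJ] by auto
    moreover from calculation have "- h w = f w" using e by (simp add: algebra_simps)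
    then have "h w = - f w" by (metis minus_minus)
    ultimately show ?thesis by blast
  qed
  have sub: "b \<in> {a, tau g a}" if b: "b \<in> moved i" for b
  proof (cases "b = a")
    case False
    obtain f where f: "f \<in> H i" "tau f a = b" using moved_transitive[OF i aM b] by blast
    then have "tau h (tau f a) = tau h (tau g a)" using * False g by auto
    then have "tau f a = tau g a" using tau_inj hG tau_in aJ GG f g by blast
    then show ?thesis using f by simp
  qed simp
  moreover have "tau g a \<in> moved i" using tau_moved i g aM by blast
  ultimately show "moved i = {a, tau g a}" using aM by blast
  show "h w = - g w" using * g by blast
qed

text \<open>An element of \<open>H i\<close> fixing \<open>a\<close> fixes the whole two-element
  orbit and is trivial on \<open>V\<close>, so \<open>H i\<close> acts as a group of order 2. Its
  nontrivial element \<open>g\<close> negates \<open>u = g w - w\<close>, and the invariant line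
  through \<open>u\<close> must contain \<open>U.part i\<close>.\<close>

lemma shared_line:
  assumes i: "i \<in> I" and j: "j \<in> I" and ij: "i \<noteq> j" and eq: "moved j = moved i" and a: "a \<in> moved i"
  shows "(\<exists>u. \<forall>v\<in>U.part i. \<exists>c. v = scale c u) \<and>
    (\<exists>g\<in>H i. (\<exists>v\<in>V. g v \<noteq> v) \<and> (\<forall>h\<in>H i. (\<forall>v\<in>V. h v = v) \<or> (\<forall>v\<in>V. h v = g v)))"
proof -
  obtain g where g: "g \<in> H i" "tau g a \<noteq> a" and aJ: "a \<in> J" using a by (auto simp: moved_def)
  obtain h where h: "h \<in> H j" "tau h a \<noteq> a" using a eq by (auto simp: moved_def)
  obtain w where w: "w \<in> W.part a" "w \<noteq> 0" using W_nonzero aJ by blast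
  define b where "b = tau g a"
  have M: "moved i = {a, b}"
    using shared_swap(1)[OF i j ij eq g h aJ w] by (simp add: b_def)
  have G: "\<And>h. h \<in> H i \<Longrightarrow> h \<in> G" using H_G i by blast
  have ab: "a \<noteq> b" "b \<in> J" using g G aJ tau_in by (auto simp: b_def)
  have triv: "f v = v" if f: "f \<in> H i" "tau f a = a" and v: "v \<in> V" for f v
  proof -
    have "tau f c = c" if "c \<in> J" for c
    proof (cases "c \<in> moved i")
      case True
      then show ?thesis using tau_moved[OF i f(1), of b] tau_inj[OF G[OF f(1)], of a b] f M ab aJ by auto
    qed (use that f in \<open>auto simp: moved_def\<close>)
    then have "f (R c v) = R c v" if "c \<in> J" for c
      using stabiliser_trivial[OF i a] that f v W.P_in_part by blast
    then have "f (\<Sum>c\<in>J. R c v) = (\<Sum>c\<in>J. R c v)"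
      using f by (simp add: G_sum[OF G])
    then show ?thesis using W.P_sum v by simp
  qed
  obtain g' where g': "g' \<in> H i" "\<forall>v\<in>V. g' (g v) = v \<and> g (g' v) = v" using H_inv i g by blast
  have g'b: "tau g' b = a"
    using tau_inverse[OF G[OF g(1)] G[OF g'(1)] _ aJ] g'(2) by (simp add: b_def)
  \<comment> \<open>Both \<open>f\<close> and \<open>g\<close> send \<open>a\<close> to
    \<open>b\<close>, so the product of \<open>f\<close> with an inverse of \<open>g\<close> fixes
    \<open>a\<close> and is trivial.\<close>
  have two: "f v = g v" if f: "f \<in> H i" "tau f a \<noteq> a" and v: "v \<in> V" for f v
  proof -
    have "tau f a = b" using tau_moved[OF i f(1) a] M f by blast
    obtain f' where f': "f' \<in> H i" "\<forall>v\<in>V. f' v = g' (f v)" using H_comp[OF i g'(1) f(1)] by blast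
    have "tau f' a = a"
      using tau_comp[OF G[OF g'(1)] G[OF f(1)] G[OF f'(1)] f'(2) aJ] \<open>tau f a = b\<close> g'b by simp
    then have "g' (f v) = v" using triv f' v by metis
    then show ?thesis using g' G_V G f v by metis
  qed
  have wV: "w \<in> V" "g w \<in> V" using w W.part_V aJ G_V G g by blast+
  define u where "u = g w - w"
  have gw: "g w \<in> W.part b" unfolding b_def using tau_W G g aJ w by blast
  have "u \<noteq> 0" unfolding u_def using W.part_disjoint[OF aJ ab(2) ab(1)] gw w by auto
  have uU: "u \<in> U.part i" unfolding u_def using H_move i g wV by blast
  \<comment> \<open>The square of \<open>g\<close> fixes \<open>a\<close>, hence is trivial on
    \<open>V\<close>.\<close>
  have gu: "g u = - u"
  proof -
    obtain f where f: "f \<in> H i" "\<forall>v\<in>V. f v = g (g v)" using H_comp[OF i g(1) g(1)] by blast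
    have "tau g b \<in> moved i" using tau_moved[OF i g(1), of b] M by simp
    moreover have "tau g b \<noteq> b" using tau_inj[OF G[OF g(1)] aJ ab(2)] ab(1) b_def by metis
    ultimately have "tau g b = a" using M by simp
    then have "tau f a = a"
      using tau_comp[OF G[OF g(1)] G[OF g(1)] G[OF f(1)] f(2) aJ] b_def by simp
    then have "g (g w) = w" using triv[OF f(1) _ wV(1)] f(2) wV(1) by simp
    then show ?thesis unfolding u_def using G_diff[OF G[OF g(1)], of "g w" w] by simp
  qed
  have "U.part i \<subseteq> range (\<lambda>c. scale c u)"
  proof (rule part_subset_invariant[OF i _ _ uU])
    show "subspace (range (\<lambda>c. scale c u))"
      using span_singleton subspace_span by metis
    show "u \<in> range (\<lambda>c. scale c u)" by (metis rangeI scale_one)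
    show "u \<noteq> 0" by fact
    fix f v assume f: "f \<in> H i" and "v \<in> range (\<lambda>c. scale c u)"
    then obtain c where "v = scale c u" by blast
    moreover have "f u = u \<or> f u = - u"
      using triv[OF f] two[OF f] gu uU U.part_V i by metis
    ultimately show "f v \<in> range (\<lambda>c. scale c u)"
      using G_scale G f by (metis rangeI scale_minus_left scale_minus_right)
  qed
  then have "\<exists>u. \<forall>v\<in>U.part i. \<exists>c. v = scale c u" by blast
  moreover have "g w \<noteq> w" using \<open>u \<noteq> 0\<close> by (auto simp: u_def)
  moreover have "(\<forall>v\<in>V. h v = v) \<or> (\<forall>v\<in>V. h v = g v)" if f: "h \<in> H i" for h
    using triv[OF f] two[OF f] by metis
  ultimately show ?thesis using g(1) wV(1) by (intro conjI bexI[of _ g]) auto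
qed

text \<open>\<open>L p\<close> conjugates \<open>H i\<close> into \<open>H (p i)\<close>, so it
  takes summands moved by the one to summands moved by the other.\<close>

lemma moved_K:
  assumes p: "p \<in> K" and i: "i \<in> I" and a: "a \<in> moved i"
  shows "tau (L p) a \<in> moved (p i)"
proof -
  obtain h where h: "h \<in> H i" "tau h a \<noteq> a" and aJ: "a \<in> J" using a by (auto simp: moved_def)
  obtain h' where h': "h' \<in> H (p i)" "\<forall>v\<in>V. L p (h v) = h' (L p v)" using L_H p i h by blast
  have pi: "p i \<in> I" using K_perm p i permutes_in_image by metis
  have G: "h \<in> G" "h' \<in> G" "L p \<in> G" using h h' i pi p H_G L_G by blast+
  obtain w where w: "w \<in> W.part a" "w \<noteq> 0" using W_nonzero aJ by blast
  have "tau h' (tau (L p) a) = tau (L p) (tau h a)"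
  proof (rule tau_unique[OF G(2)])
    show "tau (L p) a \<in> J" "tau (L p) (tau h a) \<in> J" using tau_in G aJ by blast+
    show "L p w \<in> W.part (tau (L p) a)" using tau_W G aJ w by blast
    show "L p w \<noteq> 0" using G_nonzero G w W.part_V aJ by blast
    have "h' (L p w) = L p (h w)" using h' w W.part_V aJ by metis
    then show "h' (L p w) \<in> W.part (tau (L p) (tau h a))" using tau_W tau_in G aJ w by metis
  qed
  then have "tau h' (tau (L p) a) \<noteq> tau (L p) a" using tau_inj tau_in G aJ h by metis
  then show ?thesis using movedI[OF tau_in[OF G(3) aJ] h'(1)] by blast
qed

theorem exceptional:
  assumes "i \<in> I" "moved i \<noteq> {}"
  shows "(\<exists>u. \<forall>v\<in>U.part i. \<exists>c. v = scale c u)"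
    and "\<exists>g\<in>H i. (\<exists>v\<in>V. g v \<noteq> v) \<and> (\<forall>h\<in>H i. (\<forall>v\<in>V. h v = v) \<or> (\<forall>v\<in>V. h v = g v))"
    and "\<exists>Q. partition_on I Q \<and> (\<forall>B\<in>Q. card B = 2) \<and> (\<forall>p\<in>K. \<forall>B\<in>Q. p ` B \<in> Q)"
proof -
  have ne: "moved j \<noteq> {}" if j: "j \<in> I" for j
  proof -
    obtain p where "p \<in> K" "p i = j" using K_trans assms j by blast
    then show ?thesis using moved_K assms by blast
  qed
  \<comment> \<open>These classes will be the pairs of the excluded case.\<close>
  define B where "B j = {j'\<in>I. moved j' = moved j}" for j
  have B2: "card (B j) = 2" if j: "j \<in> I" for j
  proof -
    obtain a where a: "a \<in> moved j" using ne j by blast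
    have aJ: "a \<in> J" using a moved_J by blast
    obtain j' where j': "j' \<in> I" "j' \<noteq> j" "moved j' = moved j" using moved_shared[OF j a ne] by blast
    \<comment> \<open>With a third index, \<open>h w\<close> and \<open>f w\<close> would both equal
      \<open>- g w\<close>. Then \<open>h w - w\<close> would lie in two different summands
      \<open>U.part\<close> and vanish, although \<open>h\<close> moves
      \<open>W.part a\<close>.\<close>
    have "j'' \<in> {j, j'}" if j'': "j'' \<in> I" "moved j'' = moved j" for j''
    proof (rule ccontr)
      assume n: "\<not> ?thesis"
      obtain w where w: "w \<in> W.part a" "w \<noteq> 0" using W_nonzero aJ by blast
      obtain g where g: "g \<in> H j" "tau g a \<noteq> a" using a by (auto simp: moved_def)
      obtain h where h: "h \<in> H j'" "tau h a \<noteq> a" using a j' by (auto simp: moved_def)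
      obtain f where f: "f \<in> H j''" "tau f a \<noteq> a" using a j'' by (auto simp: moved_def)
      have e: "h w = - g w" "f w = - g w"
        using shared_swap(2)[OF j j'(1) _ j'(3) g h aJ w] shared_swap(2)[OF j j''(1) _ j''(2) g f aJ w] j' n
        by auto
      have wV: "w \<in> V" using w W.part_V aJ by blast
      have "h w - w \<in> U.part j'" "h w - w \<in> U.part j''"
        using H_move[OF j'(1) h(1) wV] H_move[OF j''(1) f(1) wV] e by auto
      then have "h w - w = 0" using U.part_disjoint[of j' j''] j' j'' n by blast
      then have "h w = w" by simp
      moreover have "h w \<in> W.part (tau h a)" using tau_W h aJ w H_G j' by blast
      ultimately show False using W.part_disjoint[OF aJ _ _ w(1)] h w tau_in H_G j' aJ by metis
    qed
    then have "B j = {j, j'}" using j j' by (auto simp: B_def)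
    then show ?thesis using j' by simp
  qed
  have "p ` B j = B (p j)" if p: "p \<in> K" and j: "j \<in> I" for p j
  proof -
    have pI: "\<And>j. j \<in> I \<Longrightarrow> p j \<in> I" using K_perm p permutes_in_image by metis
    have "p j' \<in> B (p j)" if j'B: "j' \<in> B j" for j'
    proof -
      have j': "j' \<in> I" "moved j' = moved j" using j'B by (auto simp: B_def)
      obtain a where "a \<in> moved j" using ne j by blast
      then have "tau (L p) a \<in> moved (p j)" "tau (L p) a \<in> moved (p j')" using moved_K p j j' by auto
      then show ?thesis using moved_eq[of "p j'" "p j"] pI j j' by (auto simp: B_def)
    qed
    then have "p ` B j \<subseteq> B (p j)" by blast
    \<comment> \<open>All classes have two elements, so the inclusion just shown is an
      equality.\<close>
    moreover have "card (p ` B j) = card (B j)"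
      using K_perm p by (intro card_image) (metis inj_on_subset permutes_inj subset_UNIV)
    moreover have "finite (B (p j))" using U.finite_index by (simp add: B_def)
    ultimately show ?thesis using B2 j pI card_subset_eq by metis
  qed
  moreover have "partition_on I (B ` I)"
    by (rule partition_onI) (auto simp: B_def disjnt_def)
  ultimately show "\<exists>Q. partition_on I Q \<and> (\<forall>B\<in>Q. card B = 2) \<and> (\<forall>p\<in>K. \<forall>B\<in>Q. p ` B \<in> Q)"
    using B2 K_perm permutes_in_image by (intro exI[of _ "B ` I"]) (fastforce simp: image_iff)
  obtain a where a: "a \<in> moved i" using assms by blast
  obtain j where "j \<in> I" "i \<noteq> j" "moved j = moved i" using moved_shared[OF assms(1) a ne] by blast
  from shared_line[OF assms(1) this a]
  show "(\<exists>u. \<forall>v\<in>U.part i. \<exists>c. v = scale c u)"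
    and "\<exists>g\<in>H i. (\<exists>v\<in>V. g v \<noteq> v) \<and> (\<forall>h\<in>H i. (\<forall>v\<in>V. h v = v) \<or> (\<forall>v\<in>V. h v = g v))"
    by blast+
qed

text \<open>The map \<open>f\<close> intertwines \<open>p\<close> with \<open>tau (L p)\<close>,
  because a nonzero vector of \<open>U.part i\<close> determines where its summand goes.
  Transitivity of \<open>K\<close> then makes all fibres equally large.\<close>

theorem refinement:
  assumes "\<And>i. i \<in> I \<Longrightarrow> moved i = {}"
  obtains f where "\<And>i. i \<in> I \<Longrightarrow> f i \<in> J \<and> U.part i \<subseteq> W.part (f i)"
    and "f ` I = J"
    and "\<And>j j'. j \<in> J \<Longrightarrow> j' \<in> J \<Longrightarrow> card {i\<in>I. f i = j} = card {i\<in>I. f i = j'}"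
    and "\<And>p i i'. p \<in> K \<Longrightarrow> i \<in> I \<Longrightarrow> i' \<in> I \<Longrightarrow> f i = f i' \<Longrightarrow> f (p i) = f (p i')"
proof -
  have "\<forall>i\<in>I. \<exists>j. j \<in> J \<and> U.part i \<subseteq> W.part j" using moved_empty_part assms by blast
  then obtain f where f: "\<And>i. i \<in> I \<Longrightarrow> f i \<in> J \<and> U.part i \<subseteq> W.part (f i)" by metis
  have nz: "\<exists>u\<in>U.part i. u \<noteq> 0" if i: "i \<in> I" for i
  proof -
    obtain h v where "h \<in> H i" "v \<in> V" "h v \<noteq> v" using H_nontrivial i by blast
    then show ?thesis using H_move i by (metis right_minus_eq)
  qed
  have equiv: "f (p i) = tau (L p) (f i)" if p: "p \<in> K" and i: "i \<in> I" for p i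
  proof -
    obtain u where u: "u \<in> U.part i" "u \<noteq> 0" using nz i by blast
    have pi: "p i \<in> I" using K_perm p i permutes_in_image by metis
    have "L p u \<in> W.part (f (p i))" using L_U p i u f pi by blast
    moreover have "u \<in> W.part (f i)" using f i u by blast
    ultimately show ?thesis
      using tau_unique[OF L_G[OF p] _ _ _ u(2), of "f i" "f (p i)"] f[OF i] f[OF pi] by simp
  qed
  have surj: "f ` I = J"
  proof (rule equalityI)
    \<comment> \<open>If no \<open>U.part i\<close> lay in \<open>W.part j\<close>, then
      \<open>R j\<close> would kill every \<open>P i w\<close>, hence every
      \<open>w\<close>.\<close>
    show "J \<subseteq> f ` I"
    proof (rule subsetI, rule ccontr)
      fix j assume j: "j \<in> J" "j \<notin> f ` I"
      obtain w where w: "w \<in> W.part j" "w \<noteq> 0" using W_nonzero j by blast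
      have wV: "w \<in> V" using w W.part_V j by blast
      have "R j (P i w) = 0" if "i \<in> I" for i
        using W.P_other_part[of j "f i" "P i w"] f that j U.P_in_part wV by blast
      then have "R j (\<Sum>i\<in>I. P i w) = 0" using j by (simp add: W.P_sum_distrib)
      then show False using U.P_sum wV w j by auto
    qed
  qed (use f in blast)
  have le: "card {i\<in>I. f i = j} \<le> card {i\<in>I. f i = j'}" if jj: "j \<in> J" "j' \<in> J" for j j'
  proof -
    obtain i i' where ii: "i \<in> I" "i' \<in> I" "j = f i" "j' = f i'" using jj surj by blast
    obtain p where p: "p \<in> K" "p i = i'" using K_trans ii by blast
    have "p ` {i\<in>I. f i = j} \<subseteq> {i\<in>I. f i = j'}"
      using equiv p ii K_perm permutes_in_image by (fastforce simp: image_iff)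
    moreover have "inj_on p {i\<in>I. f i = j}"
      using K_perm p by (metis inj_on_subset permutes_inj subset_UNIV)
    moreover have "finite {i\<in>I. f i = j'}" using U.finite_index by simp
    ultimately show ?thesis by (intro card_inj_on_le)
  qed
  show thesis
  proof (rule that[of f])
    show "f i \<in> J \<and> U.part i \<subseteq> W.part (f i)" if "i \<in> I" for i using f that .
    show "f ` I = J" by (fact surj)
    show "card {i\<in>I. f i = j} = card {i\<in>I. f i = j'}" if "j \<in> J" "j' \<in> J" for j j'
      using le that by (simp add: le_antisym)
    show "f (p i) = f (p i')" if "p \<in> K" "i \<in> I" "i' \<in> I" "f i = f i'" for p i i'
      using equiv that by simp
  qed
qed

end

section \<open>Block monomial matrices\<close>

declare One_nat_def [simp del]

text \<open>Matrix indices start at 0 and blocks at 1: index \<open>r\<close> lies in block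
  \<open>r div d + 1\<close> at offset \<open>r mod d\<close>. This lemma and the next are the two
  directions of this correspondence.\<close>

lemma block_index:
  fixes q k i d :: nat
  assumes "q \<in> {1..k}" "i < d"
  shows "(q - 1) * d + i < d * k" "((q - 1) * d + i) div d + 1 = q" "((q - 1) * d + i) mod d = i"
proof -
  have "(q - 1) * d + i < (q - 1) * d + d" using assms(2) by linarith
  also have "\<dots> = q * d" using assms(1) by (cases q) auto
  also have "\<dots> \<le> d * k" using assms(1) by (simp add: mult.commute)
  finally show "(q - 1) * d + i < d * k" .
qed (use assms in auto)

lemma index_block:
  fixes r k d :: nat
  assumes "r < d * k"
  shows "r div d + 1 \<in> {1..k}" "r mod d < d" "r = (r div d + 1 - 1) * d + r mod d"
proof -
  have "d > 0" using assms by (cases d) auto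
  then show "r div d + 1 \<in> {1..k}" "r mod d < d"
    using assms less_mult_imp_div_less[of r k d] by (auto simp: mult.commute)
qed simp

lemma sum_block:
  fixes f :: "nat \<Rightarrow> 'b::comm_monoid_add"
  assumes "q \<in> {1..k}" "\<And>s. s < d * k \<Longrightarrow> s div d + 1 \<noteq> q \<Longrightarrow> f s = 0"
  shows "(\<Sum>s<d * k. f s) = (\<Sum>i<d. f ((q - 1) * d + i))"
proof -
  have "(\<Sum>s<d * k. f s) = (\<Sum>s\<in>(\<lambda>i. (q - 1) * d + i) ` {..<d}. f s)"
  proof (rule sum.mono_neutral_right)
    show "(\<lambda>i. (q - 1) * d + i) ` {..<d} \<subseteq> {..<d * k}" using block_index(1)[OF assms(1)] by auto
    show "\<forall>s\<in>{..<d * k} - (\<lambda>i. (q - 1) * d + i) ` {..<d}. f s = 0"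
    proof
      fix s assume s: "s \<in> {..<d * k} - (\<lambda>i. (q - 1) * d + i) ` {..<d}"
      then have "s div d + 1 \<noteq> q" using index_block(2,3)[of s d k] by fastforce
      then show "f s = 0" using assms(2) s by blast
    qed
  qed simp
  also have "\<dots> = (\<Sum>i<d. f ((q - 1) * d + i))"
    by (rule sum.reindex_cong[where l = "\<lambda>i. (q - 1) * d + i"]) (auto intro: inj_onI)
  finally show ?thesis .
qed

text \<open>Normal form for the elements of \<open>wreath_GL\<close>: column block \<open>q\<close>
  carries \<open>h q\<close> in row block \<open>p q\<close> and zeros elsewhere.\<close>

definition bmat :: "nat \<Rightarrow> nat \<Rightarrow> (nat \<Rightarrow> 'a::field mat) \<Rightarrow> (nat \<Rightarrow> nat) \<Rightarrow> 'a mat"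
  where "bmat d k h p = mat (d * k) (d * k) (\<lambda>(r, c).
    if r div d + 1 = p (c div d + 1) then h (c div d + 1) $$ (r mod d, c mod d) else 0)"

lemma bmat_carrier [simp]: "bmat d k h p \<in> carrier_mat (d * k) (d * k)"
  and dim_bmat [simp]: "dim_row (bmat d k h p) = d * k" "dim_col (bmat d k h p) = d * k"
  by (simp_all add: bmat_def)

lemma bmat_index:
  "r < d * k \<Longrightarrow> c < d * k \<Longrightarrow> bmat d k h p $$ (r, c) =
    (if r div d + 1 = p (c div d + 1) then h (c div d + 1) $$ (r mod d, c mod d) else 0)"
  by (simp add: bmat_def)

lemma bmat_block:
  assumes "q \<in> {1..k}" "q' \<in> {1..k}" "i < d" "j < d"
  shows "bmat d k h p $$ ((q' - 1) * d + i, (q - 1) * d + j) = (if q' = p q then h q $$ (i, j) else 0)"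
proof -
  note b = block_index[OF assms(1,4)] block_index[OF assms(2,3)]
  show ?thesis unfolding bmat_index[OF b(4,1)] b ..
qed

lemma bmat_cong:
  assumes "\<And>q. q \<in> {1..k} \<Longrightarrow> h q = h' q \<and> p q = p' q"
  shows "bmat d k h p = bmat d k h' p'"
proof (rule eq_matI)
  fix r c assume "r < dim_row (bmat d k h' p')" "c < dim_col (bmat d k h' p')"
  then have rc: "r < d * k" "c < d * k" by simp_all
  show "bmat d k h p $$ (r, c) = bmat d k h' p' $$ (r, c)"
    using assms[OF index_block(1)[OF rc(2)]] by (simp add: bmat_index[OF rc])
qed simp_all

lemma wreath_GL_eq: "wreath_GL d k H K = {bmat d k h p |h p. (\<forall>q\<in>{1..k}. h q \<in> H) \<and> p \<in> K}"
proof (intro equalityI subsetI)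
  fix A assume "A \<in> wreath_GL d k H K"
  then obtain h p where A: "A \<in> carrier_mat (d * k) (d * k)" "\<forall>q\<in>{1..k}. h q \<in> H" "p \<in> K"
    and e: "\<And>q q' i j. q \<in> {1..k} \<Longrightarrow> q' \<in> {1..k} \<Longrightarrow> i < d \<Longrightarrow> j < d \<Longrightarrow>
      A $$ ((q' - 1) * d + i, (q - 1) * d + j) = (if q' = p q then h q $$ (i, j) else 0)"
    unfolding wreath_GL_def by blast
  have "A = bmat d k h p"
  proof (rule eq_matI)
    fix r c assume "r < dim_row (bmat d k h p)" "c < dim_col (bmat d k h p)"
    then have rc: "r < d * k" "c < d * k" by simp_all
    show "A $$ (r, c) = bmat d k h p $$ (r, c)"
      using e[OF index_block(1)[OF rc(2)] index_block(1)[OF rc(1)] index_block(2)[OF rc(1)] index_block(2)[OF rc(2)]] rc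
      by (simp add: bmat_index)
  qed (use A in auto)
  then show "A \<in> {bmat d k h p |h p. (\<forall>q\<in>{1..k}. h q \<in> H) \<and> p \<in> K}" using A by blast
next
  fix A assume "A \<in> {bmat d k h p |h p. (\<forall>q\<in>{1..k}. h q \<in> H) \<and> p \<in> K}"
  then obtain h p where A: "A = bmat d k h p" "\<forall>q\<in>{1..k}. h q \<in> H" "p \<in> K" by blast
  have "\<forall>q\<in>{1..k}. \<forall>q'\<in>{1..k}. \<forall>i<d. \<forall>j<d.
     A $$ ((q' - 1) * d + i, (q - 1) * d + j) = (if q' = p q then h q $$ (i, j) else 0)"
    unfolding A(1) using bmat_block by blast
  then show "A \<in> wreath_GL d k H K"
    unfolding wreath_GL_def using A(2,3) bmat_carrier[of d k h p] A(1) by blast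
qed

lemma wreath_GLE:
  assumes "A \<in> wreath_GL d k H K"
  obtains h p where "A = bmat d k h p" "\<And>q. q \<in> {1..k} \<Longrightarrow> h q \<in> H" "p \<in> K"
  using assms unfolding wreath_GL_eq by blast

lemma wreath_GLI: "(\<And>q. q \<in> {1..k} \<Longrightarrow> h q \<in> H) \<Longrightarrow> p \<in> K \<Longrightarrow> bmat d k h p \<in> wreath_GL d k H K"
  unfolding wreath_GL_eq by blast

text \<open>For an entry in column block \<open>q\<close>, only intermediate indices of block
  \<open>p' q\<close> contribute to the sum.\<close>

lemma bmat_mult:
  assumes h: "\<And>q. q \<in> {1..k} \<Longrightarrow> h q \<in> carrier_mat d d" "\<And>q. q \<in> {1..k} \<Longrightarrow> h' q \<in> carrier_mat d d"
    and p': "\<And>q. q \<in> {1..k} \<Longrightarrow> p' q \<in> {1..k}"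
  shows "bmat d k h p * bmat d k h' p' = bmat d k (\<lambda>q. h (p' q) * h' q) (p \<circ> p')"
proof (rule eq_matI)
  fix r c assume "r < dim_row (bmat d k (\<lambda>q. h (p' q) * h' q) (p \<circ> p'))"
    "c < dim_col (bmat d k (\<lambda>q. h (p' q) * h' q) (p \<circ> p'))"
  then have rc: "r < d * k" "c < d * k" by simp_all
  define q where "q = c div d + 1"
  have q: "q \<in> {1..k}" "p' q \<in> {1..k}" unfolding q_def using index_block(1) rc p' by blast+
  have m: "r mod d < d" "c mod d < d" using rc index_block(2) by blast+
  have "(bmat d k h p * bmat d k h' p') $$ (r, c) = (\<Sum>s<d * k. bmat d k h p $$ (r, s) * bmat d k h' p' $$ (s, c))"
    using rc by (simp add: scalar_prod_def lessThan_atLeast0)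
  also have "\<dots> = (\<Sum>i<d. bmat d k h p $$ (r, (p' q - 1) * d + i) * bmat d k h' p' $$ ((p' q - 1) * d + i, c))"
    by (rule sum_block[OF q(2)]) (use rc in \<open>auto simp: bmat_index q_def\<close>)
  also have "\<dots> = (\<Sum>i<d. (if r div d + 1 = p (p' q) then h (p' q) $$ (r mod d, i) else 0) * h' q $$ (i, c mod d))"
  proof (rule sum.cong[OF refl])
    fix i assume "i \<in> {..<d}"
    then show "bmat d k h p $$ (r, (p' q - 1) * d + i) * bmat d k h' p' $$ ((p' q - 1) * d + i, c) =
      (if r div d + 1 = p (p' q) then h (p' q) $$ (r mod d, i) else 0) * h' q $$ (i, c mod d)"
      using rc block_index[OF q(2), of i d] by (simp only: bmat_index lessThan_iff q_def[symmetric]) simp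
  qed
  also have "\<dots> = bmat d k (\<lambda>q. h (p' q) * h' q) (p \<circ> p') $$ (r, c)"
    using m h(1)[OF q(2)] h(2)[OF q(1)]
    by (simp add: bmat_index[OF rc] scalar_prod_def lessThan_atLeast0 flip: q_def)
  finally show "(bmat d k h p * bmat d k h' p') $$ (r, c) = bmat d k (\<lambda>q. h (p' q) * h' q) (p \<circ> p') $$ (r, c)" .
qed simp_all

lemma bmat_one: "bmat d k (\<lambda>_. 1\<^sub>m d) id = 1\<^sub>m (d * k)"
proof (rule eq_matI)
  fix r c assume "r < dim_row (1\<^sub>m (d * k) :: 'a mat)" "c < dim_col (1\<^sub>m (d * k) :: 'a mat)"
  then have rc: "r < d * k" "c < d * k" by simp_all
  have "r = c \<longleftrightarrow> r div d = c div d \<and> r mod d = c mod d" by (metis div_mult_mod_eq)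
  then show "bmat d k (\<lambda>_. 1\<^sub>m d) id $$ (r, c) = 1\<^sub>m (d * k) $$ (r, c)"
    using index_block(2)[OF rc(1)] index_block(2)[OF rc(2)] rc by (auto simp: bmat_index[OF rc])
qed simp_all

section \<open>General linear and symmetric groups in terms of matrices and functions\<close>

lemma GL_iff: "A \<in> carrier (GL n) \<longleftrightarrow>
    A \<in> carrier_mat n n \<and> (\<exists>B\<in>carrier_mat n n. A * B = 1\<^sub>m n \<and> B * A = 1\<^sub>m n)"
  for A :: "'a::field mat"
  by (auto simp: GL_def units_of_def Units_def ring_mat_def)

lemma GL_group: "group (GL n)"
  unfolding GL_def by (intro monoid.units_group ring.is_monoid ring_mat)

lemma GL_mult: "x \<otimes>\<^bsub>GL n\<^esub> y = x * y" and GL_one: "\<one>\<^bsub>GL n\<^esub> = 1\<^sub>m n"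
  by (auto simp: GL_def units_of_def ring_mat_def)

lemma GL_mat: "A \<in> carrier (GL n) \<Longrightarrow> A \<in> carrier_mat n n"
  by (simp add: GL_iff)

lemma GL_inv:
  assumes "A \<in> carrier (GL n)"
  shows "inv\<^bsub>GL n\<^esub> A \<in> carrier (GL n)" "A * inv\<^bsub>GL n\<^esub> A = 1\<^sub>m n" "inv\<^bsub>GL n\<^esub> A * A = 1\<^sub>m n"
  using assms group.inv_closed[OF GL_group] group.r_inv[OF GL_group] group.l_inv[OF GL_group]
  by (auto simp: GL_mult GL_one)

lemma GL_mult_closed: "A \<in> carrier (GL n) \<Longrightarrow> B \<in> carrier (GL n) \<Longrightarrow> A * B \<in> carrier (GL n)"
  using monoid.m_closed[OF group.is_monoid[OF GL_group]] by (metis GL_mult)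

lemma GL_one_closed: "1\<^sub>m n \<in> carrier (GL n)"
  using monoid.one_closed[OF group.is_monoid[OF GL_group]] by (metis GL_one)

lemma GL_inv_unique:
  assumes "A \<in> carrier_mat n n" "B \<in> carrier_mat n n" "A * B = 1\<^sub>m n"
  shows "A \<in> carrier (GL n)" "B \<in> carrier (GL n)" "inv\<^bsub>GL n\<^esub> A = B"
proof -
  have BA: "B * A = 1\<^sub>m n" using assms mat_mult_left_right_inverse by blast
  show A: "A \<in> carrier (GL n)" and B: "B \<in> carrier (GL n)" unfolding GL_iff using assms BA by blast+
  show "inv\<^bsub>GL n\<^esub> A = B"
    using group.inv_equality[OF GL_group _ A B] BA by (simp add: GL_mult GL_one)
qed

lemma GL_subgroup:
  assumes "subgroup H (GL n)"
  shows "H \<subseteq> carrier (GL n)" "1\<^sub>m n \<in> H" "\<And>x y. x \<in> H \<Longrightarrow> y \<in> H \<Longrightarrow> x * y \<in> H"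
    "\<And>x. x \<in> H \<Longrightarrow> inv\<^bsub>GL n\<^esub> x \<in> H"
  using subgroup.subset[OF assms] subgroup.one_closed[OF assms] subgroup.m_closed[OF assms]
    subgroup.m_inv_closed[OF assms] by (auto simp: GL_mult GL_one)

lemma sym_mult: "x \<otimes>\<^bsub>sym_group n\<^esub> y = x \<circ> y" and sym_one: "\<one>\<^bsub>sym_group n\<^esub> = id"
  and sym_carrier: "x \<in> carrier (sym_group n) \<longleftrightarrow> x permutes {1..n}"
  by (auto simp: sym_group_def)

lemma sym_inv:
  assumes "p permutes {1..n}"
  shows "inv\<^bsub>sym_group n\<^esub> p permutes {1..n}" "p \<circ> inv\<^bsub>sym_group n\<^esub> p = id" "inv\<^bsub>sym_group n\<^esub> p \<circ> p = id"
proof -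
  have c: "p \<in> carrier (sym_group n)" using assms sym_carrier by blast
  show "inv\<^bsub>sym_group n\<^esub> p permutes {1..n}"
    using group.inv_closed[OF sym_group_is_group c] sym_carrier by blast
  show "p \<circ> inv\<^bsub>sym_group n\<^esub> p = id" "inv\<^bsub>sym_group n\<^esub> p \<circ> p = id"
    using group.r_inv[OF sym_group_is_group c] group.l_inv[OF sym_group_is_group c]
    unfolding sym_mult sym_one by simp_all
qed

lemma sym_subgroup:
  assumes "subgroup K (sym_group n)"
  shows "\<And>p. p \<in> K \<Longrightarrow> p permutes {1..n}" "id \<in> K" "\<And>x y. x \<in> K \<Longrightarrow> y \<in> K \<Longrightarrow> x \<circ> y \<in> K"
    "\<And>x. x \<in> K \<Longrightarrow> inv\<^bsub>sym_group n\<^esub> x \<in> K"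
  using subgroup.subset[OF assms] subgroup.one_closed[OF assms] subgroup.m_closed[OF assms]
    subgroup.m_inv_closed[OF assms] by (auto simp: sym_mult sym_one sym_carrier)

lemma permutes_range: "p permutes {1..n} \<Longrightarrow> q \<in> {1..n} \<Longrightarrow> p q \<in> {1..n::nat}"
  by (simp only: permutes_in_image)

lemma bmat_inverse:
  assumes h: "\<And>q. q \<in> {1..k} \<Longrightarrow> h q \<in> carrier (GL d)" and p: "p permutes {1..k}"
  shows "bmat d k h p \<in> carrier (GL (d * k))"
    and "inv\<^bsub>GL (d * k)\<^esub> (bmat d k h p) =
      bmat d k (\<lambda>q. inv\<^bsub>GL d\<^esub> (h ((inv\<^bsub>sym_group k\<^esub> p) q))) (inv\<^bsub>sym_group k\<^esub> p)"
proof -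
  let ?p = "inv\<^bsub>sym_group k\<^esub> p"
  let ?h = "\<lambda>q. inv\<^bsub>GL d\<^esub> (h (?p q))"
  have pq: "?p q \<in> {1..k}" if "q \<in> {1..k}" for q using permutes_range sym_inv(1)[OF p] that by blast
  have "bmat d k h p * bmat d k ?h ?p = bmat d k (\<lambda>q. h (?p q) * ?h q) (p \<circ> ?p)"
    using h pq GL_mat GL_inv(1) by (intro bmat_mult) blast+
  also have "\<dots> = bmat d k (\<lambda>_. 1\<^sub>m d) id"
    unfolding sym_inv(2)[OF p] using GL_inv(2)[OF h[OF pq]] by (intro bmat_cong) blast
  finally have "bmat d k h p * bmat d k ?h ?p = 1\<^sub>m (d * k)" by (simp add: bmat_one)
  then show "bmat d k h p \<in> carrier (GL (d * k))" "inv\<^bsub>GL (d * k)\<^esub> (bmat d k h p) = bmat d k ?h ?p"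
    by (rule GL_inv_unique(1,3)[OF bmat_carrier bmat_carrier])+
qed

lemma wreath_subgroup:
  assumes H: "subgroup H (GL d)" and K: "subgroup K (sym_group k)"
  shows "subgroup (wreath_GL d k H K) (GL (d * k))"
proof (rule group.subgroupI[OF GL_group])
  note H' = GL_subgroup[OF H] and K' = sym_subgroup[OF K]
  show "wreath_GL d k H K \<subseteq> carrier (GL (d * k))"
  proof
    fix A assume "A \<in> wreath_GL d k H K"
    then obtain h p where A: "A = bmat d k h p" "\<And>q. q \<in> {1..k} \<Longrightarrow> h q \<in> H" "p \<in> K"
      by (rule wreath_GLE) blast
    have "h q \<in> carrier (GL d)" if "q \<in> {1..k}" for q using A(2)[OF that] H'(1) by blast
    then show "A \<in> carrier (GL (d * k))" unfolding A(1) using bmat_inverse(1) K'(1)[OF A(3)] by blast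
  qed
  have "bmat d k (\<lambda>_. 1\<^sub>m d) id \<in> wreath_GL d k H K" using H' K' by (intro wreath_GLI) auto
  then show "wreath_GL d k H K \<noteq> {}" by blast
  fix A assume "A \<in> wreath_GL d k H K"
  then obtain h p where A: "A = bmat d k h p" "\<And>q. q \<in> {1..k} \<Longrightarrow> h q \<in> H" "p \<in> K"
    by (auto elim: wreath_GLE)
  have pq: "(inv\<^bsub>sym_group k\<^esub> p) q \<in> {1..k}" if "q \<in> {1..k}" for q
    using permutes_range sym_inv(1)[OF K'(1)[OF A(3)]] that by blast
  have hG: "h q \<in> carrier (GL d)" if "q \<in> {1..k}" for q using A(2) H'(1) that by blast
  show "inv\<^bsub>GL (d * k)\<^esub> A \<in> wreath_GL d k H K"
    unfolding A(1) bmat_inverse(2)[of k h d p, OF hG K'(1)[OF A(3)], simplified]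
    using H'(4)[OF A(2)[OF pq]] K'(4)[OF A(3)] by (intro wreath_GLI) blast+
  fix B assume "B \<in> wreath_GL d k H K"
  then obtain h' p' where B: "B = bmat d k h' p'" "\<And>q. q \<in> {1..k} \<Longrightarrow> h' q \<in> H" "p' \<in> K"
    by (auto elim: wreath_GLE)
  have pq': "p' q \<in> {1..k}" if "q \<in> {1..k}" for q
    using permutes_range K'(1)[OF B(3)] that by blast
  have "A * B = bmat d k (\<lambda>q. h (p' q) * h' q) (p \<circ> p')"
    unfolding A(1) B(1) using hG GL_mat B(2) H'(1) pq' by (intro bmat_mult) blast+
  then show "A \<otimes>\<^bsub>GL (d * k)\<^esub> B \<in> wreath_GL d k H K"
    unfolding GL_mult using H'(3)[OF A(2)[OF pq'] B(2)] K'(3)[OF A(3) B(3)]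
    by (metis (no_types, lifting) wreath_GLI)
qed

text \<open>An invertible block of positive size is nonzero, so its position reveals
  \<open>p q\<close>.\<close>

lemma bmat_inject:
  assumes e: "bmat d k h p = bmat d k h' p'" and q: "q \<in> {1..k}" and p: "p q \<in> {1..k}"
    and h: "h q \<in> carrier (GL d)" "h' q \<in> carrier_mat d d" and d: "0 < d"
  shows "p q = p' q" "h q = h' q"
proof -
  have hq: "h q \<in> carrier_mat d d" using h GL_mat by blast
  have *: "h q $$ (i, j) = (if p q = p' q then h' q $$ (i, j) else 0)" if "i < d" "j < d" for i j
    using bmat_block[OF q p that, of h p] bmat_block[OF q p that, of h' p'] e by simp
  show pq: "p q = p' q"
  proof (rule ccontr)
    assume "p q \<noteq> p' q"
    then have "h q = 0\<^sub>m d d" using * hq by (intro eq_matI) auto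
    then have "h q * inv\<^bsub>GL d\<^esub> (h q) = 0\<^sub>m d d" using GL_mat[OF GL_inv(1)[OF h(1)]] by simp
    then have "(1\<^sub>m d :: 'a mat) $$ (0, 0) = 0\<^sub>m d d $$ (0, 0)" using GL_inv(2)[OF h(1)] by simp
    then show False using d by simp
  qed
  show "h q = h' q" using * pq hq h by (intro eq_matI) auto
qed

text \<open>Associativity of the wreath product: when \<open>\<sigma>\<close> respects the
  consecutive blocks of length \<open>m\<close>, the small blocks can be grouped by
  \<open>m\<close>, and each big block is again block monomial.\<close>

lemma bmat_nested:
  assumes "\<And>q r. q \<in> {1..l} \<Longrightarrow> r \<in> {1..m} \<Longrightarrow>
      \<sigma> ((q - 1) * m + r) = (y q - 1) * m + x q r \<and> y q \<in> {1..l} \<and> x q r \<in> {1..m}"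
  shows "bmat d (m * l) h \<sigma> = bmat (d * m) l (\<lambda>q. bmat d m (\<lambda>r. h ((q - 1) * m + r)) (x q)) y"
proof (rule eq_matI)
  fix r c assume "r < dim_row (bmat (d * m) l (\<lambda>q. bmat d m (\<lambda>r. h ((q - 1) * m + r)) (x q)) y)"
    "c < dim_col (bmat (d * m) l (\<lambda>q. bmat d m (\<lambda>r. h ((q - 1) * m + r)) (x q)) y)"
  then have rc: "r < d * m * l" "c < d * m * l" by simp_all
  then have rc': "r < d * (m * l)" "c < d * (m * l)" by (simp_all add: mult.assoc)
  have pos: "0 < d" "0 < m" using rc by (auto intro: gr0I)
  define q t where "q = c div d div m + 1" and "t = c div d mod m + 1"
  have q: "q \<in> {1..l}" using index_block(1)[OF rc(2)] by (simp add: q_def div_mult2_eq)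
  have t: "t \<in> {1..m}" using mod_less_divisor[OF pos(2), of "c div d"] by (simp add: t_def)
  have cq: "c div d + 1 = (q - 1) * m + t" unfolding q_def t_def by simp
  note s = assms[OF q t]
  have xt: "x q t - 1 < m" "x q t \<ge> 1" "y q \<ge> 1" using s pos by auto
  \<comment> \<open>Uniqueness of quotient and remainder modulo \<open>m\<close>, after the shift by
    1 between points and matrix blocks.\<close>
  have iff: "r div d + 1 = \<sigma> ((q - 1) * m + t) \<longleftrightarrow> r div d div m + 1 = y q \<and> r div d mod m + 1 = x q t"
  proof -
    have "r div d + 1 = \<sigma> ((q - 1) * m + t) \<longleftrightarrow> r div d = (y q - 1) * m + (x q t - 1)"
      using s xt by auto
    also have "\<dots> \<longleftrightarrow> r div d div m = y q - 1 \<and> r div d mod m = x q t - 1"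
    proof
      assume e: "r div d = (y q - 1) * m + (x q t - 1)"
      show "r div d div m = y q - 1 \<and> r div d mod m = x q t - 1"
        unfolding e div_mult_self3[OF pos(2)[THEN gr_implies_not0]] mod_mult_self3 using xt(1) by simp
    next
      assume "r div d div m = y q - 1 \<and> r div d mod m = x q t - 1"
      then show "r div d = (y q - 1) * m + (x q t - 1)" by (metis div_mult_mod_eq)
    qed
    also have "\<dots> \<longleftrightarrow> r div d div m + 1 = y q \<and> r div d mod m + 1 = x q t" using xt by auto
    finally show ?thesis .
  qed
  have mm: "r mod (d * m) < d * m" "c mod (d * m) < d * m" using pos by simp_all
  have md: "s mod (d * m) div d = s div d mod m" "s mod (d * m) mod d = s mod d" for s
    using pos by (simp_all add: mod_mult2_eq)
  have e: "c div (d * m) + 1 = q" "r div (d * m) = r div d div m" "c div d mod m + 1 = t"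
    by (simp_all add: q_def t_def div_mult2_eq)
  show "bmat d (m * l) h \<sigma> $$ (r, c) =
      bmat (d * m) l (\<lambda>q. bmat d m (\<lambda>r. h ((q - 1) * m + r)) (x q)) y $$ (r, c)"
    unfolding bmat_index[OF rc'] bmat_index[OF rc] bmat_index[OF mm] e iff cq md by simp
qed (simp_all add: mult.assoc)

section \<open>Conjugates of subgroups\<close>

lemma conj_set_eq: "conj_set G g A = (\<lambda>a. g \<otimes>\<^bsub>G\<^esub> a \<otimes>\<^bsub>G\<^esub> inv\<^bsub>G\<^esub> g) ` A"
  by (auto simp: conj_set_def l_coset_def r_coset_def)

lemma conj_set_subgroup:
  fixes G (structure)
  assumes "group G" "subgroup A G" "g \<in> carrier G"
  shows "subgroup (conj_set G g A) G"
proof -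
  interpret group G by fact
  interpret A: subgroup A G by fact
  have c: "(g \<otimes> a \<otimes> inv g) \<otimes> (g \<otimes> b \<otimes> inv g) = g \<otimes> (a \<otimes> b) \<otimes> inv g"
    if "a \<in> carrier G" "b \<in> carrier G" for a b
  proof -
    have "(g \<otimes> a \<otimes> inv g) \<otimes> (g \<otimes> b \<otimes> inv g) = g \<otimes> a \<otimes> (inv g \<otimes> g) \<otimes> b \<otimes> inv g"
      using assms that by (simp only: m_assoc m_closed inv_closed)
    then show ?thesis using assms that by (simp add: m_assoc)
  qed
  show ?thesis
  proof (rule subgroupI)
    show "conj_set G g A \<subseteq> carrier G" "conj_set G g A \<noteq> {}"
      unfolding conj_set_eq using assms(3) A.one_closed A.mem_carrier by (blast intro: m_closed inv_closed)+
    fix x assume "x \<in> conj_set G g A"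
    then obtain a where a: "a \<in> A" "x = g \<otimes> a \<otimes> inv g" by (auto simp: conj_set_eq)
    have "inv x = g \<otimes> inv a \<otimes> inv g" using a assms by (simp add: inv_mult_group m_assoc)
    then show "inv x \<in> conj_set G g A" using a by (auto simp: conj_set_eq)
    fix y assume "y \<in> conj_set G g A"
    then obtain b where b: "b \<in> A" "y = g \<otimes> b \<otimes> inv g" by (auto simp: conj_set_eq)
    show "x \<otimes> y \<in> conj_set G g A" using a b c by (auto simp: conj_set_eq)
  qed
qed

section \<open>Column vectors as functions\<close>

text \<open>
  The vectors of length \<open>n\<close> become the functions vanishing from \<open>n\<close> on, because these live in an
  additive group type, on which no carrier conditions are needed.
\<close>

definition fscale :: "'a::field \<Rightarrow> (nat \<Rightarrow> 'a) \<Rightarrow> nat \<Rightarrow> 'a"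
  where "fscale c f = (\<lambda>r. c * f r)"

interpretation fun_vs: vector_space "fscale :: 'a::field \<Rightarrow> (nat \<Rightarrow> 'a) \<Rightarrow> nat \<Rightarrow> 'a"
  by unfold_locales (auto simp: fscale_def fun_eq_iff algebra_simps)

lemma module_hom_fscaleI:
  assumes "\<And>x y. f (x + y) = f x + f y" "\<And>c x. f (fscale c x) = fscale c (f x)"
  shows "module_hom fscale fscale f"
  using assms fun_vs.module_axioms by (simp add: module_hom_def module_hom_axioms_def)

lemma sum_fun_apply: "(sum f A) x = (\<Sum>a\<in>A. f a x)" for f :: "'b \<Rightarrow> nat \<Rightarrow> 'a::field"
  by (induction A rule: infinite_finite_induct) auto

definition fspace :: "nat \<Rightarrow> (nat \<Rightarrow> 'a::field) set"
  where "fspace n = {f. \<forall>r\<ge>n. f r = 0}"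

definition bspace :: "nat \<Rightarrow> nat \<Rightarrow> (nat \<Rightarrow> 'a::field) set"
  where "bspace d i = {f. \<forall>r. r div d + 1 \<noteq> i \<longrightarrow> f r = 0}"

definition embed :: "nat \<Rightarrow> nat \<Rightarrow> 'a::field vec \<Rightarrow> nat \<Rightarrow> 'a"
  where "embed d i v = (\<lambda>r. if r div d + 1 = i then v $ (r mod d) else 0)"

text \<open>The action of \<open>A\<close> on the i-th summand, preceded by the projection onto that
  summand.\<close>

definition block_act :: "nat \<Rightarrow> nat \<Rightarrow> 'a::field mat \<Rightarrow> (nat \<Rightarrow> 'a) \<Rightarrow> nat \<Rightarrow> 'a"
  where "block_act d i A f = (\<lambda>r. if r div d + 1 = i then \<Sum>j<d. A $$ (r mod d, j) * f ((i - 1) * d + j) else 0)"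

lemma subspace_fspace: "fun_vs.subspace (fspace n)" and subspace_bspace: "fun_vs.subspace (bspace d i)"
  by (auto simp: fun_vs.subspace_def fspace_def bspace_def fscale_def)

text \<open>The whole space counts as a single block, so the transfer lemmas below serve both for
  \<open>H1\<close> on one summand and for the wreath product on the whole space.\<close>

lemma fspace_eq_bspace: "0 < n \<Longrightarrow> fspace n = bspace n 1"
  by (auto simp: fspace_def bspace_def div_eq_0_iff)

lemma block_split:
  assumes "0 < d" "r div d + 1 = i" shows "(i - 1) * d + r mod d = (r::nat)"
  using assms by auto

lemma embed_in: "embed d i v \<in> bspace d i"
  by (auto simp: embed_def bspace_def)

lemma embed_block: "1 \<le> i \<Longrightarrow> t < d \<Longrightarrow> embed d i v ((i - 1) * d + t) = v $ t"
  by (simp add: embed_def)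

lemma bspace_embed:
  assumes "0 < d" "1 \<le> i" "f \<in> bspace d i"
  obtains v where "v \<in> carrier_vec d" "embed d i v = f"
proof
  show "vec d (\<lambda>t. f ((i - 1) * d + t)) \<in> carrier_vec d" by simp
  show "embed d i (vec d (\<lambda>t. f ((i - 1) * d + t))) = f"
    using assms block_split[OF assms(1)] by (auto simp: embed_def bspace_def fun_eq_iff)
qed

lemma embed_inj:
  assumes "1 \<le> i" "v \<in> carrier_vec d" "w \<in> carrier_vec d" "embed d i v = embed d i w"
  shows "v = w"
proof (rule eq_vecI)
  fix t assume "t < dim_vec w"
  then show "v $ t = w $ t"
    using assms(3,4) embed_block[OF assms(1), of t d v] embed_block[OF assms(1), of t d w] by simp
qed (use assms in simp)

lemma embed_add: "0 < d \<Longrightarrow> v \<in> carrier_vec d \<Longrightarrow> w \<in> carrier_vec d \<Longrightarrow> embed d i (v + w) = embed d i v + embed d i w"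
  and embed_smult: "0 < d \<Longrightarrow> v \<in> carrier_vec d \<Longrightarrow> embed d i (c \<cdot>\<^sub>v v) = fscale c (embed d i v)"
  and embed_zero: "0 < d \<Longrightarrow> embed d i (0\<^sub>v d) = 0"
  by (auto simp: embed_def fscale_def fun_eq_iff)

lemma embed_finsum:
  assumes "0 < d" "finite F" "w \<in> F \<rightarrow> carrier_vec d"
  shows "embed d i (finsum_vec TYPE('a::field) d w F) = (\<Sum>b\<in>F. embed d i (w b))"
  using assms by (auto simp: embed_def fun_eq_iff sum_fun_apply index_finsum_vec)

lemma block_act_embed:
  assumes "0 < d" "1 \<le> i" "A \<in> carrier_mat d d" "v \<in> carrier_vec d"
  shows "block_act d i A (embed d i v) = embed d i (A *\<^sub>v v)"
proof
  fix r
  have "(\<Sum>j<d. A $$ (r mod d, j) * embed d i v ((i - 1) * d + j)) = (A *\<^sub>v v) $ (r mod d)"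
    if "r div d + 1 = i"
    using assms by (simp add: embed_block scalar_prod_def lessThan_atLeast0 del: add_diff_cancel_right')
  then show "block_act d i A (embed d i v) r = embed d i (A *\<^sub>v v) r" by (simp add: block_act_def embed_def)
qed

section \<open>Transfer of irreducibility and imprimitivity between column vectors and
  functions\<close>

lemma linear_subspace_iff:
  "linear_subspace n W \<longleftrightarrow> W \<subseteq> carrier_vec n \<and> 0\<^sub>v n \<in> W \<and>
    (\<forall>v\<in>W. \<forall>w\<in>W. v + w \<in> W) \<and> (\<forall>c. \<forall>v\<in>W. c \<cdot>\<^sub>v v \<in> W)" for W :: "'a::field vec set"
proof -
  have "vectorspace class_ring (module_vec TYPE('a) n)" by (rule vec_vs)
  moreover from this have "module class_ring (module_vec TYPE('a) n)" by (simp add: vectorspace_def)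
  ultimately show ?thesis
    unfolding linear_subspace_def VectorSpace.subspace_def submodule_def module_vec_simps
    by (auto simp: class_ring_simps)
qed

lemma linear_subspace_embed:
  assumes "0 < d" "fun_vs.subspace S"
  shows "linear_subspace d {v \<in> carrier_vec d. embed d i v \<in> S}"
  using assms by (auto simp: linear_subspace_iff fun_vs.subspace_def embed_add embed_smult embed_zero)

lemma subspace_embed_image:
  assumes "0 < d" "linear_subspace d W"
  shows "fun_vs.subspace (embed d i ` W)"
proof -
  have W: "\<And>v. v \<in> W \<Longrightarrow> v \<in> carrier_vec d" "0\<^sub>v d \<in> W" "\<And>v w. v \<in> W \<Longrightarrow> w \<in> W \<Longrightarrow> v + w \<in> W"
    "\<And>c v. v \<in> W \<Longrightarrow> c \<cdot>\<^sub>v v \<in> W"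
    using assms(2) by (auto simp: linear_subspace_iff)
  show ?thesis
    unfolding fun_vs.subspace_def
  proof (intro conjI ballI allI)
    show "0 \<in> embed d i ` W" using embed_zero[OF assms(1)] W(2) by (metis imageI)
    fix x assume "x \<in> embed d i ` W"
    then obtain v where v: "v \<in> W" "x = embed d i v" by blast
    show "fscale c x \<in> embed d i ` W" for c
      using embed_smult[OF assms(1) W(1)[OF v(1)], of i c] v W(4) by (metis imageI)
    fix y assume "y \<in> embed d i ` W"
    then obtain w where w: "w \<in> W" "y = embed d i w" by blast
    show "x + y \<in> embed d i ` W"
      using embed_add[OF assms(1) W(1)[OF v(1)] W(1)[OF w(1)]] v w W(3) by (metis imageI)
  qed
qed

text \<open>Pull \<open>S\<close> back along \<open>embed d i\<close> to a subspace of column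
  vectors, where irreducibility is defined.\<close>

lemma irreducibleD:
  assumes irr: "irreducible_group d H" and i: "1 \<le> i"
    and S: "fun_vs.subspace S" "S \<subseteq> bspace d i" "\<And>h f. h \<in> H \<Longrightarrow> f \<in> S \<Longrightarrow> block_act d i h f \<in> S"
  shows "S = {0} \<or> S = bspace d i"
proof -
  have d: "0 < d" and H: "subgroup H (GL d)" using irr by (auto simp: irreducible_group_def)
  let ?W = "{v \<in> carrier_vec d. embed d i v \<in> S}"
  have "(\<lambda>v. h *\<^sub>v v) ` ?W \<subseteq> ?W" if h: "h \<in> H" for h
  proof -
    have hm: "h \<in> carrier_mat d d" using GL_subgroup(1)[OF H] GL_mat h by blast
    show ?thesis
    proof (rule image_subsetI)
      fix v assume "v \<in> ?W"
      then show "h *\<^sub>v v \<in> ?W" using S(3)[OF h, of "embed d i v"] block_act_embed[OF d i hm, of v] hm by simp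
    qed
  qed
  then have "?W = {0\<^sub>v d} \<or> ?W = carrier_vec d"
    using irr linear_subspace_embed[OF d S(1)] unfolding irreducible_group_def by blast
  moreover have "S = embed d i ` ?W"
    using bspace_embed[OF d i] S(2) by (auto simp: image_iff)
  moreover have "embed d i ` carrier_vec d = bspace d i"
    using bspace_embed[OF d i] embed_in by blast
  ultimately show ?thesis by (metis (no_types, lifting) embed_zero[OF d] image_empty image_insert)
qed

lemma irreducibleI:
  assumes H: "subgroup H (GL d)" and d: "0 < d" and i: "1 \<le> i"
    and irr: "\<And>S. fun_vs.subspace S \<Longrightarrow> S \<subseteq> bspace d i \<Longrightarrow> (\<And>h f. h \<in> H \<Longrightarrow> f \<in> S \<Longrightarrow> block_act d i h f \<in> S)
      \<Longrightarrow> S = {0} \<or> S = bspace d i"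
  shows "irreducible_group d H"
  unfolding irreducible_group_def
proof (intro conjI allI impI H d)
  fix W assume W: "linear_subspace d W \<and> (\<forall>h\<in>H. (\<lambda>v. h *\<^sub>v v) ` W \<subseteq> W)"
  have Wc: "W \<subseteq> carrier_vec d" "0\<^sub>v d \<in> W" using W by (auto simp: linear_subspace_iff)
  have inj: "x \<in> W" if "embed d i x \<in> embed d i ` W" "x \<in> carrier_vec d" for x
    using that embed_inj[OF i] Wc by blast
  have "embed d i ` W = {0} \<or> embed d i ` W = bspace d i"
  proof (rule irr)
    show "fun_vs.subspace (embed d i ` W)" using subspace_embed_image[OF d] W by blast
    show "embed d i ` W \<subseteq> bspace d i" using embed_in by blast
    fix h f assume h: "h \<in> H" and "f \<in> embed d i ` W"
    then obtain v where v: "v \<in> W" "f = embed d i v" by blast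
    have "h \<in> carrier_mat d d" using GL_subgroup(1)[OF H] GL_mat h by blast
    then have "block_act d i h f = embed d i (h *\<^sub>v v)" using block_act_embed[OF d i] v Wc by blast
    then show "block_act d i h f \<in> embed d i ` W" using W h v by blast
  qed
  then show "W = {0\<^sub>v d} \<or> W = carrier_vec d"
  proof
    assume e: "embed d i ` W = {0}"
    have "x = 0\<^sub>v d" if "x \<in> W" for x
    proof (rule embed_inj[OF i])
      have "embed d i x \<in> {0}" using e that by blast
      then show "embed d i x = embed d i (0\<^sub>v d)" using embed_zero[OF d, of i] by simp
    qed (use that Wc in auto)
    then show ?thesis using Wc by blast
  next
    assume "embed d i ` W = bspace d i"
    then have "carrier_vec d \<subseteq> W" using inj embed_in by blast
    then show ?thesis using Wc by blast
  qed
qed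

text \<open>A permuted family of projections yields the decomposition with unique sums that
  \<open>imprimitive_group\<close> asks for: existence is \<open>P_sum\<close>, and uniqueness
  follows by applying the projections to a sum.\<close>

lemma imprimitive_of_projections:
  assumes irr: "irreducible_group d H" and i: "1 \<le> i"
    and proj: "projections fscale (bspace d i) M Q" and M: "1 < card M"
    and nz: "\<And>b. b \<in> M \<Longrightarrow> \<exists>f\<in>bspace d i. Q b f \<noteq> 0"
    and perm: "\<And>h b. h \<in> H \<Longrightarrow> b \<in> M \<Longrightarrow> \<exists>c\<in>M. \<forall>f\<in>bspace d i. block_act d i h (Q b f) = Q c (block_act d i h f)"
  shows "imprimitive_group d H"
proof -
  have d: "0 < d" and H: "subgroup H (GL d)" using irr by (auto simp: irreducible_group_def)
  interpret Q: projections fscale "bspace d i" M Q by (fact proj)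
  \<comment> \<open>Decompositions are indexed by an initial segment of the positive integers, so
    \<open>M\<close> is renumbered.\<close>
  obtain \<beta> where \<beta>: "bij_betw \<beta> {1..card M} M"
    using ex_bij_betw_nat_finite_1 Q.finite_index by blast
  have \<beta>M: "\<beta> b \<in> M" if "b \<in> {1..card M}" for b using \<beta> that bij_betwE by blast
  define W where "W b = {v \<in> carrier_vec d. embed d i v \<in> Q.part (\<beta> b)}" for b
  have hm: "h \<in> carrier_mat d d" if "h \<in> H" for h using GL_subgroup(1)[OF H] GL_mat that by blast
  have block_act_in: "block_act d i h f \<in> bspace d i" for h f by (auto simp: block_act_def bspace_def)
  have "direct_decomposition d (card M) W"
    unfolding direct_decomposition_def
  proof (intro conjI ballI)
    fix b assume b: "b \<in> {1..card M}"
    show "linear_subspace d (W b)"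
      unfolding W_def by (intro linear_subspace_embed d Q.subspace_part \<beta>M b)
    obtain f where f: "f \<in> bspace d i" "Q (\<beta> b) f \<noteq> 0" using nz \<beta>M[OF b] by blast
    obtain v where v: "v \<in> carrier_vec d" "embed d i v = Q (\<beta> b) f"
      using bspace_embed[OF d i Q.P_in[OF \<beta>M[OF b] f(1)]] by blast
    have "v \<in> W b" using v Q.P_in_part[OF f(1)] by (simp add: W_def)
    moreover have "v \<noteq> 0\<^sub>v d" using v f embed_zero[OF d] by metis
    ultimately show "W b \<noteq> {0\<^sub>v d}" by blast
  next
    fix v :: "'a vec" assume v: "v \<in> carrier_vec d"
    define w where "w = (\<lambda>b\<in>{1..card M}. SOME u. u \<in> carrier_vec d \<and> embed d i u = Q (\<beta> b) (embed d i v))"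
    have w: "w b \<in> carrier_vec d \<and> embed d i (w b) = Q (\<beta> b) (embed d i v)" if b: "b \<in> {1..card M}" for b
    proof -
      obtain u where "u \<in> carrier_vec d \<and> embed d i u = Q (\<beta> b) (embed d i v)"
        using bspace_embed[OF d i Q.P_in[OF \<beta>M[OF b] embed_in]] by blast
      then have "(SOME u. u \<in> carrier_vec d \<and> embed d i u = Q (\<beta> b) (embed d i v)) \<in> carrier_vec d \<and>
        embed d i (SOME u. u \<in> carrier_vec d \<and> embed d i u = Q (\<beta> b) (embed d i v)) = Q (\<beta> b) (embed d i v)"
        by (rule someI)
      then show ?thesis using b by (simp add: w_def)
    qed
    have wc: "w \<in> {1..card M} \<rightarrow> carrier_vec d" using w by blast
    have "embed d i (finsum_vec TYPE('a) d w {1..card M}) = (\<Sum>b\<in>{1..card M}. Q (\<beta> b) (embed d i v))"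
      using embed_finsum[OF d _ wc] w by simp
    also have "\<dots> = (\<Sum>b\<in>M. Q b (embed d i v))" by (rule sum.reindex_bij_betw[OF \<beta>])
    also have "\<dots> = embed d i v" using Q.P_sum embed_in by blast
    finally have "v = finsum_vec TYPE('a) d w {1..card M}"
      using embed_inj[OF i v finsum_vec_closed[OF wc]] by simp
    moreover have wW: "w \<in> (\<Pi>\<^sub>E b\<in>{1..card M}. W b)"
      using w Q.P_in_part[OF embed_in] by (auto simp: W_def w_def)
    moreover have "u = w" if u: "u \<in> (\<Pi>\<^sub>E b\<in>{1..card M}. W b)" "v = finsum_vec TYPE('a) d u {1..card M}" for u
    proof (rule PiE_ext[OF u(1) wW])
      fix b assume b: "b \<in> {1..card M}"
      have uW: "u a \<in> carrier_vec d" "embed d i (u a) \<in> Q.part (\<beta> a)" if "a \<in> {1..card M}" for a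
        using u(1) that by (auto simp: W_def PiE_def Pi_def)
      have uc: "u \<in> {1..card M} \<rightarrow> carrier_vec d" using uW by blast
      have "Q (\<beta> b) (embed d i v) = (\<Sum>a\<in>{1..card M}. Q (\<beta> b) (embed d i (u a)))"
        unfolding u(2) using embed_finsum[OF d _ uc] \<beta>M[OF b] by (simp add: Q.P_sum_distrib)
      also have "\<dots> = (\<Sum>a\<in>{1..card M}. if a = b then embed d i (u a) else 0)"
      proof (rule sum.cong[OF refl])
        fix a assume a: "a \<in> {1..card M}"
        have "a \<noteq> b \<Longrightarrow> \<beta> b \<noteq> \<beta> a" using \<beta> a b by (metis bij_betw_inv_into_left)
        then show "Q (\<beta> b) (embed d i (u a)) = (if a = b then embed d i (u a) else 0)"
          using Q.P_part[OF \<beta>M[OF a] uW(2)[OF a]] Q.P_other_part[OF \<beta>M[OF b] \<beta>M[OF a] _ uW(2)[OF a]] by auto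
      qed
      also have "\<dots> = embed d i (u b)" using b by simp
      finally show "u b = w b" using w[OF b] uW(1)[OF b] embed_inj[OF i] by metis
    qed
    ultimately show "\<exists>!w. w \<in> (\<Pi>\<^sub>E b\<in>{1..card M}. W b) \<and> v = finsum_vec TYPE('a) d w {1..card M}"
      by blast
  qed
  moreover have "(\<lambda>v. h *\<^sub>v v) ` W b \<in> W ` {1..card M}" if h: "h \<in> H" and b: "b \<in> {1..card M}" for h b
  proof -
    obtain c where c: "c \<in> M" "\<forall>f\<in>bspace d i. block_act d i h (Q (\<beta> b) f) = Q c (block_act d i h f)"
      using perm[OF h \<beta>M[OF b]] by blast
    then obtain a where a: "a \<in> {1..card M}" "\<beta> a = c" using \<beta> by (metis bij_betw_iff_bijections)
    have "h *\<^sub>v v \<in> W a" if v: "v \<in> W b" for v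
    proof -
      have vc: "v \<in> carrier_vec d" "embed d i v \<in> Q.part (\<beta> b)" using v by (auto simp: W_def)
      have "embed d i (h *\<^sub>v v) = block_act d i h (Q (\<beta> b) (embed d i v))"
        using block_act_embed[OF d i hm[OF h] vc(1)] Q.P_part[OF \<beta>M[OF b] vc(2)] by simp
      also have "\<dots> = Q c (block_act d i h (embed d i v))" using c embed_in by blast
      also have "\<dots> \<in> Q.part c" by (intro Q.P_in_part block_act_in)
      finally show ?thesis using vc hm[OF h] a by (auto simp: W_def)
    qed
    \<comment> \<open>The image has to be all of \<open>W a\<close>. A preimage of \<open>v\<close>
      in \<open>W b\<close> is the \<open>\<beta> b\<close>-component of the inverse image of
      \<open>v\<close> under \<open>h\<close>.\<close>
    moreover have "v \<in> (\<lambda>v. h *\<^sub>v v) ` W b" if v: "v \<in> W a" for v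
    proof -
      have vc: "v \<in> carrier_vec d" "embed d i v \<in> Q.part c" using v a by (auto simp: W_def)
      let ?h' = "inv\<^bsub>GL d\<^esub> h"
      have hG: "h \<in> carrier (GL d)" using GL_subgroup(1)[OF H] h by blast
      have h'm: "?h' \<in> carrier_mat d d" using GL_mat GL_inv(1)[OF hG] by blast
      define u where "u = ?h' *\<^sub>v v"
      have u: "u \<in> carrier_vec d" "h *\<^sub>v u = v"
        using vc h'm hm[OF h] GL_inv(2)[OF hG] by (auto simp: u_def simp flip: assoc_mult_mat_vec)
      obtain x where x: "x \<in> carrier_vec d" "embed d i x = Q (\<beta> b) (embed d i u)"
        using bspace_embed[OF d i Q.P_in[OF \<beta>M[OF b] embed_in]] by blast
      have "embed d i (h *\<^sub>v x) = block_act d i h (Q (\<beta> b) (embed d i u))"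
        using block_act_embed[OF d i hm[OF h] x(1)] x(2) by simp
      also have "\<dots> = Q c (block_act d i h (embed d i u))" using c embed_in by blast
      also have "\<dots> = embed d i v" using block_act_embed[OF d i hm[OF h] u(1)] u(2) Q.P_part[OF c(1) vc(2)] by simp
      finally have "h *\<^sub>v x = v"
        using embed_inj[OF i mult_mat_vec_carrier[OF hm[OF h] x(1)] vc(1)] by blast
      moreover have "x \<in> W b" using x Q.P_in_part[OF embed_in] by (simp add: W_def)
      ultimately show ?thesis by blast
    qed
    ultimately have "(\<lambda>v. h *\<^sub>v v) ` W b = W a" by blast
    then show ?thesis using a by blast
  qed
  ultimately show ?thesis using irr M unfolding imprimitive_group_def by blast
qed

section \<open>Matrices acting on the whole space, and its standard and conjugated
  decompositions\<close>

definition mat_act :: "'a::field mat \<Rightarrow> (nat \<Rightarrow> 'a) \<Rightarrow> nat \<Rightarrow> 'a"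
  where "mat_act A f = (\<lambda>r. if r < dim_row A then \<Sum>c<dim_col A. A $$ (r, c) * f c else 0)"

lemma mat_act_in: "A \<in> carrier_mat n n \<Longrightarrow> mat_act A f \<in> fspace n"
  by (auto simp: mat_act_def fspace_def)

lemma mat_act_hom: "module_hom fscale fscale (mat_act A)"
  by (rule module_hom_fscaleI)
    (auto simp: mat_act_def fscale_def fun_eq_iff algebra_simps sum.distrib sum_distrib_left)

lemma mat_act_mult:
  assumes "A \<in> carrier_mat n n" "B \<in> carrier_mat n n"
  shows "mat_act (A * B) f = mat_act A (mat_act B f)"
proof
  fix r
  have "(\<Sum>c<n. (\<Sum>s<n. A $$ (r, s) * B $$ (s, c)) * f c) = (\<Sum>s<n. A $$ (r, s) * (\<Sum>c<n. B $$ (s, c) * f c))"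
    unfolding sum_distrib_left sum_distrib_right mult.assoc by (rule sum.swap)
  then show "mat_act (A * B) f r = mat_act A (mat_act B f) r"
    using assms by (simp add: mat_act_def scalar_prod_def lessThan_atLeast0)
qed

lemma mat_act_one: "f \<in> fspace n \<Longrightarrow> mat_act (1\<^sub>m n) f = f"
proof
  fix r assume f: "f \<in> fspace n"
  have "(\<Sum>c<n. 1\<^sub>m n $$ (r, c) * f c) = (\<Sum>c<n. if c = r then f c else 0)" if "r < n"
    using that by (intro sum.cong) auto
  then show "mat_act (1\<^sub>m n) f r = f r" using f by (auto simp: mat_act_def fspace_def)
qed

lemma mat_act_inverse:
  assumes "A \<in> carrier_mat n n" "B \<in> carrier_mat n n" "A * B = 1\<^sub>m n" "f \<in> fspace n"
  shows "mat_act A (mat_act B f) = f"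
  using mat_act_mult[OF assms(1,2)] mat_act_one[OF assms(4)] assms(3) by metis

lemma block_act_mat_act: "0 < n \<Longrightarrow> A \<in> carrier_mat n n \<Longrightarrow> block_act n 1 A f = mat_act A f"
  by (auto simp: block_act_def mat_act_def fun_eq_iff div_eq_0_iff)

definition block_proj :: "nat \<Rightarrow> nat \<Rightarrow> (nat \<Rightarrow> 'a::field) \<Rightarrow> nat \<Rightarrow> 'a"
  where "block_proj d i f = (\<lambda>r. if r div d + 1 = i then f r else 0)"

lemma projections_block: "projections fscale (fspace (d * k)) {1..k} (block_proj d)"
proof (intro projections.intro projections_axioms.intro)
  show "(\<Sum>i\<in>{1..k}. block_proj d i f) = f" if f: "f \<in> fspace (d * k)" for f
  proof
    fix r
    show "(\<Sum>i\<in>{1..k}. block_proj d i f) r = f r"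
    proof (cases "r < d * k")
      case True
      have "(\<Sum>i\<in>{1..k}. block_proj d i f) r = (\<Sum>i\<in>{1..k}. if i = r div d + 1 then f r else 0)"
        unfolding sum_fun_apply by (rule sum.cong) (auto simp: block_proj_def)
      then show ?thesis using index_block(1)[OF True] by simp
    next
      case False
      then show ?thesis using f by (simp add: sum_fun_apply block_proj_def fspace_def)
    qed
  qed
  show "module_hom fscale fscale (block_proj d i)" for i
    by (rule module_hom_fscaleI) (auto simp: block_proj_def fscale_def fun_eq_iff)
  show "vector_space (fscale :: 'a \<Rightarrow> _)" by unfold_locales
  show "fun_vs.subspace (fspace (d * k) :: (nat \<Rightarrow> 'a) set)" by (rule subspace_fspace)
qed (auto simp: block_proj_def fspace_def fun_eq_iff)

lemma part_block:
  assumes "0 < d" "i \<in> {1..k}"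
  shows "projections.part (fspace (d * k)) (block_proj d) i = (bspace d i :: (nat \<Rightarrow> 'a::field) set)"
proof -
  interpret projections fscale "fspace (d * k) :: (nat \<Rightarrow> 'a) set" "{1..k}" "block_proj d" by (rule projections_block)
  have "f \<in> fspace (d * k)" if f: "f \<in> bspace d i" for f :: "nat \<Rightarrow> 'a"
  proof -
    have "r div d + 1 \<noteq> i" if "r \<ge> d * k" for r
      using that assms div_le_mono[of "d * k" r d] by simp
    then show ?thesis using f by (auto simp: bspace_def fspace_def)
  qed
  moreover have "block_proj d i f = f" if "f \<in> bspace d i" for f :: "nat \<Rightarrow> 'a"
    using that by (auto simp: bspace_def block_proj_def fun_eq_iff)
  ultimately have "bspace d i \<subseteq> part i" using partI by blast
  moreover have "part i \<subseteq> bspace d i" by (auto simp: part_def bspace_def block_proj_def)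
  ultimately show ?thesis by blast
qed

lemma mat_act_bmat_apply:
  assumes p: "p permutes {1..k}" and q: "q \<in> {1..k}" and r: "r < d * k" "r div d + 1 = p q"
  shows "mat_act (bmat d k h p) f r = (\<Sum>j<d. h q $$ (r mod d, j) * f ((q - 1) * d + j))"
proof -
  have "mat_act (bmat d k h p) f r = (\<Sum>c<d * k. bmat d k h p $$ (r, c) * f c)" using r by (simp add: mat_act_def)
  also have "\<dots> = (\<Sum>j<d. bmat d k h p $$ (r, (q - 1) * d + j) * f ((q - 1) * d + j))"
  proof (rule sum_block[OF q])
    fix s assume s: "s < d * k" "s div d + 1 \<noteq> q"
    then have "p (s div d + 1) \<noteq> p q" using permutes_inj[OF p] by (auto dest: injD)
    then show "bmat d k h p $$ (r, s) * f s = 0" using r s by (simp add: bmat_index)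
  qed
  also have "\<dots> = (\<Sum>j<d. h q $$ (r mod d, j) * f ((q - 1) * d + j))"
  proof (rule sum.cong[OF refl])
    fix j assume "j \<in> {..<d}"
    then have j: "j < d" by simp
    note b = block_index[OF q j]
    show "bmat d k h p $$ (r, (q - 1) * d + j) * f ((q - 1) * d + j) =
      h q $$ (r mod d, j) * f ((q - 1) * d + j)"
      unfolding bmat_index[OF r(1) b(1)] b using r(2) by simp
  qed
  finally show ?thesis .
qed

text \<open>Rows in block \<open>p q\<close> read only the entries of block \<open>q\<close>, so
  cutting the argument down to block \<open>q\<close> is the same as cutting the result down to
  block \<open>p q\<close>.\<close>

lemma mat_act_bmat_block_proj:
  assumes p: "p permutes {1..k}" and q: "q \<in> {1..k}"
  shows "mat_act (bmat d k h p) (block_proj d q f) = block_proj d (p q) (mat_act (bmat d k h p) f)"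
proof
  fix r
  show "mat_act (bmat d k h p) (block_proj d q f) r = block_proj d (p q) (mat_act (bmat d k h p) f) r"
  proof (cases "r < d * k")
    case True
    then obtain q' where q': "q' \<in> {1..k}" "r div d + 1 = p q'"
      using index_block(1)[OF True] p by (metis permutes_image imageE)
    have "p q' = p q \<longleftrightarrow> q' = q" using permutes_inj[OF p] by (auto dest: injD)
    moreover have "block_proj d q f ((q' - 1) * d + j) = (if q' = q then f ((q' - 1) * d + j) else 0)"
      if "j < d" for j
      unfolding block_proj_def block_index[OF q'(1) that] by simp
    ultimately show ?thesis
      unfolding mat_act_bmat_apply[OF p q'(1) True q'(2)] block_proj_def[of d "p q"] q'(2)
      by (auto intro!: sum.cong sum.neutral)
  next
    case False
    then show ?thesis by (simp add: mat_act_def block_proj_def)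
  qed
qed

text \<open>The element of the base group with \<open>h\<close> in coordinate
  \<open>i\<close>.\<close>

definition at_block :: "nat \<Rightarrow> nat \<Rightarrow> nat \<Rightarrow> 'a::field mat \<Rightarrow> 'a mat"
  where "at_block d k i h = bmat d k (\<lambda>q. if q = i then h else 1\<^sub>m d) id"

lemma mat_act_at_block:
  assumes f: "f \<in> fspace (d * k)" and i: "i \<in> {1..k}" and d: "0 < d"
  shows "mat_act (at_block d k i h) f = (\<lambda>r. if r div d + 1 = i then block_act d i h f r else f r)"
proof
  fix r
  show "mat_act (at_block d k i h) f r = (if r div d + 1 = i then block_act d i h f r else f r)"
  proof (cases "r < d * k")
    case True
    define q where "q = r div d + 1"
    have q: "q \<in> {1..k}" unfolding q_def by (rule index_block(1)[OF True])
    have m: "r mod d < d" using d by simp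
    have r: "(q - 1) * d + r mod d = r" by (simp add: q_def)
    have 1: "mat_act (at_block d k i h) f r = (\<Sum>j<d. (if q = i then h else 1\<^sub>m d) $$ (r mod d, j) * f ((q - 1) * d + j))"
      unfolding at_block_def by (rule mat_act_bmat_apply[OF permutes_id q True]) (simp add: q_def)
    have "(\<Sum>j<d. 1\<^sub>m d $$ (r mod d, j) * f ((q - 1) * d + j)) = (\<Sum>j<d. if j = r mod d then f ((q - 1) * d + j) else 0)"
      using m by (intro sum.cong) auto
    also have "\<dots> = f r" using m r by simp
    finally show ?thesis unfolding 1 by (auto simp: block_act_def q_def)
  next
    case False
    then have "r div d + 1 \<noteq> i" using i d div_le_mono[of "d * k" r d] by auto
    then show ?thesis using False f by (simp add: mat_act_def at_block_def fspace_def)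
  qed
qed

lemma mat_act_at_block_lift:
  assumes "f \<in> bspace d i" "i \<in> {1..k}" "0 < d"
  shows "mat_act (at_block d k i h) f = block_act d i h f"
proof -
  have "f \<in> fspace (d * k)"
    using projections.part_V[OF projections_block assms(2)] part_block[OF assms(3,2)] assms(1) by blast
  then show ?thesis using assms by (auto simp: mat_act_at_block block_act_def bspace_def)
qed

text \<open>With \<open>g'\<close> inverse to \<open>g\<close>, these are the projections belonging
  to the images under \<open>g\<close> of the standard summands of dimension
  \<open>e\<close>.\<close>

definition conj_proj :: "nat \<Rightarrow> 'a::field mat \<Rightarrow> 'a mat \<Rightarrow> nat \<Rightarrow> (nat \<Rightarrow> 'a) \<Rightarrow> nat \<Rightarrow> 'a"
  where "conj_proj e g g' j f = mat_act g (block_proj e j (mat_act g' f))"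

lemma projections_conj:
  assumes g: "g \<in> carrier_mat (e * l) (e * l)" "g' \<in> carrier_mat (e * l) (e * l)"
    "g * g' = 1\<^sub>m (e * l)" "g' * g = 1\<^sub>m (e * l)"
  shows "projections fscale (fspace (e * l)) {1..l} (conj_proj e g g')"
proof -
  interpret B: projections fscale "fspace (e * l) :: (nat \<Rightarrow> 'a) set" "{1..l}" "block_proj e" by (rule projections_block)
  interpret g: module_hom fscale fscale "mat_act g" by (rule mat_act_hom)
  interpret g': module_hom fscale fscale "mat_act g'" by (rule mat_act_hom)
  show ?thesis
  proof (intro projections.intro projections_axioms.intro)
    show "module_hom fscale fscale (conj_proj e g g' j)" if "j \<in> {1..l}" for j
      using B.P_add[OF that] B.P_scale[OF that]
      by (intro module_hom_fscaleI) (simp_all add: conj_proj_def g.add g'.add g.scale g'.scale)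
    show "conj_proj e g g' j f \<in> fspace (e * l)" for j f
      unfolding conj_proj_def by (rule mat_act_in[OF g(1)])
    show "(\<Sum>j\<in>{1..l}. conj_proj e g g' j f) = f" if f: "f \<in> fspace (e * l)" for f
    proof -
      have "(\<Sum>j\<in>{1..l}. conj_proj e g g' j f) = mat_act g (\<Sum>j\<in>{1..l}. block_proj e j (mat_act g' f))"
        by (simp add: conj_proj_def g.sum)
      then show ?thesis using B.P_sum[OF mat_act_in[OF g(2)]] mat_act_inverse[OF g(1,2,3) f] by simp
    qed
    show "conj_proj e g g' i (conj_proj e g g' j f) = (if i = j then conj_proj e g g' j f else 0)"
      if ij: "i \<in> {1..l}" "j \<in> {1..l}" and f: "f \<in> fspace (e * l)" for i j f
    proof -
      have "mat_act g' (mat_act g (block_proj e j (mat_act g' f))) = block_proj e j (mat_act g' f)"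
        by (rule mat_act_inverse[OF g(2,1,4) B.P_in[OF ij(2) mat_act_in[OF g(2)]]])
      then show ?thesis
        unfolding conj_proj_def using B.P_orth[OF ij mat_act_in[OF g(2)]] g.zero by simp
    qed
  qed (simp_all add: subspace_fspace fun_vs.vector_space_axioms)
qed

lemma part_conj:
  assumes g: "g \<in> carrier_mat (e * l) (e * l)" "g' \<in> carrier_mat (e * l) (e * l)"
    "g * g' = 1\<^sub>m (e * l)" "g' * g = 1\<^sub>m (e * l)" and e: "0 < e" and j: "j \<in> {1..l}"
  shows "projections.part (fspace (e * l)) (conj_proj e g g') j = {f \<in> fspace (e * l). mat_act g' f \<in> bspace e j}"
proof -
  interpret B: projections fscale "fspace (e * l) :: (nat \<Rightarrow> 'a) set" "{1..l}" "block_proj e" by (rule projections_block)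
  interpret C: projections fscale "fspace (e * l)" "{1..l}" "conj_proj e g g'" by (rule projections_conj[OF g])
  note part = part_block[OF e j]
  show ?thesis
  proof (intro equalityI subsetI CollectI conjI)
    fix f assume f: "f \<in> C.part j"
    show fV: "f \<in> fspace (e * l)" using C.part_V[OF j f] .
    have "mat_act g' f = mat_act g' (mat_act g (block_proj e j (mat_act g' f)))"
      using C.P_part[OF j f] by (simp add: conj_proj_def)
    also have "\<dots> = block_proj e j (mat_act g' f)"
      by (rule mat_act_inverse[OF g(2,1,4) B.P_in[OF j mat_act_in[OF g(2)]]])
    also have "\<dots> \<in> bspace e j" using B.P_in_part[OF mat_act_in[OF g(2)]] part by blast
    finally show "mat_act g' f \<in> bspace e j" .
  next
    fix f assume f: "f \<in> {f \<in> fspace (e * l). mat_act g' f \<in> bspace e j}"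
    then have "block_proj e j (mat_act g' f) = mat_act g' f" using B.P_part[OF j] part by blast
    then have "conj_proj e g g' j f = f" unfolding conj_proj_def using mat_act_inverse[OF g(1,2,3)] f by simp
    then show "f \<in> C.part j" using C.partI f by blast
  qed
qed

section \<open>Wreath products and a second decomposition\<close>

lemma at_block_carrier [simp]: "at_block d k i h \<in> carrier_mat (d * k) (d * k)"
  by (simp add: at_block_def)

lemma at_block_mult:
  assumes "h \<in> carrier_mat d d" "h' \<in> carrier_mat d d"
  shows "at_block d k i h * at_block d k i h' = at_block d k i (h * h')"
  unfolding at_block_def using assms by (subst bmat_mult) (auto intro!: bmat_cong)

lemma at_block_one: "at_block d k i (1\<^sub>m d) = 1\<^sub>m (d * k)"
  unfolding at_block_def by (simp add: bmat_one)

lemma at_block_wreath: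
  "subgroup H (GL d) \<Longrightarrow> subgroup K (sym_group k) \<Longrightarrow> h \<in> H \<Longrightarrow> at_block d k i h \<in> wreath_GL d k H K"
  unfolding at_block_def using GL_subgroup(2) sym_subgroup(2) by (intro wreath_GLI) auto

text \<open>Conjugation by a permutation matrix permutes the base factors; this supplies
  \<open>L_H\<close>.\<close>

lemma perm_at_block:
  assumes p: "p permutes {1..k}" and h: "h \<in> carrier_mat d d"
  shows "bmat d k (\<lambda>_. 1\<^sub>m d) p * at_block d k i h = at_block d k (p i) h * bmat d k (\<lambda>_. 1\<^sub>m d) p"
proof -
  have pq: "p q \<in> {1..k}" if "q \<in> {1..k}" for q using permutes_range[OF p that] .
  have inj: "p q = p i \<longleftrightarrow> q = i" for q using permutes_inj[OF p] by (auto dest: injD)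
  have "bmat d k (\<lambda>_. 1\<^sub>m d) p * at_block d k i h = bmat d k (\<lambda>q. 1\<^sub>m d * (if q = i then h else 1\<^sub>m d)) (p \<circ> id)"
    unfolding at_block_def using h by (intro bmat_mult) auto
  moreover have "at_block d k (p i) h * bmat d k (\<lambda>_. 1\<^sub>m d) p =
      bmat d k (\<lambda>q. (if p q = p i then h else 1\<^sub>m d) * 1\<^sub>m d) (id \<circ> p)"
    unfolding at_block_def using h pq by (intro bmat_mult) auto
  ultimately show ?thesis using h by (auto simp: inj intro!: bmat_cong)
qed

lemma fspace_unit: "C < n \<Longrightarrow> (\<lambda>r. if r = C then 1 else 0) \<in> fspace n"
  by (auto simp: fspace_def)

lemma mat_act_unit: "A \<in> carrier_mat n n \<Longrightarrow> r < n \<Longrightarrow> C < n \<Longrightarrow> mat_act A (\<lambda>r. if r = C then 1 else 0) r = A $$ (r, C)"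
  by (simp add: mat_act_def if_distrib[of "(*) _"] cong: if_cong)

lemma wreath_transitive_blocks:
  assumes irr: "irreducible_group d H" and nt: "H \<noteq> {1\<^sub>m d}"
    and K: "subgroup K (sym_group k)" "transitive_perms k K"
  shows "transitive_blocks fscale (fspace (d * k)) {1..k} (block_proj d)
    (\<lambda>i. (\<lambda>h. mat_act (at_block d k i h)) ` H) (mat_act ` wreath_GL d k H K) K (\<lambda>p. mat_act (bmat d k (\<lambda>_. 1\<^sub>m d) p))"
proof (intro transitive_blocks.intro transitive_blocks_axioms.intro)
  have d: "0 < d" and H: "subgroup H (GL d)" using irr by (auto simp: irreducible_group_def)
  note part = part_block[OF d]
  have W: "subgroup (wreath_GL d k H K) (GL (d * k))" by (rule wreath_subgroup[OF H K(1)])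
  have Wm: "A \<in> carrier_mat (d * k) (d * k)" if "A \<in> wreath_GL d k H K" for A
    using GL_subgroup(1)[OF W] GL_mat that by blast
  have hm: "h \<in> carrier_mat d d" if "h \<in> H" for h using GL_subgroup(1)[OF H] GL_mat that by blast
  show "vector_space (fscale :: 'a \<Rightarrow> _)" by unfold_locales
  show "projections fscale (fspace (d * k)) {1..k} (block_proj d :: _ \<Rightarrow> (nat \<Rightarrow> 'a) \<Rightarrow> _)" by (rule projections_block)
  show "module_hom fscale fscale g" if "g \<in> mat_act ` wreath_GL d k H K" for g using that mat_act_hom by blast
  show "g v \<in> fspace (d * k)" if "g \<in> mat_act ` wreath_GL d k H K" for g v using that mat_act_in Wm by blast
  show "\<exists>g'\<in>mat_act ` wreath_GL d k H K. \<forall>v\<in>fspace (d * k). g' (g v) = v \<and> g (g' v) = v"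
    if g: "g \<in> mat_act ` wreath_GL d k H K" for g
  proof -
    obtain A where A: "A \<in> wreath_GL d k H K" "g = mat_act A" using g by blast
    have AG: "A \<in> carrier (GL (d * k))" using GL_subgroup(1)[OF W] A by blast
    note inv = GL_inv[OF AG]
    have "mat_act (inv\<^bsub>GL (d * k)\<^esub> A) (g v) = v \<and> g (mat_act (inv\<^bsub>GL (d * k)\<^esub> A) v) = v" if "v \<in> fspace (d * k)" for v
      unfolding A(2) using mat_act_inverse[OF GL_mat[OF AG] GL_mat[OF inv(1)] inv(2) that]
        mat_act_inverse[OF GL_mat[OF inv(1)] GL_mat[OF AG] inv(3) that] by simp
    then show ?thesis using GL_subgroup(4)[OF W A(1)] by blast
  qed
  show "p permutes {1..k}" if "p \<in> K" for p using sym_subgroup(1)[OF K(1) that] .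
  show "mat_act (bmat d k (\<lambda>_. 1\<^sub>m d) p) \<in> mat_act ` wreath_GL d k H K" if "p \<in> K" for p
    using GL_subgroup(2)[OF H] that by (intro imageI wreath_GLI)
  fix i assume i: "i \<in> {1..k}"
  show "h \<in> mat_act ` wreath_GL d k H K" if "h \<in> (\<lambda>h. mat_act (at_block d k i h)) ` H" for h
    using that at_block_wreath[OF H K(1)] by blast
  show "\<exists>h'\<in>(\<lambda>h. mat_act (at_block d k i h)) ` H. \<forall>v\<in>fspace (d * k). h' (h v) = v \<and> h (h' v) = v"
    if h: "h \<in> (\<lambda>h. mat_act (at_block d k i h)) ` H" for h
  proof -
    obtain x where x: "x \<in> H" "h = mat_act (at_block d k i x)" using h by blast
    have xG: "x \<in> carrier (GL d)" using GL_subgroup(1)[OF H] x by blast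
    note inv = GL_inv[OF xG]
    have "mat_act (at_block d k i (inv\<^bsub>GL d\<^esub> x)) (h v) = v \<and> h (mat_act (at_block d k i (inv\<^bsub>GL d\<^esub> x)) v) = v"
      if "v \<in> fspace (d * k)" for v
      unfolding x(2)
      using mat_act_inverse[OF at_block_carrier at_block_carrier _ that, of i x i "inv\<^bsub>GL d\<^esub> x"]
        mat_act_inverse[OF at_block_carrier at_block_carrier _ that, of i "inv\<^bsub>GL d\<^esub> x" i x]
      by (simp add: at_block_mult GL_mat[OF xG] GL_mat[OF inv(1)] inv(2,3) at_block_one)
    then show ?thesis using GL_subgroup(4)[OF H x(1)] by blast
  qed
  show "\<exists>h''\<in>(\<lambda>h. mat_act (at_block d k i h)) ` H. \<forall>v\<in>fspace (d * k). h'' v = h (h' v)"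
    if h: "h \<in> (\<lambda>h. mat_act (at_block d k i h)) ` H" "h' \<in> (\<lambda>h. mat_act (at_block d k i h)) ` H" for h h'
  proof -
    obtain x y where x: "x \<in> H" "h = mat_act (at_block d k i x)" "y \<in> H" "h' = mat_act (at_block d k i y)" using h by blast
    have "mat_act (at_block d k i (x * y)) v = h (h' v)" for v
      unfolding x(2,4) using mat_act_mult[OF at_block_carrier at_block_carrier] at_block_mult hm x by metis
    then show ?thesis using GL_subgroup(3)[OF H x(1,3)] by blast
  qed
  show "h v - v \<in> projections.part (fspace (d * k)) (block_proj d) i"
    if "h \<in> (\<lambda>h. mat_act (at_block d k i h)) ` H" "v \<in> fspace (d * k)" for h v
    unfolding part[OF i] using that by (auto simp: bspace_def mat_act_at_block[OF _ i d])
  show "h v = v" if j: "j \<in> {1..k}" "i \<noteq> j" "h \<in> (\<lambda>h. mat_act (at_block d k i h)) ` H"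
    "v \<in> projections.part (fspace (d * k)) (block_proj d) j" for j h v
  proof -
    have v: "v \<in> bspace d j" using j part by blast
    have vV: "v \<in> fspace (d * k)" using projections.part_V[OF projections_block] j by blast
    \<comment> \<open>\<open>h\<close> changes only block \<open>i\<close>, and there
      \<open>v\<close> vanishes.\<close>
    have "v ((i - 1) * d + t) = 0" if "t < d" for t
      using v block_index(2)[OF i that] j by (auto simp: bspace_def)
    then have "block_act d i x v r = v r" if "r div d + 1 = i" for x r
      using that v j by (auto simp: block_act_def bspace_def)
    then show ?thesis using j(3) vV by (auto simp: mat_act_at_block[OF _ i d])
  qed
  show "\<exists>h\<in>(\<lambda>h. mat_act (at_block d k i h)) ` H. \<exists>v\<in>fspace (d * k). h v \<noteq> v"
  proof (rule ccontr)
    assume c: "\<not> ?thesis"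
    \<comment> \<open>If the copy of \<open>h\<close> acted trivially, its values at unit vectors
      would show that \<open>h\<close> has the entries of the identity.\<close>
    obtain h where h: "h \<in> H" "h \<noteq> 1\<^sub>m d" using nt GL_subgroup(2)[OF H] by blast
    have "h = 1\<^sub>m d"
    proof (rule eq_matI)
      fix r t assume rt: "r < dim_row (1\<^sub>m d :: 'a mat)" "t < dim_col (1\<^sub>m d :: 'a mat)"
      let ?r = "(i - 1) * d + r" and ?t = "(i - 1) * d + t"
      have rt': "r < d" "t < d" using rt by simp_all
      have n: "?r < d * k" "?t < d * k" using block_index(1)[OF i rt'(1)] block_index(1)[OF i rt'(2)] by auto
      have "mat_act (at_block d k i h) (\<lambda>r. if r = ?t then 1 else 0) ?r = (if ?r = ?t then 1 else 0)"
        using c h fspace_unit[OF n(2)] by (metis (mono_tags, lifting) image_eqI)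
      then have "at_block d k i h $$ (?r, ?t) = (if r = t then 1 else 0)"
        unfolding mat_act_unit[OF at_block_carrier n] by simp
      then show "h $$ (r, t) = 1\<^sub>m d $$ (r, t)"
        using rt' unfolding at_block_def bmat_block[OF i i rt'] by simp
    qed (use hm[OF h(1)] in auto)
    then show False using h by blast
  qed
  show "S = {0} \<or> S = projections.part (fspace (d * k)) (block_proj d) i"
    if S: "fun_vs.subspace S" "S \<subseteq> projections.part (fspace (d * k)) (block_proj d) i"
      "\<And>h v. h \<in> (\<lambda>h. mat_act (at_block d k i h)) ` H \<Longrightarrow> v \<in> S \<Longrightarrow> h v \<in> S" for S
    unfolding part[OF i]
  proof (rule irreducibleD[OF irr _ S(1)])
    show "1 \<le> i" using i by simp
    show SU: "S \<subseteq> bspace d i" using S(2) part[OF i] by blast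
    show "block_act d i h f \<in> S" if hf: "h \<in> H" "f \<in> S" for h f
      using S(3)[OF imageI[OF hf(1)] hf(2)] mat_act_at_block_lift[of f d i k h, OF _ i d] SU hf by auto
  qed
  show "\<exists>p\<in>K. p i = j" if "j \<in> {1..k}" for j using K(2) i that by (auto simp: transitive_perms_def)
  fix p assume p: "p \<in> K"
  note pp = sym_subgroup(1)[OF K(1) p]
  show "mat_act (bmat d k (\<lambda>_. 1\<^sub>m d) p) v \<in> projections.part (fspace (d * k)) (block_proj d) (p i)"
    if v: "v \<in> projections.part (fspace (d * k)) (block_proj d) i" for v
  proof -
    have "block_proj d i v = v" using projections.P_part[OF projections_block i v] .
    then have "mat_act (bmat d k (\<lambda>_. 1\<^sub>m d) p) v = block_proj d (p i) (mat_act (bmat d k (\<lambda>_. 1\<^sub>m d) p) v)"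
      using mat_act_bmat_block_proj[OF pp i, of d "\<lambda>_. 1\<^sub>m d" v] by simp
    then show ?thesis
      using projections.P_in_part[OF projections_block mat_act_in[OF bmat_carrier[of d k "\<lambda>_. 1\<^sub>m d" p]]] by metis
  qed
  show "\<exists>h'\<in>(\<lambda>h. mat_act (at_block d k (p i) h)) ` H. \<forall>v\<in>fspace (d * k).
      mat_act (bmat d k (\<lambda>_. 1\<^sub>m d) p) (h v) = h' (mat_act (bmat d k (\<lambda>_. 1\<^sub>m d) p) v)"
    if h: "h \<in> (\<lambda>h. mat_act (at_block d k i h)) ` H" for h
  proof -
    obtain x where x: "x \<in> H" "h = mat_act (at_block d k i x)" using h by blast
    have "mat_act (bmat d k (\<lambda>_. 1\<^sub>m d) p) (h v) = mat_act (at_block d k (p i) x) (mat_act (bmat d k (\<lambda>_. 1\<^sub>m d) p) v)" for v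
      unfolding x(2) mat_act_mult[OF bmat_carrier at_block_carrier, symmetric]
        mat_act_mult[OF at_block_carrier bmat_carrier, symmetric] perm_at_block[OF pp hm[OF x(1)]] ..
    then show ?thesis using x by blast
  qed
qed

lemma wreath_irreducible:
  assumes irr: "irreducible_group d H" and nt: "H \<noteq> {1\<^sub>m d}"
    and K: "subgroup K (sym_group k)" "transitive_perms k K" and k: "0 < k"
  shows "irreducible_group (d * k) (wreath_GL d k H K)"
proof -
  have d: "0 < d" and H: "subgroup H (GL d)" using irr by (auto simp: irreducible_group_def)
  have n: "0 < d * k" using d k by simp
  interpret T: transitive_blocks fscale "fspace (d * k)" "{1..k}" "block_proj d"
    "\<lambda>i. (\<lambda>h. mat_act (at_block d k i h)) ` H" "mat_act ` wreath_GL d k H K" K "\<lambda>p. mat_act (bmat d k (\<lambda>_. 1\<^sub>m d) p)"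
    by (rule wreath_transitive_blocks[OF irr nt K])
  note W = wreath_subgroup[OF H K(1)]
  show ?thesis
  proof (rule irreducibleI[OF W n order.refl])
    fix S assume S: "fun_vs.subspace S" "S \<subseteq> bspace (d * k) 1"
      "\<And>h f. h \<in> wreath_GL d k H K \<Longrightarrow> f \<in> S \<Longrightarrow> block_act (d * k) 1 h f \<in> S"
    have "mat_act h f \<in> S" if hf: "h \<in> wreath_GL d k H K" "f \<in> S" for h f
      using S(3)[OF hf] block_act_mat_act[OF n GL_mat] GL_subgroup(1)[OF W] hf by (metis subsetD)
    then show "S = {0} \<or> S = bspace (d * k) 1"
      using T.irreducible[OF S(1)] S(2) fspace_eq_bspace[OF n] by (metis imageE)
  qed
qed

section \<open>Subgroups of a conjugated wreath product\<close>

lemma conj_GL_iff: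
  "A \<in> conj_set (GL n) g B \<longleftrightarrow> (\<exists>C\<in>B. A = g * C * inv\<^bsub>GL n\<^esub> g)"
  by (auto simp: conj_set_eq GL_mult)

lemma mat_act_conj_proj:
  assumes g: "g \<in> carrier (GL (e * l))" and p: "p permutes {1..l}" and j: "j \<in> {1..l}"
    and A: "A = g * bmat e l h p * inv\<^bsub>GL (e * l)\<^esub> g"
  shows "mat_act A (conj_proj e g (inv\<^bsub>GL (e * l)\<^esub> g) j f) = conj_proj e g (inv\<^bsub>GL (e * l)\<^esub> g) (p j) (mat_act A f)"
proof -
  let ?g = "inv\<^bsub>GL (e * l)\<^esub> g"
  note inv = GL_inv[OF g]
  note m = GL_mat[OF g] GL_mat[OF inv(1)]
  have actA: "mat_act A x = mat_act g (mat_act (bmat e l h p) (mat_act ?g x))" for x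
    unfolding A using mat_act_mult[OF mult_carrier_mat[OF m(1) bmat_carrier] m(2)] mat_act_mult[OF m(1) bmat_carrier] by simp
  have canc: "mat_act ?g (mat_act g x) = x" if "x \<in> fspace (e * l)" for x
    using mat_act_inverse[OF m(2,1) inv(3) that] .
  have B: "block_proj e j (mat_act ?g f) \<in> fspace (e * l)"
    using projections.P_in[OF projections_block j mat_act_in[OF m(2)]] .
  show ?thesis
    unfolding conj_proj_def actA canc[OF B] canc[OF mat_act_in[OF bmat_carrier]] mat_act_bmat_block_proj[OF p j] ..
qed

lemma irreducible_superset:
  assumes "irreducible_group n G" "subgroup S (GL n)" "G \<subseteq> S"
  shows "irreducible_group n S"
  using assms unfolding irreducible_group_def by blast

text \<open>The images under \<open>g\<close> of the \<open>l\<close> standard summands form a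
  system of imprimitivity, nontrivial because \<open>1 < l\<close>.\<close>

lemma imprimitive_conj:
  assumes irr: "irreducible_group (e * l) S" and S: "S \<subseteq> conj_set (GL (e * l)) g (wreath_GL e l H K)"
    and g: "g \<in> carrier (GL (e * l))" and K: "subgroup K (sym_group l)" and l: "1 < l"
  shows "imprimitive_group (e * l) S"
proof -
  let ?g = "inv\<^bsub>GL (e * l)\<^esub> g"
  note inv = GL_inv[OF g]
  note m = GL_mat[OF g] GL_mat[OF inv(1)]
  have n: "0 < e * l" and SG: "subgroup S (GL (e * l))" using irr by (auto simp: irreducible_group_def)
  then have e: "0 < e" by simp
  note proj = projections_conj[OF m inv(2,3)]
  show ?thesis
  proof (rule imprimitive_of_projections[OF irr order.refl])
    show "projections fscale (bspace (e * l) 1) {1..l} (conj_proj e g ?g)"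
      using proj fspace_eq_bspace[OF n] by metis
    show "1 < card {1..l}" using l by simp
    show "\<exists>f\<in>bspace (e * l) 1. conj_proj e g ?g b f \<noteq> 0" if b: "b \<in> {1..l}" for b
    proof -
      \<comment> \<open>The unit vector at the first position of block \<open>b\<close> is sent by
        \<open>g\<close> to a nonzero vector of the b-th summand.\<close>
      let ?C = "(b - 1) * e"
      have C: "?C < e * l" using block_index(1)[OF b e] by simp
      let ?u = "\<lambda>r. if r = ?C then 1 else 0 :: 'a"
      have u: "?u \<in> fspace (e * l)" by (rule fspace_unit[OF C])
      have ub: "block_proj e b ?u = ?u" using e b by (auto simp: block_proj_def fun_eq_iff)
      have "conj_proj e g ?g b (mat_act g ?u) = mat_act g ?u"
        unfolding conj_proj_def mat_act_inverse[OF m(2,1) inv(3) u] ub ..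
      moreover have "mat_act g ?u \<noteq> 0"
      proof
        assume "mat_act g ?u = 0"
        then have "?u = mat_act ?g 0" using mat_act_inverse[OF m(2,1) inv(3) u] by simp
        also have "\<dots> = 0" by (rule module_hom.zero[OF mat_act_hom])
        finally have "?u = 0" .
        from fun_cong[OF this, of ?C] show False by simp
      qed
      ultimately show ?thesis using mat_act_in[OF m(1), of ?u] fspace_eq_bspace[OF n] by metis
    qed
    show "\<exists>c\<in>{1..l}. \<forall>f\<in>bspace (e * l) 1. block_act (e * l) 1 A (conj_proj e g ?g b f) = conj_proj e g ?g c (block_act (e * l) 1 A f)"
      if A: "A \<in> S" and b: "b \<in> {1..l}" for A b
    proof -
      obtain C where C: "C \<in> wreath_GL e l H K" "A = g * C * ?g" using A S conj_GL_iff by blast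
      obtain h p where hp: "C = bmat e l h p" "p \<in> K" using C(1) by (rule wreath_GLE)
      note p = sym_subgroup(1)[OF K hp(2)]
      have "A \<in> carrier_mat (e * l) (e * l)" using GL_subgroup(1)[OF SG] A GL_mat by blast
      then show ?thesis
        using mat_act_conj_proj[OF g p b C(2)[unfolded hp(1)]] block_act_mat_act[OF n] permutes_range[OF p b] by metis
    qed
  qed
qed

text \<open>Compares the standard summands \<open>bspace d i\<close> with the images of the
  \<open>bspace e j\<close> under \<open>g\<close>. The second property of \<open>f\<close> is the
  inclusion of summands, read through the inverse of \<open>g\<close>. The exceptional outcome is
  ruled out by \<open>exc\<close>.\<close>

lemma wreath_refinement:
  fixes H1 H2 :: "'a::field mat set"
  assumes prim: "primitive_group d H1" and nt: "H1 \<noteq> {1\<^sub>m d}"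
    and K1: "subgroup K1 (sym_group k)" "transitive_perms k K1" and k: "0 < k"
    and exc: "\<not> (d = 1 \<and> even k \<and> card H1 = 2 \<and> preserves_pairing k K1)"
    and n: "d * k = e * l" and g: "g \<in> carrier (GL (e * l))"
    and K2: "subgroup K2 (sym_group l)"
    and sub: "wreath_GL d k H1 K1 \<subseteq> conj_set (GL (e * l)) g (wreath_GL e l H2 K2)"
  obtains f where "\<And>i. i \<in> {1..k} \<Longrightarrow> f i \<in> {1..l}"
    and "\<And>i x. i \<in> {1..k} \<Longrightarrow> x \<in> bspace d i \<Longrightarrow> mat_act (inv\<^bsub>GL (e * l)\<^esub> g) x \<in> bspace e (f i)"
    and "f ` {1..k} = {1..l}"
    and "\<And>j j'. j \<in> {1..l} \<Longrightarrow> j' \<in> {1..l} \<Longrightarrow> card {i\<in>{1..k}. f i = j} = card {i\<in>{1..k}. f i = j'}"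
    and "\<And>p i i'. p \<in> K1 \<Longrightarrow> i \<in> {1..k} \<Longrightarrow> i' \<in> {1..k} \<Longrightarrow> f i = f i' \<Longrightarrow> f (p i) = f (p i')"
proof -
  let ?g = "inv\<^bsub>GL (e * l)\<^esub> g"
  have irr: "irreducible_group d H1" using prim by (simp add: primitive_group_def)
  have d: "0 < d" and H1: "subgroup H1 (GL d)" using irr by (auto simp: irreducible_group_def)
  have n0: "0 < e * l" using d k n by (metis nat_0_less_mult_iff)
  then have e: "0 < e" by simp
  note inv = GL_inv[OF g]
  note m = GL_mat[OF g] GL_mat[OF inv(1)]
  note proj = projections_conj[OF m inv(2,3)]
  note part = part_block[OF d]
  let ?H = "\<lambda>i. (\<lambda>h. mat_act (at_block d k i h)) ` H1"
  interpret T: transitive_blocks fscale "fspace (d * k)" "{1..k}" "block_proj d"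
    ?H "mat_act ` wreath_GL d k H1 K1" K1 "\<lambda>p. mat_act (bmat d k (\<lambda>_. 1\<^sub>m d) p)"
    by (rule wreath_transitive_blocks[OF irr nt K1])
  have hm: "h \<in> carrier_mat d d" if "h \<in> H1" for h using GL_subgroup(1)[OF H1] GL_mat that by blast
  interpret D: two_decompositions fscale "fspace (d * k)" "{1..k}" "block_proj d"
    ?H "mat_act ` wreath_GL d k H1 K1" K1 "\<lambda>p. mat_act (bmat d k (\<lambda>_. 1\<^sub>m d) p)" "{1..l}" "conj_proj e g ?g"
  proof (intro two_decompositions.intro two_decompositions_axioms.intro)
    show "transitive_blocks fscale (fspace (d * k)) {1..k} (block_proj d)
      ?H (mat_act ` wreath_GL d k H1 K1) K1 (\<lambda>p. mat_act (bmat d k (\<lambda>_. 1\<^sub>m d) p))"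
      by (rule T.transitive_blocks_axioms)
    show proj': "projections fscale (fspace (d * k)) {1..l} (conj_proj e g ?g)" unfolding n by (rule proj)
    show "\<exists>w\<in>projections.part (fspace (d * k)) (conj_proj e g ?g) j. w \<noteq> 0" if j: "j \<in> {1..l}" for j
    proof -
      let ?C = "(j - 1) * e"
      have C: "?C < e * l" using block_index(1)[OF j e] by simp
      let ?u = "\<lambda>r. if r = ?C then 1 else 0 :: 'a"
      have u: "?u \<in> fspace (e * l)" by (rule fspace_unit[OF C])
      have ub: "?u \<in> bspace e j" using e j by (auto simp: bspace_def)
      have "mat_act g ?u \<in> projections.part (fspace (d * k)) (conj_proj e g ?g) j"
        unfolding n part_conj[OF m inv(2,3) e j] using mat_act_in[OF m(1)] mat_act_inverse[OF m(2,1) inv(3) u] ub by simp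
      moreover have "mat_act g ?u \<noteq> 0"
      proof
        assume "mat_act g ?u = 0"
        then have "?u = mat_act ?g 0" using mat_act_inverse[OF m(2,1) inv(3) u] by simp
        also have "\<dots> = 0" by (rule module_hom.zero[OF mat_act_hom])
        finally have "?u = 0" .
        from fun_cong[OF this, of ?C] show False by simp
      qed
      ultimately show ?thesis by blast
    qed
    show "\<exists>c\<in>{1..l}. \<forall>w\<in>projections.part (fspace (d * k)) (conj_proj e g ?g) j.
        G w \<in> projections.part (fspace (d * k)) (conj_proj e g ?g) c"
      if G: "G \<in> mat_act ` wreath_GL d k H1 K1" and j: "j \<in> {1..l}" for G j
    proof -
      obtain A where A: "A \<in> wreath_GL d k H1 K1" "G = mat_act A" using G by blast
      obtain C where C: "C \<in> wreath_GL e l H2 K2" "A = g * C * ?g" using A sub conj_GL_iff by blast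
      obtain h p where hp: "C = bmat e l h p" "p \<in> K2" using C(1) by (rule wreath_GLE)
      note p = sym_subgroup(1)[OF K2 hp(2)]
      have "mat_act A w \<in> projections.part (fspace (d * k)) (conj_proj e g ?g) (p j)"
        if w: "w \<in> projections.part (fspace (d * k)) (conj_proj e g ?g) j" for w
      proof -
        have wV: "w \<in> fspace (d * k)" using projections.part_V[OF proj' j w] .
        have "mat_act A w = mat_act A (conj_proj e g ?g j w)" using projections.P_part[OF proj' j w] by simp
        also have "\<dots> = conj_proj e g ?g (p j) (mat_act A w)"
          by (rule mat_act_conj_proj[OF g p j C(2)[unfolded hp(1)]])
        finally show ?thesis
          using projections.P_in_part[OF proj', of "mat_act A w" "p j"] T.G_V[of "mat_act A" w] A wV by auto
      qed
      then show ?thesis using permutes_range[OF p j] A by blast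
    qed
    show "card M \<le> 1"
      if i: "i \<in> {1..k}" and M: "projections fscale (T.U.part i) M (conj_proj e g ?g)"
        and nz: "\<And>b. b \<in> M \<Longrightarrow> \<exists>v\<in>T.U.part i. conj_proj e g ?g b v \<noteq> 0"
        and perm: "\<And>h b. h \<in> ?H i \<Longrightarrow> b \<in> M \<Longrightarrow>
          \<exists>c\<in>M. \<forall>v\<in>T.U.part i. h (conj_proj e g ?g b v) = conj_proj e g ?g c (h v)" for i M
    proof (rule ccontr)
      assume c: "\<not> card M \<le> 1"
      have "imprimitive_group d H1"
      proof (rule imprimitive_of_projections[OF irr])
        show "1 \<le> i" using i by simp
        show M': "projections fscale (bspace d i) M (conj_proj e g ?g)" by (rule M[unfolded part[OF i]])
        show "1 < card M" using c by simp
        show "\<exists>f\<in>bspace d i. conj_proj e g ?g b f \<noteq> 0" if "b \<in> M" for b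
          by (rule nz[OF that, unfolded part[OF i]])
        show "\<exists>c\<in>M. \<forall>f\<in>bspace d i. block_act d i h (conj_proj e g ?g b f) = conj_proj e g ?g c (block_act d i h f)"
          if h: "h \<in> H1" and b: "b \<in> M" for h b
        proof -
          obtain c where "c \<in> M" "\<forall>v\<in>bspace d i. mat_act (at_block d k i h) (conj_proj e g ?g b v) =
              conj_proj e g ?g c (mat_act (at_block d k i h) v)"
            using perm[OF imageI[OF h] b, unfolded part[OF i]] by blast
          then show ?thesis
            using mat_act_at_block_lift[OF _ i d] projections.P_in[OF M' b] by metis
        qed
      qed
      then show False using prim by (simp add: primitive_group_def)
    qed
  qed
  have "D.moved i = {}" if i: "i \<in> {1..k}" for i
  proof (rule ccontr)
    assume mv: "D.moved i \<noteq> {}"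
    note ex = D.exceptional[OF i mv]
    have d1: "d = 1"
    proof (rule ccontr)
      assume "d \<noteq> 1"
      then have d2: "0 < d" "1 < d" using d by auto
      \<comment> \<open>If \<open>1 < d\<close>, the first two unit vectors of the i-th summand
        cannot lie on one line.\<close>
      define a where "a t = (\<lambda>r. if r = (i - 1) * d + t then 1 else 0 :: 'a)" for t
      have a: "a t \<in> T.U.part i" if "t < d" for t
        unfolding part[OF i] a_def bspace_def using block_index(2)[OF i that] by auto
      obtain u where u: "\<forall>v\<in>T.U.part i. \<exists>c. v = fscale c u" using ex(1) by blast
      obtain c0 c1 where c: "a 0 = fscale c0 u" "a 1 = fscale c1 u"
        using u a[OF d2(1)] a[OF d2(2)] by blast
      let ?p = "(i - 1) * d"
      have "1 = c0 * u ?p" "0 = c0 * u (?p + 1)" "1 = c1 * u (?p + 1)"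
        using fun_cong[OF c(1), of ?p] fun_cong[OF c(1), of "?p + 1"] fun_cong[OF c(2), of "?p + 1"]
        by (simp_all add: a_def fscale_def)
      then show False by (metis mult_eq_0_iff zero_neq_one)
    qed
    have "card H1 = 2"
    proof -
      obtain x where x: "x \<in> H1" "\<exists>v\<in>fspace (d * k). mat_act (at_block d k i x) v \<noteq> v"
        and all: "\<forall>y\<in>H1. (\<forall>v\<in>fspace (d * k). mat_act (at_block d k i y) v = v) \<or>
          (\<forall>v\<in>fspace (d * k). mat_act (at_block d k i y) v = mat_act (at_block d k i x) v)"
        using ex(2) by blast
      \<comment> \<open>The entries of an element of \<open>H1\<close> can be read off from the
        action of its i-th copy on unit vectors.\<close>
      have eqI: "y = z" if yz: "y \<in> H1" "z \<in> H1"
        and e: "\<forall>v\<in>fspace (d * k). mat_act (at_block d k i y) v = mat_act (at_block d k i z) v" for y z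
      proof (rule eq_matI)
        fix r t assume "r < dim_row z" "t < dim_col z"
        then have rt: "r < d" "t < d" using hm[OF yz(2)] by auto
        note b = block_index(1)[OF i rt(1)] block_index(1)[OF i rt(2)]
        have "at_block d k i y $$ ((i - 1) * d + r, (i - 1) * d + t) = at_block d k i z $$ ((i - 1) * d + r, (i - 1) * d + t)"
          using mat_act_unit[OF at_block_carrier b] e fspace_unit[OF b(2)] by metis
        then show "y $$ (r, t) = z $$ (r, t)" unfolding at_block_def bmat_block[OF i i rt] by simp
      qed (use hm[OF yz(1)] hm[OF yz(2)] in auto)
      have one: "1\<^sub>m d \<in> H1" by (rule GL_subgroup(2)[OF H1])
      have act1: "mat_act (at_block d k i (1\<^sub>m d)) v = v" if "v \<in> fspace (d * k)" for v
        unfolding at_block_one by (rule mat_act_one[OF that])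
      have "y = 1\<^sub>m d \<or> y = x" if y: "y \<in> H1" for y
        using all y eqI[OF y one] eqI[OF y x(1)] act1 by metis
      then have "H1 = {1\<^sub>m d, x}" using one x(1) by blast
      moreover have "x \<noteq> 1\<^sub>m d" using x(2) act1 by blast
      ultimately show ?thesis by auto
    qed
    moreover obtain Q where Q: "partition_on {1..k} Q" "\<forall>B\<in>Q. card B = 2" "\<forall>p\<in>K1. \<forall>B\<in>Q. p ` B \<in> Q"
      using ex(3) by blast
    \<comment> \<open>Counting by pairs shows that \<open>k\<close> is even and that
      \<open>Q\<close> has the \<open>k div 2\<close> members required by
      \<open>preserves_pairing\<close>.\<close>
    have "card {1..k} = (\<Sum>B\<in>Q. card B)"
      using Q by (intro product_partition) (auto intro: card_ge_0_finite)
    then have "k = 2 * card Q" using Q by simp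
    then have "even k" "preserves_pairing k K1"
      unfolding preserves_pairing_def using Q by auto
    ultimately show False using exc d1 by blast
  qed
  note unmoved = this
  show thesis
  proof (rule D.refinement[OF unmoved])
    fix f assume f: "\<And>i. i \<in> {1..k} \<Longrightarrow> f i \<in> {1..l} \<and> T.U.part i \<subseteq> D.W.part (f i)"
      "f ` {1..k} = {1..l}"
      "\<And>j j'. j \<in> {1..l} \<Longrightarrow> j' \<in> {1..l} \<Longrightarrow> card {i\<in>{1..k}. f i = j} = card {i\<in>{1..k}. f i = j'}"
      "\<And>p i i'. p \<in> K1 \<Longrightarrow> i \<in> {1..k} \<Longrightarrow> i' \<in> {1..k} \<Longrightarrow> f i = f i' \<Longrightarrow> f (p i) = f (p i')"
    show thesis
    proof (rule that[of f])
      show "f i \<in> {1..l}" if "i \<in> {1..k}" for i using f(1)[OF that] by blast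
      show "mat_act ?g x \<in> bspace e (f i)" if i: "i \<in> {1..k}" and x: "x \<in> bspace d i" for i x
      proof -
        have fi: "f i \<in> {1..l}" and "bspace d i \<subseteq> D.W.part (f i)"
          using f(1)[OF i, unfolded part[OF i]] by blast+
        then have "x \<in> {x \<in> fspace (e * l). mat_act ?g x \<in> bspace e (f i)}"
          using x unfolding part_conj[OF m inv(2,3) e fi, symmetric] n by blast
        then show ?thesis by blast
      qed
    qed (fact f)+
  qed (assumption)
qed

section \<open>Consecutive blocks\<close>

text \<open>The analogue of \<open>block_index\<close> for points: these start at 1, so point
  \<open>c\<close> has position \<open>(c - 1) mod m + 1\<close> in its block.\<close>

lemma index_pair:
  fixes q r m l :: nat
  assumes "q \<in> {1..l}" "r \<in> {1..m}"
  shows "(q - 1) * m + r \<in> {1..m * l}" "((q - 1) * m + r - 1) div m + 1 = q"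
    "((q - 1) * m + r - 1) mod m + 1 = r"
proof -
  have e: "(q - 1) * m + r = (q - 1) * m + (r - 1) + 1" "(q - 1) * m + r - 1 = (q - 1) * m + (r - 1)"
    and r: "r - 1 < m" using assms by auto
  note b = block_index[OF assms(1) r]
  show "(q - 1) * m + r \<in> {1..m * l}" using b(1) unfolding e(1) by simp
  show "((q - 1) * m + r - 1) div m + 1 = q" unfolding e(2) by (rule b(2))
  show "((q - 1) * m + r - 1) mod m + 1 = r" unfolding e(2) b(3) using assms(2) by simp
qed

lemma pair_index:
  fixes c m l :: nat
  assumes "c \<in> {1..m * l}"
  shows "(c - 1) div m + 1 \<in> {1..l}" "(c - 1) mod m + 1 \<in> {1..m}"
    "((c - 1) div m + 1 - 1) * m + ((c - 1) mod m + 1) = c"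
proof -
  have c: "c - 1 < m * l" using assms by auto
  note b = index_block[OF c]
  show "(c - 1) div m + 1 \<in> {1..l}" by (rule b(1))
  show "(c - 1) mod m + 1 \<in> {1..m}" using b(2) by simp
  show "((c - 1) div m + 1 - 1) * m + ((c - 1) mod m + 1) = c" using b(3) assms by simp
qed

lemma permutesI_inj:
  assumes "\<And>x. x \<notin> A \<Longrightarrow> p x = x" "\<And>x. x \<in> A \<Longrightarrow> p x \<in> A" "inj_on p A" "finite A"
  shows "p permutes A"
proof (rule bij_imp_permutes)
  have "p ` A = A" by (rule endo_inj_surj[OF assms(4) _ assms(3)]) (use assms(2) in blast)
  then show "bij_betw p A A" using assms(3) by (simp add: bij_betw_def)
qed (rule assms(1))

text \<open>Sufficiency of the conditions in standard position: after grouping by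
  \<open>bmat_nested\<close>, the big blocks lie in \<open>H1\<close> wr \<open>X\<close>.\<close>

lemma wreath_GL_mono:
  assumes X: "wreath_GL d m H1 X \<subseteq> H2" and K: "K1 \<subseteq> wreath_Sym m l X Y" and Y: "Y \<subseteq> K2"
    and XS: "subgroup X (sym_group m)" and YS: "subgroup Y (sym_group l)"
  shows "wreath_GL d (m * l) H1 K1 \<subseteq> wreath_GL (d * m) l H2 K2"
proof
  fix A assume "A \<in> wreath_GL d (m * l) H1 K1"
  then obtain h \<sigma> where A: "A = bmat d (m * l) h \<sigma>" and h: "\<And>q. q \<in> {1..m * l} \<Longrightarrow> h q \<in> H1" and \<sigma>: "\<sigma> \<in> K1"
    by (rule wreath_GLE) blast
  obtain x y where x: "\<And>q. q \<in> {1..l} \<Longrightarrow> x q \<in> X" and y: "y \<in> Y"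
    and e: "\<And>q r. q \<in> {1..l} \<Longrightarrow> r \<in> {1..m} \<Longrightarrow> \<sigma> ((q - 1) * m + r) = (y q - 1) * m + x q r"
    using K \<sigma> unfolding wreath_Sym_def by blast
  have "A = bmat (d * m) l (\<lambda>q. bmat d m (\<lambda>r. h ((q - 1) * m + r)) (x q)) y"
    unfolding A
  proof (rule bmat_nested)
    fix q r assume qr: "q \<in> {1..l}" "r \<in> {1..m}"
    show "\<sigma> ((q - 1) * m + r) = (y q - 1) * m + x q r \<and> y q \<in> {1..l} \<and> x q r \<in> {1..m}"
      using e[OF qr] permutes_range[OF sym_subgroup(1)[OF XS x[OF qr(1)]] qr(2)]
        permutes_range[OF sym_subgroup(1)[OF YS y] qr(1)] by blast
  qed
  moreover have "bmat d m (\<lambda>r. h ((q - 1) * m + r)) (x q) \<in> H2" if q: "q \<in> {1..l}" for q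
  proof -
    have "bmat d m (\<lambda>r. h ((q - 1) * m + r)) (x q) \<in> wreath_GL d m H1 X"
    proof (rule wreath_GLI)
      show "h ((q - 1) * m + r) \<in> H1" if "r \<in> {1..m}" for r using h[OF index_pair(1)[OF q that]] .
    qed (rule x[OF q])
    then show ?thesis using X by blast
  qed
  ultimately show "A \<in> wreath_GL (d * m) l H2 K2"
    using Y y wreath_GLI[of l "\<lambda>q. bmat d m (\<lambda>r. h ((q - 1) * m + r)) (x q)" H2 y K2 "d * m"] by blast
qed

text \<open>Necessity in standard position, with \<open>Y = K2\<close>: the permutation matrices of
  \<open>K1\<close> determine the action on big blocks, and the base group supplies the diagonal
  part of \<open>H1\<close> wr \<open>X\<close>.\<close>

lemma wreath_GL_subsetD:
  fixes H1 H2 :: "'a::field mat set"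
  assumes H1: "subgroup H1 (GL d)" and H2: "subgroup H2 (GL (d * m))"
    and K1: "subgroup K1 (sym_group (m * l))" and K2: "subgroup K2 (sym_group l)"
    and d: "0 < d" and m: "0 < m" and l: "0 < l"
    and sub: "wreath_GL d (m * l) H1 K1 \<subseteq> wreath_GL (d * m) l H2 K2"
  shows "\<exists>X. subgroup X (sym_group m) \<and> K1 \<subseteq> wreath_Sym m l X K2 \<and> wreath_GL d m H1 X \<subseteq> H2"
proof -
  let ?I = "\<lambda>_::nat. 1\<^sub>m d :: 'a mat"
  note GH1 = GL_subgroup[OF H1] and GH2 = GL_subgroup[OF H2] and SK1 = sym_subgroup[OF K1] and SK2 = sym_subgroup[OF K2]
  have dm: "0 < d * m" using d m by simp
  \<comment> \<open>The largest possible choice: as \<open>H1\<close> contains the identity,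
    condition (iii) forces the permutation matrices of \<open>X\<close> into
    \<open>H2\<close>.\<close>
  define X where "X = {x. x permutes {1..m} \<and> bmat d m ?I x \<in> H2}"
  have mult: "bmat d m ?I x * bmat d m ?I y = bmat d m ?I (x \<circ> y)" if "y permutes {1..m}" for x y
    using permutes_range[OF that] by (subst bmat_mult) (auto intro: bmat_cong)
  have X: "subgroup X (sym_group m)"
  proof (rule group.subgroupI[OF sym_group_is_group])
    show "X \<subseteq> carrier (sym_group m)" by (auto simp: X_def sym_carrier)
    have "id \<in> X" using GH2(2) by (simp add: X_def bmat_one permutes_id)
    then show "X \<noteq> {}" by blast
    fix x assume x: "x \<in> X"
    then have xp: "x permutes {1..m}" "bmat d m ?I x \<in> H2" by (auto simp: X_def)
    note inv = sym_inv[OF xp(1)]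
    have "bmat d m ?I x * bmat d m ?I (inv\<^bsub>sym_group m\<^esub> x) = 1\<^sub>m (d * m)"
      unfolding mult[OF inv(1)] inv(2) by (rule bmat_one)
    then have "bmat d m ?I (inv\<^bsub>sym_group m\<^esub> x) = inv\<^bsub>GL (d * m)\<^esub> (bmat d m ?I x)"
      using GL_inv_unique(3)[OF bmat_carrier bmat_carrier] by metis
    then show "inv\<^bsub>sym_group m\<^esub> x \<in> X" using GH2(4)[OF xp(2)] inv(1) by (simp add: X_def)
    fix y assume "y \<in> X"
    then have yp: "y permutes {1..m}" "bmat d m ?I y \<in> H2" by (auto simp: X_def)
    show "x \<otimes>\<^bsub>sym_group m\<^esub> y \<in> X"
      unfolding sym_mult X_def using GH2(3)[OF xp(2) yp(2)] mult[OF yp(1)] permutes_compose[OF yp(1) xp(1)]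
      by simp
  qed
  moreover have "K1 \<subseteq> wreath_Sym m l X K2"
  proof
    fix \<sigma> assume \<sigma>: "\<sigma> \<in> K1"
    note \<sigma>p = SK1(1)[OF \<sigma>]
    have "bmat d (m * l) ?I \<sigma> \<in> wreath_GL d (m * l) H1 K1" using GH1(2) \<sigma> by (intro wreath_GLI)
    then have "bmat d (m * l) ?I \<sigma> \<in> wreath_GL (d * m) l H2 K2" using sub by blast
    then obtain h p where hp: "bmat d (m * l) ?I \<sigma> = bmat (d * m) l h p"
      and h: "\<And>q. q \<in> {1..l} \<Longrightarrow> h q \<in> H2" and p: "p \<in> K2"
      by (rule wreath_GLE) blast
    note pp = SK2(1)[OF p]
    \<comment> \<open>The permutation matrix of \<open>\<sigma>\<close> has an entry 1 at the first
      positions of the small blocks \<open>\<sigma> c\<close> and \<open>c\<close>. It must lie in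
      one of the big blocks where the matrix with data \<open>h\<close> and \<open>p\<close> can be
      nonzero.\<close>
    have blk: "(\<sigma> c - 1) div m + 1 = p ((c - 1) div m + 1)" if c: "c \<in> {1..m * l}" for c
    proof (rule ccontr)
      assume n: "\<not> ?thesis"
      have \<sigma>c: "\<sigma> c \<in> {1..m * l}" by (rule permutes_range[OF \<sigma>p c])
      let ?r = "(\<sigma> c - 1) * d + 0" and ?c = "(c - 1) * d + 0"
      have 1: "bmat d (m * l) ?I \<sigma> $$ (?r, ?c) = 1"
        unfolding bmat_block[OF c \<sigma>c d d] using d by simp
      have rc: "?r < d * m * l" "?c < d * m * l"
        using block_index(1)[OF c d] block_index(1)[OF \<sigma>c d] by (simp_all add: mult.assoc)
      have "?r div (d * m) = (\<sigma> c - 1) div m" "?c div (d * m) = (c - 1) div m"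
        using d by (simp_all add: div_mult2_eq)
      then have "bmat (d * m) l h p $$ (?r, ?c) = 0" unfolding bmat_index[OF rc] using n by simp
      then show False using 1 hp by simp
    qed
    \<comment> \<open>The position of the image within its big block, extended by the identity so
      that \<open>x q\<close> is a permutation in the sense of \<open>permutes\<close>.\<close>
    define x where "x q r = (if r \<in> {1..m} then \<sigma> ((q - 1) * m + r) - (p q - 1) * m else r)" for q r
    have x: "\<sigma> ((q - 1) * m + r) = (p q - 1) * m + x q r \<and> x q r \<in> {1..m}"
      if q: "q \<in> {1..l}" and r: "r \<in> {1..m}" for q r
    proof -
      let ?c = "(q - 1) * m + r"
      note i = index_pair[OF q r]
      have \<sigma>c: "\<sigma> ?c \<in> {1..m * l}" by (rule permutes_range[OF \<sigma>p i(1)])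
      note j = pair_index[OF \<sigma>c]
      have "(\<sigma> ?c - 1) div m + 1 = p q" using blk[OF i(1)] unfolding i(2) .
      then have e: "(p q - 1) * m + ((\<sigma> ?c - 1) mod m + 1) = \<sigma> ?c" using j(3) by simp
      then have "x q r = (\<sigma> ?c - 1) mod m + 1" using r by (simp add: x_def)
      then show ?thesis using e j(2) by simp
    qed
    have xp: "x q permutes {1..m}" if q: "q \<in> {1..l}" for q
    proof (rule permutesI_inj)
      show "x q r \<in> {1..m}" if "r \<in> {1..m}" for r using x[OF q that] by blast
      show "inj_on (x q) {1..m}"
      proof (rule inj_onI)
        fix r s assume rs: "r \<in> {1..m}" "s \<in> {1..m}" "x q r = x q s"
        have "\<sigma> ((q - 1) * m + r) = \<sigma> ((q - 1) * m + s)" 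
          unfolding x[OF q rs(1), THEN conjunct1] x[OF q rs(2), THEN conjunct1] rs(3) by (rule refl)
        from injD[OF permutes_inj[OF \<sigma>p] this] show "r = s" by simp
      qed
    qed (auto simp: x_def)
    have pq: "p q \<in> {1..l}" if "q \<in> {1..l}" for q by (rule permutes_range[OF pp that])
    have nest: "bmat d (m * l) ?I \<sigma> = bmat (d * m) l (\<lambda>q. bmat d m ?I (x q)) p"
      using x pq by (intro bmat_nested) blast
    have "x q \<in> X" if q: "q \<in> {1..l}" for q
    proof -
      have "h q = bmat d m ?I (x q)"
        using bmat_inject(2)[OF hp[symmetric, unfolded nest] q pq[OF q] _ _ dm] h[OF q] GH2(1) bmat_carrier by blast
      then show ?thesis using h[OF q] xp[OF q] by (simp add: X_def)
    qed
    then show "\<sigma> \<in> wreath_Sym m l X K2"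
      unfolding wreath_Sym_def using \<sigma>p x p by (simp only: sym_carrier mem_Collect_eq) blast
  qed
  moreover have "wreath_GL d m H1 X \<subseteq> H2"
  proof
    fix A assume "A \<in> wreath_GL d m H1 X"
    then obtain h x where A: "A = bmat d m h x" and h: "\<And>r. r \<in> {1..m} \<Longrightarrow> h r \<in> H1" and x: "x \<in> X"
      by (rule wreath_GLE) blast
    have xp: "x permutes {1..m}" "bmat d m ?I x \<in> H2" using x by (auto simp: X_def)
    \<comment> \<open>The tuple \<open>h\<close> in the first big block and identities elsewhere;
      reading off the first big block puts the diagonal matrix of \<open>h\<close> into
      \<open>H2\<close>.\<close>
    define h' where "h' c = (if c \<in> {1..m} then h c else 1\<^sub>m d)" for c
    have "bmat d (m * l) h' id \<in> wreath_GL d (m * l) H1 K1"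
      using h GH1(2) SK1(2) by (intro wreath_GLI) (auto simp: h'_def)
    then have "bmat d (m * l) h' id \<in> wreath_GL (d * m) l H2 K2" using sub by blast
    then obtain g p where gp: "bmat d (m * l) h' id = bmat (d * m) l g p"
      and g: "\<And>q. q \<in> {1..l} \<Longrightarrow> g q \<in> H2" and p: "p \<in> K2"
      by (rule wreath_GLE) blast
    have 1: "1 \<in> {1..l}" using l by simp
    have nest: "bmat d (m * l) h' id = bmat (d * m) l (\<lambda>q. bmat d m (\<lambda>r. h' ((q - 1) * m + r)) id) id"
      by (rule bmat_nested) auto
    have "g 1 = bmat d m (\<lambda>r. h' ((1 - 1) * m + r)) id"
      using bmat_inject(2)[OF gp[symmetric, unfolded nest] 1 permutes_range[OF SK2(1)[OF p] 1] _ _ dm]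
        g[OF 1] GH2(1) bmat_carrier by blast
    also have "\<dots> = bmat d m h id" by (rule bmat_cong) (auto simp: h'_def)
    finally have diag: "bmat d m h id \<in> H2" using g[OF 1] by simp
    have hm: "h r \<in> carrier_mat d d" if "r \<in> {1..m}" for r using h[OF that] GH1(1) GL_mat by blast
    \<comment> \<open>\<open>A\<close> is a permutation matrix times a block diagonal matrix, both
      already known to lie in \<open>H2\<close>.\<close>
    have "bmat d m ?I x * bmat d m h id = bmat d m (\<lambda>q. 1\<^sub>m d * h q) (x \<circ> id)"
      using hm by (subst bmat_mult) auto
    also have "\<dots> = A" unfolding A by (rule bmat_cong) (simp add: left_mult_one_mat[OF hm])
    finally show "A \<in> H2" using GH2(3)[OF xp(2) diag] by simp
  qed
  ultimately show ?thesis by blast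
qed

section \<open>Conjugating wreath products by permutation and block diagonal matrices\<close>

lemma conj_set_mono: "A \<subseteq> B \<Longrightarrow> conj_set G g A \<subseteq> conj_set G g B"
  unfolding conj_set_eq by blast

lemma conj_set_mult:
  fixes G (structure)
  assumes "group G" "g \<in> carrier G" "h \<in> carrier G" "A \<subseteq> carrier G"
  shows "conj_set G g (conj_set G h A) = conj_set G (g \<otimes> h) A"
proof -
  interpret group G by fact
  have "g \<otimes> (h \<otimes> a \<otimes> inv h) \<otimes> inv g = (g \<otimes> h) \<otimes> a \<otimes> inv (g \<otimes> h)" if "a \<in> A" for a
    using assms that by (simp add: inv_mult_group m_assoc subset_iff)
  then show ?thesis unfolding conj_set_eq image_image by (intro image_cong) auto
qed

lemma conj_set_one:
  fixes G (structure)
  assumes "group G" "A \<subseteq> carrier G"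
  shows "conj_set G \<one> A = A"
proof -
  interpret group G by fact
  have "\<one> \<otimes> a \<otimes> inv \<one> = a" if "a \<in> A" for a using assms that by auto
  then show ?thesis unfolding conj_set_eq by auto
qed

lemma conj_set_self:
  fixes G (structure)
  assumes "group G" "subgroup A G" "g \<in> A"
  shows "conj_set G g A = A"
proof -
  interpret group G by fact
  interpret A: subgroup A G by fact
  have "a \<in> conj_set G g A" if a: "a \<in> A" for a
  proof -
    have "g \<otimes> (inv g \<otimes> a \<otimes> g) \<otimes> inv g = (g \<otimes> inv g) \<otimes> a \<otimes> (g \<otimes> inv g)"
      using assms(3) a by (simp only: m_assoc A.mem_carrier m_closed inv_closed)
    then have "g \<otimes> (inv g \<otimes> a \<otimes> g) \<otimes> inv g = a" using assms(3) a by simp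
    then show ?thesis unfolding conj_set_eq using assms(3) a by (metis A.m_closed A.m_inv_closed imageI)
  qed
  then show ?thesis unfolding conj_set_eq using assms(3) by blast
qed

lemma conj_set_inv:
  fixes G (structure)
  assumes "group G" "g \<in> carrier G" "A \<subseteq> carrier G"
  shows "conj_set G g (conj_set G (inv g) A) = A" "conj_set G (inv g) (conj_set G g A) = A"
  using assms conj_set_mult[OF assms(1,2) _ assms(3)] conj_set_mult[OF assms(1) _ assms(2,3)] conj_set_one[OF assms(1,3)]
  by (simp_all add: group.inv_closed group.r_inv group.l_inv)

text \<open>A permutation matrix only relabels the coordinates of the base tuples, and
  \<open>H\<close> is the same in each coordinate, so the conjugation affects \<open>K\<close>
  alone.\<close>

lemma wreath_conj_perm:
  assumes H: "subgroup H (GL d)" and s: "s permutes {1..k}" and K: "\<And>p. p \<in> K \<Longrightarrow> p permutes {1..k}"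
  shows "wreath_GL d k H (conj_set (sym_group k) s K) \<subseteq>
    conj_set (GL (d * k)) (bmat d k (\<lambda>_. 1\<^sub>m d) s) (wreath_GL d k H K)"
proof
  let ?I = "\<lambda>_::nat. 1\<^sub>m d :: 'a mat" and ?s = "inv\<^bsub>sym_group k\<^esub> s"
  note inv = sym_inv[OF s]
  fix A assume "A \<in> wreath_GL d k H (conj_set (sym_group k) s K)"
  then obtain h \<tau> where A: "A = bmat d k h \<tau>" and h: "\<And>r. r \<in> {1..k} \<Longrightarrow> h r \<in> H"
    and \<tau>: "\<tau> \<in> conj_set (sym_group k) s K"
    by (rule wreath_GLE) blast
  obtain \<sigma> where \<sigma>: "\<sigma> \<in> K" "\<tau> = s \<circ> \<sigma> \<circ> ?s" using \<tau> unfolding conj_set_eq sym_mult by blast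
  have hm: "h r \<in> carrier_mat d d" if "r \<in> {1..k}" for r using h[OF that] GL_subgroup(1)[OF H] GL_mat by blast
  have sr: "s q \<in> {1..k}" "?s q \<in> {1..k}" "\<sigma> q \<in> {1..k}" if "q \<in> {1..k}" for q
    using permutes_range[OF s that] permutes_range[OF inv(1) that] permutes_range[OF K[OF \<sigma>(1)] that] .
  have ss: "s (?s q) = q" for q using fun_cong[OF inv(2), of q] by simp
  have "inv\<^bsub>GL (d * k)\<^esub> (bmat d k ?I s) = bmat d k ?I ?s"
  proof (rule GL_inv_unique(3)[OF bmat_carrier bmat_carrier])
    have "bmat d k ?I s * bmat d k ?I ?s = bmat d k (\<lambda>q. 1\<^sub>m d * 1\<^sub>m d) (s \<circ> ?s)" using sr(2) by (intro bmat_mult) auto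
    then show "bmat d k ?I s * bmat d k ?I ?s = 1\<^sub>m (d * k)" unfolding inv(2) by (simp add: bmat_one)
  qed
  moreover have "bmat d k ?I s * bmat d k (\<lambda>q. h (s q)) \<sigma> * bmat d k ?I ?s = A"
  proof -
    have "bmat d k ?I s * bmat d k (\<lambda>q. h (s q)) \<sigma> = bmat d k (\<lambda>q. 1\<^sub>m d * h (s q)) (s \<circ> \<sigma>)"
      using hm sr by (intro bmat_mult) auto
    moreover have "bmat d k (\<lambda>q. 1\<^sub>m d * h (s q)) (s \<circ> \<sigma>) * bmat d k ?I ?s =
        bmat d k (\<lambda>q. (1\<^sub>m d * h (s (?s q))) * 1\<^sub>m d) (s \<circ> \<sigma> \<circ> ?s)"
      using left_mult_one_mat[OF hm[OF sr(1)]] hm[OF sr(1)] sr(2) by (intro bmat_mult) auto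
    moreover have "1\<^sub>m d * h q * 1\<^sub>m d = h q" if "q \<in> {1..k}" for q
      unfolding left_mult_one_mat[OF hm[OF that]] right_mult_one_mat[OF hm[OF that]] ..
    then have "bmat d k (\<lambda>q. 1\<^sub>m d * h (s (?s q)) * 1\<^sub>m d) (s \<circ> \<sigma> \<circ> ?s) = A"
      unfolding A \<sigma>(2) ss by (intro bmat_cong conjI refl)
    ultimately show ?thesis by simp
  qed
  moreover have "bmat d k (\<lambda>q. h (s q)) \<sigma> \<in> wreath_GL d k H K"
    by (rule wreath_GLI) (use h[OF sr(1)] \<sigma>(1) in blast)+
  ultimately show "A \<in> conj_set (GL (d * k)) (bmat d k ?I s) (wreath_GL d k H K)"
    unfolding conj_GL_iff by metis
qed

text \<open>A block diagonal matrix with the same \<open>t\<close> in every block commutes with the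
  permutation matrices, so the conjugation affects \<open>H\<close> alone.\<close>

lemma wreath_conj_diag:
  assumes H: "subgroup H (GL e)" and t: "t \<in> carrier (GL e)" and K: "\<And>p. p \<in> K \<Longrightarrow> p permutes {1..l}"
  shows "conj_set (GL (e * l)) (bmat e l (\<lambda>_. t) id) (wreath_GL e l H K) = wreath_GL e l (conj_set (GL e) t H) K"
proof -
  let ?t = "inv\<^bsub>GL e\<^esub> t" and ?D = "bmat e l (\<lambda>_. t) id"
  note inv = GL_inv[OF t]
  note m = GL_mat[OF t] GL_mat[OF inv(1)]
  have invD: "inv\<^bsub>GL (e * l)\<^esub> ?D = bmat e l (\<lambda>_. ?t) id"
  proof (rule GL_inv_unique(3)[OF bmat_carrier bmat_carrier])
    have "?D * bmat e l (\<lambda>_. ?t) id = bmat e l (\<lambda>q. t * ?t) (id \<circ> id)" using m by (intro bmat_mult) auto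
    then show "?D * bmat e l (\<lambda>_. ?t) id = 1\<^sub>m (e * l)" by (simp add: inv(2) bmat_one)
  qed
  have conj: "?D * bmat e l a p * inv\<^bsub>GL (e * l)\<^esub> ?D = bmat e l (\<lambda>q. t * a q * ?t) p"
    if a: "\<And>q. q \<in> {1..l} \<Longrightarrow> a q \<in> H" and p: "p \<in> K" for a p
  proof -
    have am: "a q \<in> carrier_mat e e" if "q \<in> {1..l}" for q using a[OF that] GL_subgroup(1)[OF H] GL_mat by blast
    have pr: "p q \<in> {1..l}" if "q \<in> {1..l}" for q using permutes_range[OF K[OF p] that] .
    have "?D * bmat e l a p = bmat e l (\<lambda>q. t * a q) (id \<circ> p)" using am pr m by (intro bmat_mult) auto
    moreover have "bmat e l (\<lambda>q. t * a q) (id \<circ> p) * bmat e l (\<lambda>_. ?t) id = bmat e l (\<lambda>q. t * a (id q) * ?t) (id \<circ> p \<circ> id)"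
      using am m by (intro bmat_mult) auto
    ultimately show ?thesis unfolding invD by simp
  qed
  show ?thesis
  proof (intro equalityI subsetI)
    fix A assume "A \<in> conj_set (GL (e * l)) ?D (wreath_GL e l H K)"
    then obtain C where C: "C \<in> wreath_GL e l H K" "A = ?D * C * inv\<^bsub>GL (e * l)\<^esub> ?D" using conj_GL_iff by blast
    obtain a p where a: "C = bmat e l a p" "\<And>q. q \<in> {1..l} \<Longrightarrow> a q \<in> H" "p \<in> K"
      using C(1) by (rule wreath_GLE) blast
    have "A = bmat e l (\<lambda>q. t * a q * ?t) p" unfolding C(2) a(1) by (rule conj[OF a(2,3)])
    moreover have "t * a q * ?t \<in> conj_set (GL e) t H" if "q \<in> {1..l}" for q
      unfolding conj_GL_iff using a(2)[OF that] by blast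
    ultimately show "A \<in> wreath_GL e l (conj_set (GL e) t H) K" using a(3) by (auto intro: wreath_GLI)
  next
    fix A assume "A \<in> wreath_GL e l (conj_set (GL e) t H) K"
    then obtain b p where A: "A = bmat e l b p" and b: "\<And>q. q \<in> {1..l} \<Longrightarrow> b q \<in> conj_set (GL e) t H" and p: "p \<in> K"
      by (rule wreath_GLE) blast
    have "\<forall>q\<in>{1..l}. \<exists>a. a \<in> H \<and> b q = t * a * ?t" using b unfolding conj_GL_iff by blast
    then obtain a where a: "\<And>q. q \<in> {1..l} \<Longrightarrow> a q \<in> H \<and> b q = t * a q * ?t" by metis
    have "A = bmat e l (\<lambda>q. t * a q * ?t) p" unfolding A using a by (intro bmat_cong) blast
    also have "\<dots> = ?D * bmat e l a p * inv\<^bsub>GL (e * l)\<^esub> ?D" using conj[of a p] a p by simp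
    finally show "A \<in> conj_set (GL (e * l)) ?D (wreath_GL e l H K)"
      unfolding conj_GL_iff using wreath_GLI[of l a H p K e] a p by blast
  qed
qed

section \<open>Straightening the blocks of a conjugated inclusion\<close>

lemma mult_perm_index:
  fixes A :: "'a::field mat"
  assumes A: "A \<in> carrier_mat (d * k) (d * k)" and s: "s permutes {1..k}"
    and i: "i \<in> {1..k}" and t: "t < d" and r: "r < d * k"
  shows "(A * bmat d k (\<lambda>_. 1\<^sub>m d) s) $$ (r, (i - 1) * d + t) = A $$ (r, (s i - 1) * d + t)"
proof -
  let ?C = "(i - 1) * d + t"
  have si: "s i \<in> {1..k}" by (rule permutes_range[OF s i])
  note b = block_index[OF i t]
  have "(A * bmat d k (\<lambda>_. 1\<^sub>m d) s) $$ (r, ?C) = (\<Sum>x<d * k. A $$ (r, x) * bmat d k (\<lambda>_. 1\<^sub>m d) s $$ (x, ?C))"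
    using A b(1) r by (simp add: scalar_prod_def lessThan_atLeast0 del: add_diff_cancel_right')
  also have "\<dots> = (\<Sum>y<d. A $$ (r, (s i - 1) * d + y) * bmat d k (\<lambda>_. 1\<^sub>m d) s $$ ((s i - 1) * d + y, ?C))"
  proof (rule sum_block[OF si])
    fix x assume x: "x < d * k" "x div d + 1 \<noteq> s i"
    then show "A $$ (r, x) * bmat d k (\<lambda>_. 1\<^sub>m d) s $$ (x, ?C) = 0" unfolding bmat_index[OF x(1) b(1)] b by simp
  qed
  also have "\<dots> = (\<Sum>y<d. if y = t then A $$ (r, (s i - 1) * d + y) else 0)"
  proof (rule sum.cong[OF refl])
    fix y assume "y \<in> {..<d}"
    then have y: "y < d" by simp
    show "A $$ (r, (s i - 1) * d + y) * bmat d k (\<lambda>_. 1\<^sub>m d) s $$ ((s i - 1) * d + y, ?C) =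
        (if y = t then A $$ (r, (s i - 1) * d + y) else 0)"
      unfolding bmat_block[OF i si y t] using y t by simp
  qed
  also have "\<dots> = A $$ (r, (s i - 1) * d + t)" using t by simp
  finally show ?thesis .
qed

text \<open>By \<open>f1\<close>, column block \<open>i\<close> of the inverse of \<open>g\<close>
  lives in row block \<open>f i\<close>. Some element of \<open>K1\<close> carries the fibre of
  \<open>f\<close> over 1 to the fibre over \<open>j\<close>; its permutation matrix is conjugate
  under \<open>g\<close> to an element of \<open>H2\<close> wr \<open>K2\<close>, so the columns
  over \<open>j\<close> are those over 1 multiplied by a single \<open>h j\<close> in
  \<open>H2\<close>. This leaves one matrix \<open>b\<close> common to all blocks.\<close>

lemma block_alignment:
  fixes H2 :: "'a::field mat set"
  assumes n: "d * k = e * l" and e: "e = d * m" and k: "k = m * l" and d: "0 < d" and m: "0 < m"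
    and g: "g \<in> carrier (GL (e * l))" and H2: "subgroup H2 (GL e)" and K2: "subgroup K2 (sym_group l)"
    and K1: "subgroup K1 (sym_group k)" "transitive_perms k K1"
    and perm: "\<And>p. p \<in> K1 \<Longrightarrow> \<exists>C\<in>wreath_GL e l H2 K2. bmat d k (\<lambda>_. 1\<^sub>m d) p = g * C * inv\<^bsub>GL (e * l)\<^esub> g"
    and f1: "\<And>i x. i \<in> {1..k} \<Longrightarrow> x \<in> bspace d i \<Longrightarrow> mat_act (inv\<^bsub>GL (e * l)\<^esub> g) x \<in> bspace e (f i)"
    and f2: "f ` {1..k} = {1..l}"
    and f3: "card {i\<in>{1..k}. f i = 1} = m"
    and f4: "\<And>p i i'. p \<in> K1 \<Longrightarrow> i \<in> {1..k} \<Longrightarrow> i' \<in> {1..k} \<Longrightarrow> f i = f i' \<Longrightarrow> f (p i) = f (p i')"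
  obtains s h b where "s permutes {1..k}" "\<And>j. j \<in> {1..l} \<Longrightarrow> h j \<in> H2" "b \<in> carrier_mat e e"
    "inv\<^bsub>GL (e * l)\<^esub> g * bmat d k (\<lambda>_. 1\<^sub>m d) s = bmat e l (\<lambda>j. h j * b) id"
proof -
  let ?g = "inv\<^bsub>GL (e * l)\<^esub> g" and ?P = "bmat d k (\<lambda>_. 1\<^sub>m d)"
  have e0: "0 < e" using d m e by simp
  note inv = GL_inv[OF g]
  have gm: "g \<in> carrier_mat (d * k) (d * k)" "?g \<in> carrier_mat (d * k) (d * k)"
    unfolding n using GL_mat[OF g] GL_mat[OF inv(1)] .
  have col0: "?g $$ (r, (i - 1) * d + t) = 0"
    if i: "i \<in> {1..k}" and t: "t < d" and r: "r < d * k" "r div e + 1 \<noteq> f i" for i t r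
  proof -
    note b = block_index[OF i t]
    have "(\<lambda>r. if r = (i - 1) * d + t then 1 else 0) \<in> bspace d i" using b(2) by (auto simp: bspace_def)
    from f1[OF i this] have "mat_act ?g (\<lambda>r. if r = (i - 1) * d + t then 1 else 0) r = 0"
      using r(2) unfolding bspace_def by blast
    then show ?thesis unfolding mat_act_unit[OF gm(2) r(1) b(1)] .
  qed
  \<comment> \<open>An invertible matrix has no zero column; this is what identifies
    \<open>p 1\<close> below.\<close>
  have col_nz: "\<exists>r<d * k. ?g $$ (r, C) \<noteq> 0" if C: "C < d * k" for C
  proof (rule ccontr)
    assume z: "\<not> ?thesis"
    have "(g * ?g) $$ (C, C) = (\<Sum>x<d * k. g $$ (C, x) * ?g $$ (x, C))"
      using gm C by (simp add: scalar_prod_def lessThan_atLeast0)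
    also have "\<dots> = 0" using z by (intro sum.neutral) auto
    finally show False using inv(2) C n by simp
  qed
  \<comment> \<open>Collects the requirements on the representative for block \<open>j\<close>, so
    that the representatives and their matrices can be chosen for all \<open>j\<close> at
    once.\<close>
  define R where "R j \<sigma> h \<longleftrightarrow> (\<forall>i\<in>{1..k}. f i = 1 \<longrightarrow> f (\<sigma> i) = j \<and>
      (\<forall>r<d * k. \<forall>t<d. ?g $$ (r, (\<sigma> i - 1) * d + t) =
        (if r div e + 1 = j then \<Sum>y<e. h $$ (r mod e, y) * ?g $$ (y, (i - 1) * d + t) else 0)))"
    for j \<sigma> h
  have step: "\<exists>\<sigma>\<in>K1. \<exists>h\<in>H2. R j \<sigma> h" if j: "j \<in> {1..l}" for j
  proof -
    have l1: "1 \<in> {1..l}" using j by simp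
    obtain i1 i2 where i12: "i1 \<in> {1..k}" "f i1 = 1" "i2 \<in> {1..k}" "f i2 = j"
      using f2 l1 j by (metis imageE)
    obtain \<sigma> where \<sigma>: "\<sigma> \<in> K1" "\<sigma> i1 = i2" using K1(2) i12 unfolding transitive_perms_def by blast
    note \<sigma>p = sym_subgroup(1)[OF K1(1) \<sigma>(1)]
    obtain C where C: "C \<in> wreath_GL e l H2 K2" "?P \<sigma> = g * C * ?g" using perm[OF \<sigma>(1)] by blast
    obtain h p where hp: "C = bmat e l h p" "\<And>q. q \<in> {1..l} \<Longrightarrow> h q \<in> H2" "p \<in> K2"
      using C(1) by (rule wreath_GLE) blast
    have Cm: "C \<in> carrier_mat (d * k) (d * k)" unfolding hp(1) n by simp
    \<comment> \<open>Permuting the columns of \<open>?g\<close> by \<open>\<sigma>\<close> amounts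
      to multiplying it by \<open>C\<close> from the left.\<close>
    have "?g * ?P \<sigma> = (?g * g) * (C * ?g)"
      unfolding C(2) using gm Cm by (simp add: assoc_mult_mat[of _ "d * k" "d * k" _ "d * k" _ "d * k"])
    also have "\<dots> = C * ?g" using left_mult_one_mat[OF mult_carrier_mat[OF Cm gm(2)]] inv(3) n by simp
    finally have gP: "?g * ?P \<sigma> = C * ?g" .
    have fs: "f (\<sigma> i) = j" if "i \<in> {1..k}" "f i = 1" for i
      using f4[OF \<sigma>(1) that(1) i12(1)] that(2) i12 \<sigma>(2) by simp
    have ent: "?g $$ (r, (\<sigma> i - 1) * d + t) =
        (if r div e + 1 = p 1 then \<Sum>y<e. h 1 $$ (r mod e, y) * ?g $$ (y, (i - 1) * d + t) else 0)"
      if i: "i \<in> {1..k}" "f i = 1" and r: "r < d * k" and t: "t < d" for i r t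
    proof -
      let ?C = "(i - 1) * d + t"
      note b = block_index[OF i(1) t]
      have "?g $$ (r, (\<sigma> i - 1) * d + t) = (C * ?g) $$ (r, ?C)"
        using mult_perm_index[OF gm(2) \<sigma>p i(1) t r] gP by simp
      also have "\<dots> = (\<Sum>x<e * l. C $$ (r, x) * ?g $$ (x, ?C))"
        using gm Cm r b(1) by (simp add: scalar_prod_def lessThan_atLeast0 n[symmetric] del: add_diff_cancel_right')
      also have "\<dots> = (\<Sum>y<e. C $$ (r, (1 - 1) * e + y) * ?g $$ ((1 - 1) * e + y, ?C))"
        using col0[OF i(1) t] i(2) by (intro sum_block[OF l1]) (simp add: n)
      also have "\<dots> = (\<Sum>y<e. (if r div e + 1 = p 1 then h 1 $$ (r mod e, y) else 0) * ?g $$ (y, ?C))"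
      proof (rule sum.cong[OF refl])
        fix y assume "y \<in> {..<e}"
        then have y: "y < e" by simp
        have rc: "r < e * l" "y < e * l" using r n block_index(1)[OF l1 y] by simp_all
        show "C $$ (r, (1 - 1) * e + y) * ?g $$ ((1 - 1) * e + y, ?C) =
            (if r div e + 1 = p 1 then h 1 $$ (r mod e, y) else 0) * ?g $$ (y, ?C)"
          unfolding hp(1) using bmat_index[OF rc, of h p] y by simp
      qed
      finally show ?thesis by auto
    qed
    \<comment> \<open>A nonzero column over \<open>j\<close> is confined to row block
      \<open>j\<close> by \<open>f\<close> and to row block \<open>p 1\<close> by the shape of
      \<open>C\<close>.\<close>
    have "p 1 = j"
    proof -
      have i2: "\<sigma> i1 \<in> {1..k}" using i12 \<sigma> by simp
      obtain r where r: "r < d * k" "?g $$ (r, (\<sigma> i1 - 1) * d + 0) \<noteq> 0"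
        using col_nz[OF block_index(1)[OF i2 d]] by blast
      have "r div e + 1 = f (\<sigma> i1)" using col0[OF i2 d r(1)] r(2) by blast
      moreover have "r div e + 1 = p 1" using ent[OF i12(1,2) r(1) d] r(2) by (metis (no_types, lifting))
      ultimately show ?thesis using fs i12 by simp
    qed
    note p1 = this
    show ?thesis
    proof (rule bexI[OF _ \<sigma>(1)], rule bexI[OF _ hp(2)[OF l1]], unfold R_def, intro ballI impI conjI allI)
      fix i assume i: "i \<in> {1..k}" "f i = 1"
      show "f (\<sigma> i) = j" by (rule fs[OF i])
      fix r t assume "r < d * k" "t < d"
      then show "?g $$ (r, (\<sigma> i - 1) * d + t) =
          (if r div e + 1 = j then \<Sum>y<e. h 1 $$ (r mod e, y) * ?g $$ (y, (i - 1) * d + t) else 0)"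
        using ent[OF i] p1 by simp
    qed
  qed
  then obtain \<sigma> h where \<sigma>: "\<And>j. j \<in> {1..l} \<Longrightarrow> \<sigma> j \<in> K1" and h: "\<And>j. j \<in> {1..l} \<Longrightarrow> h j \<in> H2"
    and R: "\<And>j. j \<in> {1..l} \<Longrightarrow> R j (\<sigma> j) (h j)"
    by metis
  have f\<sigma>: "f (\<sigma> j i) = j" if "j \<in> {1..l}" "i \<in> {1..k}" "f i = 1" for j i
    using R[OF that(1)] that(2,3) by (simp add: R_def)
  have ent: "?g $$ (r, (\<sigma> j i - 1) * d + t) =
      (if r div e + 1 = j then \<Sum>y<e. h j $$ (r mod e, y) * ?g $$ (y, (i - 1) * d + t) else 0)"
    if "j \<in> {1..l}" "i \<in> {1..k}" "f i = 1" "r < d * k" "t < d" for j i r t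
    using R[OF that(1)] that(2-) by (simp only: R_def)
  obtain s1 where s1: "bij_betw s1 {1..m} {i\<in>{1..k}. f i = 1}"
    using ex_bij_betw_nat_finite_1[of "{i\<in>{1..k}. f i = 1}"] f3 by auto
  have s1r: "s1 r \<in> {1..k}" "f (s1 r) = 1" if "r \<in> {1..m}" for r using bij_betwE[OF s1] that by blast+
  \<comment> \<open>The r-th point of the j-th consecutive block is sent to
    \<open>\<sigma> j (s1 r)\<close>. Using one enumeration \<open>s1\<close> of the fibre over 1
    for every \<open>j\<close> is what makes \<open>b\<close> independent of
    \<open>j\<close>.\<close>
  define s where "s c = (if c \<in> {1..k} then \<sigma> ((c - 1) div m + 1) (s1 ((c - 1) mod m + 1)) else c)" for c
  have s: "s permutes {1..k}"
  proof (rule permutesI_inj)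
    fix c assume c: "c \<in> {1..k}"
    note p = pair_index[OF c[unfolded k]]
    show "s c \<in> {1..k}"
      using c permutes_range[OF sym_subgroup(1)[OF K1(1) \<sigma>[OF p(1)]] s1r(1)[OF p(2)]] by (simp add: s_def)
  next
    show "inj_on s {1..k}"
    proof (rule inj_onI)
      fix c c' assume c: "c \<in> {1..k}" "c' \<in> {1..k}" "s c = s c'"
      note p = pair_index[OF c(1)[unfolded k]] and p' = pair_index[OF c(2)[unfolded k]]
      have sc: "s c = \<sigma> ((c - 1) div m + 1) (s1 ((c - 1) mod m + 1))"
        "s c' = \<sigma> ((c' - 1) div m + 1) (s1 ((c' - 1) mod m + 1))" using c by (simp_all add: s_def)
      have "f (s c) = (c - 1) div m + 1" "f (s c') = (c' - 1) div m + 1"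
        unfolding sc using f\<sigma>[OF p(1) s1r[OF p(2)]] f\<sigma>[OF p'(1) s1r[OF p'(2)]] .
      then have d: "(c - 1) div m + 1 = (c' - 1) div m + 1" using c(3) by simp
      have "s1 ((c - 1) mod m + 1) = s1 ((c' - 1) mod m + 1)"
        by (rule injD[OF permutes_inj[OF sym_subgroup(1)[OF K1(1) \<sigma>[OF p'(1)]]] c(3)[unfolded sc d]])
      then have m: "(c - 1) mod m + 1 = (c' - 1) mod m + 1"
        by (rule inj_onD[OF bij_betw_imp_inj_on[OF s1] _ p(2) p'(2)])
      show "c = c'" by (rule trans[OF p(3)[unfolded d m, symmetric] p'(3)])
    qed
  qed (auto simp: s_def)
  \<comment> \<open>The first row block of \<open>?g\<close>, restricted to the columns over 1 in
    the order given by \<open>s1\<close>.\<close>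
  define b where "b = mat e e (\<lambda>(y, c). ?g $$ (y, (s1 (c div d + 1) - 1) * d + c mod d))"
  have "?g * ?P s = bmat e l (\<lambda>j. h j * b) id"
  proof (rule eq_matI)
    fix r c assume "r < dim_row (bmat e l (\<lambda>j. h j * b) id)" "c < dim_col (bmat e l (\<lambda>j. h j * b) id)"
    then have rc: "r < e * l" "c < e * l" by simp_all
    then have rc': "r < d * k" "c < d * k" using n by simp_all
    note bi = index_block[OF rc'(2)]
    let ?i = "c div d + 1" and ?j = "c div e + 1" and ?r = "c div d mod m + 1" and ?t = "c mod d"
    have j: "?j \<in> {1..l}" by (rule index_block(1)[OF rc(2)])
    have p: "(?i - 1) div m + 1 = ?j" "(?i - 1) mod m + 1 = ?r" by (simp_all add: e div_mult2_eq)
    have r: "?r \<in> {1..m}" using mod_less_divisor[OF m, of "c div d"] by simp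
    have si: "s ?i = \<sigma> ?j (s1 ?r)" using bi(1) unfolding s_def p by simp
    have hm: "h ?j \<in> carrier_mat e e" using h[OF j] GL_subgroup(1)[OF H2] GL_mat by blast
    have cm: "c mod e < e" "r mod e < e" using e0 by simp_all
    have ce: "c mod e div d = c div d mod m" "c mod e mod d = ?t" using d unfolding e by (simp_all add: mod_mult2_eq)
    have "(?g * ?P s) $$ (r, c) = ?g $$ (r, (s ?i - 1) * d + ?t)"
      using mult_perm_index[OF gm(2) s bi(1,2) rc'(1)] bi(3) by simp
    also have "\<dots> = (if r div e + 1 = ?j then \<Sum>y<e. h ?j $$ (r mod e, y) * ?g $$ (y, (s1 ?r - 1) * d + ?t) else 0)"
      unfolding si by (rule ent[OF j s1r[OF r] rc'(1) bi(2)])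
    also have "\<dots> = (if r div e + 1 = ?j then (h ?j * b) $$ (r mod e, c mod e) else 0)"
      using hm cm by (simp add: b_def scalar_prod_def lessThan_atLeast0 ce)
    also have "\<dots> = bmat e l (\<lambda>j. h j * b) id $$ (r, c)" by (simp add: bmat_index[OF rc])
    finally show "(?g * ?P s) $$ (r, c) = bmat e l (\<lambda>j. h j * b) id $$ (r, c)" .
  qed (use gm n in simp_all)
  moreover have "b \<in> carrier_mat e e" by (simp add: b_def)
  ultimately show thesis using that[of s h b] s h by blast
qed

text \<open>The top left corner of the inverse is inverse to \<open>b\<close>, since the first row
  block of the diagonal matrix meets only the first row block of its inverse.\<close>

lemma GL_diag_block:
  assumes D: "bmat e l (\<lambda>_. b) id \<in> carrier (GL (e * l))" and b: "b \<in> carrier_mat e e" and l: "0 < l"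
  shows "b \<in> carrier (GL e)"
proof -
  let ?Z = "inv\<^bsub>GL (e * l)\<^esub> (bmat e l (\<lambda>_. b) id)"
  note inv = GL_inv[OF D]
  have l1: "1 \<in> {1..l}" using l by simp
  have Z: "?Z \<in> carrier_mat (e * l) (e * l)" by (rule GL_mat[OF inv(1)])
  define z where "z = mat e e (\<lambda>(y, c). ?Z $$ (y, c))"
  have z: "z \<in> carrier_mat e e" by (simp add: z_def)
  have "b * z = 1\<^sub>m e"
  proof (rule eq_matI)
    fix r c assume "r < dim_row (1\<^sub>m e :: 'a mat)" "c < dim_col (1\<^sub>m e :: 'a mat)"
    then have rc: "r < e" "c < e" by simp_all
    have rc': "r < e * l" "c < e * l" using block_index(1)[OF l1 rc(1)] block_index(1)[OF l1 rc(2)] by simp_all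
    have "1\<^sub>m e $$ (r, c) = (bmat e l (\<lambda>_. b) id * ?Z) $$ (r, c)" unfolding inv(2) using rc rc' by simp
    also have "\<dots> = (\<Sum>x<e * l. bmat e l (\<lambda>_. b) id $$ (r, x) * ?Z $$ (x, c))"
      using rc' Z by (simp add: scalar_prod_def lessThan_atLeast0)
    also have "\<dots> = (\<Sum>y<e. bmat e l (\<lambda>_. b) id $$ (r, (1 - 1) * e + y) * ?Z $$ ((1 - 1) * e + y, c))"
      using rc rc' by (intro sum_block[OF l1]) (auto simp: bmat_index)
    also have "\<dots> = (\<Sum>y<e. b $$ (r, y) * ?Z $$ (y, c))"
    proof (rule sum.cong[OF refl])
      fix y assume "y \<in> {..<e}"
      then have y: "y < e" by simp
      show "bmat e l (\<lambda>_. b) id $$ (r, (1 - 1) * e + y) * ?Z $$ ((1 - 1) * e + y, c) = b $$ (r, y) * ?Z $$ (y, c)"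
        using bmat_block[OF l1 l1 rc(1) y, of "\<lambda>_. b" id] by simp
    qed
    also have "\<dots> = (b * z) $$ (r, c)" using rc b by (simp add: z_def scalar_prod_def lessThan_atLeast0)
    finally show "(b * z) $$ (r, c) = 1\<^sub>m e $$ (r, c)" by simp
  qed (use b z in simp_all)
  then show ?thesis by (rule GL_inv_unique(1)[OF b z])
qed

text \<open>The \<open>l\<close> fibres of \<open>f\<close> have a common size \<open>m\<close>;
  counting gives \<open>k = m * l\<close>, and comparing dimensions gives
  \<open>e = d * m\<close>.\<close>

lemma refinement_index:
  fixes H1 H2 :: "'a::field mat set"
  assumes prim: "primitive_group d H1" and nt: "H1 \<noteq> {1\<^sub>m d}"
    and K1: "subgroup K1 (sym_group k)" "transitive_perms k K1" and k: "0 < k"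
    and exc: "\<not> (d = 1 \<and> even k \<and> card H1 = 2 \<and> preserves_pairing k K1)"
    and n: "d * k = e * l" and l: "0 < l" and g: "g \<in> carrier (GL (e * l))"
    and K2: "subgroup K2 (sym_group l)"
    and sub: "wreath_GL d k H1 K1 \<subseteq> conj_set (GL (e * l)) g (wreath_GL e l H2 K2)"
  obtains m f where "0 < m" "k = m * l" "e = d * m"
    and "\<And>i. i \<in> {1..k} \<Longrightarrow> f i \<in> {1..l}"
    and "\<And>i x. i \<in> {1..k} \<Longrightarrow> x \<in> bspace d i \<Longrightarrow> mat_act (inv\<^bsub>GL (e * l)\<^esub> g) x \<in> bspace e (f i)"
    and "f ` {1..k} = {1..l}" and "card {i\<in>{1..k}. f i = 1} = m"
    and "\<And>p i i'. p \<in> K1 \<Longrightarrow> i \<in> {1..k} \<Longrightarrow> i' \<in> {1..k} \<Longrightarrow> f i = f i' \<Longrightarrow> f (p i) = f (p i')"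
proof (rule wreath_refinement[OF prim nt K1 k exc n g K2 sub])
  fix f assume f: "\<And>i. i \<in> {1..k} \<Longrightarrow> f i \<in> {1..l}"
    "\<And>i x. i \<in> {1..k} \<Longrightarrow> x \<in> bspace d i \<Longrightarrow> mat_act (inv\<^bsub>GL (e * l)\<^esub> g) x \<in> bspace e (f i)"
    "f ` {1..k} = {1..l}"
    "\<And>j j'. j \<in> {1..l} \<Longrightarrow> j' \<in> {1..l} \<Longrightarrow> card {i\<in>{1..k}. f i = j} = card {i\<in>{1..k}. f i = j'}"
    "\<And>p i i'. p \<in> K1 \<Longrightarrow> i \<in> {1..k} \<Longrightarrow> i' \<in> {1..k} \<Longrightarrow> f i = f i' \<Longrightarrow> f (p i) = f (p i')"
  define m where "m = card {i\<in>{1..k}. f i = 1}"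
  have l1: "1 \<in> {1..l}" using l by simp
  have "card {1..k} = (\<Sum>j\<in>{1..l}. card {i\<in>{1..k}. f i = j})"
    using sum.group[of "{1..k}" "{1..l}" f "\<lambda>_. 1 :: nat"] f(3) by simp
  also have "\<dots> = (\<Sum>j\<in>{1..l}. m)" unfolding m_def using f(4)[OF _ l1] by (rule sum.cong[OF refl])
  finally have km: "k = m * l" by simp
  then have m: "0 < m" using k by simp
  have "e * l = d * m * l" unfolding n[symmetric] km by (simp only: mult.assoc)
  moreover have "l \<noteq> 0" using l by simp
  ultimately have e: "e = d * m" by (metis mult_right_cancel)
  show thesis
  proof (rule that[of m f])
    show "f (p i) = f (p i')" if "p \<in> K1" "i \<in> {1..k}" "i' \<in> {1..k}" "f i = f i'" for p i i'
      by (rule f(5)[OF that])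
  qed (fact m km e f(1,2,3) m_def[symmetric])+
qed

text \<open>The alignment factors \<open>g^-1 P_s\<close> as \<open>h D\<close>, with
  \<open>h\<close> in the base group of \<open>H2\<close> wr \<open>K2\<close> and \<open>D\<close>
  block diagonal with equal blocks \<open>b\<close>. Conjugating the inclusion by
  \<open>P_s^-1\<close> absorbs \<open>h\<close>, replaces \<open>H2\<close> by its conjugate under
  \<open>b^-1\<close>, and reduces to standard position.\<close>

lemma conjugate_refinement:
  fixes H1 H2 :: "'a::field mat set"
  assumes prim: "primitive_group d H1" and nt: "H1 \<noteq> {1\<^sub>m d}"
    and K1: "subgroup K1 (sym_group k)" "transitive_perms k K1" and k: "0 < k"
    and exc: "\<not> (d = 1 \<and> even k \<and> card H1 = 2 \<and> preserves_pairing k K1)"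
    and n: "d * k = e * l" and l: "0 < l" and g: "g \<in> carrier (GL (e * l))"
    and H2: "subgroup H2 (GL e)" and K2: "subgroup K2 (sym_group l)"
    and sub: "wreath_GL d k H1 K1 \<subseteq> conj_set (GL (e * l)) g (wreath_GL e l H2 K2)"
  shows "\<exists>m X s t. k = m * l \<and> subgroup X (sym_group m) \<and> s \<in> carrier (sym_group k) \<and> t \<in> carrier (GL e) \<and>
    K1 \<subseteq> conj_set (sym_group k) s (wreath_Sym m l X K2) \<and> wreath_GL d m H1 X \<subseteq> conj_set (GL e) t H2"
proof (rule refinement_index[OF prim nt K1 k exc n l g K2 sub])
  fix m f assume m: "0 < m" and km: "k = m * l" and e: "e = d * m"
    and f: "\<And>i. i \<in> {1..k} \<Longrightarrow> f i \<in> {1..l}"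
      "\<And>i x. i \<in> {1..k} \<Longrightarrow> x \<in> bspace d i \<Longrightarrow> mat_act (inv\<^bsub>GL (e * l)\<^esub> g) x \<in> bspace e (f i)"
      "f ` {1..k} = {1..l}" "card {i\<in>{1..k}. f i = 1} = m"
      "\<And>p i i'. p \<in> K1 \<Longrightarrow> i \<in> {1..k} \<Longrightarrow> i' \<in> {1..k} \<Longrightarrow> f i = f i' \<Longrightarrow> f (p i) = f (p i')"
  let ?N = "GL (e * l) :: 'a mat monoid" and ?W2 = "wreath_GL e l H2 K2" and ?P = "bmat d k (\<lambda>_. 1\<^sub>m d) :: _ \<Rightarrow> 'a mat"
  have irr: "irreducible_group d H1" using prim by (simp add: primitive_group_def)
  have d: "0 < d" and H1: "subgroup H1 (GL d)" using irr by (auto simp: irreducible_group_def)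
  have perm: "\<exists>C\<in>?W2. ?P p = g * C * inv\<^bsub>?N\<^esub> g" if "p \<in> K1" for p
  proof -
    have "?P p \<in> wreath_GL d k H1 K1" using GL_subgroup(2)[OF H1] that by (intro wreath_GLI)
    then show ?thesis using sub conj_GL_iff by blast
  qed
  show ?thesis
  proof (rule block_alignment[where f = f, OF n e km d m g H2 K2 K1 perm f(2,3,4)])
    show "f (p i) = f (p i')" if "p \<in> K1" "i \<in> {1..k}" "i' \<in> {1..k}" "f i = f i'" for p i i'
      by (rule f(5)[OF that])
  next
    fix s h b assume s: "s permutes {1..k}" and h: "\<And>j. j \<in> {1..l} \<Longrightarrow> h j \<in> H2" and b: "b \<in> carrier_mat e e"
      and eq: "inv\<^bsub>?N\<^esub> g * ?P s = bmat e l (\<lambda>j. h j * b) id"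
    let ?s = "inv\<^bsub>sym_group k\<^esub> s" and ?D = "bmat e l (\<lambda>_. b) id" and ?h = "bmat e l h id"
    note s' = sym_inv[OF s]
    note g' = GL_inv[OF g]
    have I: "1\<^sub>m d \<in> carrier (GL d)" by (rule GL_one_closed)
    have PG: "?P q \<in> carrier ?N" if "q permutes {1..k}" for q
      using bmat_inverse(1)[of k "\<lambda>_. 1\<^sub>m d" d, OF I that] unfolding n .
    have W2: "subgroup ?W2 ?N" by (rule wreath_subgroup[OF H2 K2])
    have hW: "?h \<in> ?W2" using h sym_subgroup(2)[OF K2] by (intro wreath_GLI)
    then have hG: "?h \<in> carrier ?N" using GL_subgroup(1)[OF W2] by blast
    have hm: "h j \<in> carrier_mat e e" if "j \<in> {1..l}" for j
      using h[OF that] GL_subgroup(1)[OF H2] GL_mat by blast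
    have hD: "?h * ?D = inv\<^bsub>?N\<^esub> g * ?P s"
      unfolding eq using bmat_mult[of l h e "\<lambda>_. b" id id, OF hm b] by simp
    have gPG: "inv\<^bsub>?N\<^esub> g * ?P s \<in> carrier ?N" by (rule GL_mult_closed[OF g'(1) PG[OF s]])
    interpret N: group ?N by (rule GL_group)
    have Dm: "?D \<in> carrier_mat (e * l) (e * l)" by simp
    \<comment> \<open>This exhibits \<open>?D\<close> as a product of invertible matrices, which
      yields the invertibility of \<open>b\<close>.\<close>
    have D: "?D = inv\<^bsub>?N\<^esub> ?h * (inv\<^bsub>?N\<^esub> g * ?P s)"
    proof -
      have "inv\<^bsub>?N\<^esub> ?h * (?h * ?D) = (inv\<^bsub>?N\<^esub> ?h * ?h) * ?D"
        by (rule assoc_mult_mat[symmetric, OF GL_mat[OF GL_inv(1)[OF hG]] GL_mat[OF hG] Dm])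
      then show ?thesis unfolding GL_inv(3)[OF hG] hD left_mult_one_mat[OF Dm] ..
    qed
    have DG: "?D \<in> carrier ?N" unfolding D by (rule GL_mult_closed[OF GL_inv(1)[OF hG] gPG])
    have bG: "b \<in> carrier (GL e)" by (rule GL_diag_block[OF DG b l])
    let ?b = "inv\<^bsub>GL e\<^esub> b"
    have b': "?b \<in> carrier (GL e)" by (rule GL_inv(1)[OF bG])
    have inv_const: "inv\<^bsub>GL (x * y)\<^esub> (bmat x y (\<lambda>_. a) p) = bmat x y (\<lambda>_. inv\<^bsub>GL x\<^esub> a) (inv\<^bsub>sym_group y\<^esub> p)"
      if "a \<in> carrier (GL x)" "p permutes {1..y}" for x y and a :: "'a mat" and p
      using bmat_inverse(2)[of y "\<lambda>_. a" x p] that by blast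
    have inv_id: "inv\<^bsub>sym_group l\<^esub> id = id"
      using monoid.inv_one[OF group.is_monoid[OF sym_group_is_group]] sym_one by metis
    have invD: "inv\<^bsub>?N\<^esub> ?D = bmat e l (\<lambda>_. ?b) id"
      using inv_const[OF bG permutes_id, of l] unfolding inv_id .
    have inv1: "inv\<^bsub>GL d\<^esub> (1\<^sub>m d) = 1\<^sub>m d" using monoid.inv_one[OF group.is_monoid[OF GL_group]] GL_one by metis
    have invP: "inv\<^bsub>?N\<^esub> (?P s) = ?P ?s"
      using inv_const[OF I s] unfolding inv1 n .
    have K1c: "K1 \<subseteq> carrier (sym_group k)" using sym_subgroup(1)[OF K1(1)] sym_carrier by blast
    have sc: "s \<in> carrier (sym_group k)" "?s \<in> carrier (sym_group k)" using s s'(1) sym_carrier by blast+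
    define K1' where "K1' = conj_set (sym_group k) ?s K1"
    have K1': "subgroup K1' (sym_group k)"
      unfolding K1'_def by (rule conj_set_subgroup[OF sym_group_is_group K1(1) sc(2)])
    define H2' where "H2' = conj_set (GL e) ?b H2"
    have H2': "subgroup H2' (GL e)" unfolding H2'_def by (rule conj_set_subgroup[OF GL_group H2 b'])
    have W2c: "?W2 \<subseteq> carrier ?N" by (rule GL_subgroup(1)[OF W2])
    have PD: "inv\<^bsub>?N\<^esub> (?P s) * g = inv\<^bsub>?N\<^esub> ?D * inv\<^bsub>?N\<^esub> ?h"
    proof -
      have "inv\<^bsub>?N\<^esub> (?h * ?D) = inv\<^bsub>?N\<^esub> ?D * inv\<^bsub>?N\<^esub> ?h"
        using N.inv_mult_group[OF hG DG] by (simp add: GL_mult)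
      moreover have "inv\<^bsub>?N\<^esub> (inv\<^bsub>?N\<^esub> g * ?P s) = inv\<^bsub>?N\<^esub> (?P s) * g"
        using N.inv_mult_group[OF g'(1) PG[OF s]] N.inv_inv[OF g] by (simp add: GL_mult)
      ultimately show ?thesis unfolding hD by simp
    qed
    have "wreath_GL d k H1 K1' \<subseteq> conj_set ?N (?P ?s) (wreath_GL d k H1 K1)"
      unfolding K1'_def using wreath_conj_perm[OF H1 s'(1) sym_subgroup(1)[OF K1(1)]] unfolding n .
    also have "\<dots> \<subseteq> conj_set ?N (?P ?s) (conj_set ?N g ?W2)" by (rule conj_set_mono[OF sub])
    also have "\<dots> = conj_set ?N (inv\<^bsub>?N\<^esub> (?P s) * g) ?W2"
      using conj_set_mult[OF GL_group PG[OF s'(1)] g W2c] by (simp add: GL_mult invP)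
    also have "\<dots> = conj_set ?N (inv\<^bsub>?N\<^esub> ?D) (conj_set ?N (inv\<^bsub>?N\<^esub> ?h) ?W2)"
      unfolding PD using conj_set_mult[OF GL_group GL_inv(1)[OF DG] GL_inv(1)[OF hG] W2c] by (simp add: GL_mult)
    also have "conj_set ?N (inv\<^bsub>?N\<^esub> ?h) ?W2 = ?W2"
      by (rule conj_set_self[OF GL_group W2 GL_subgroup(4)[OF W2 hW]])
    also have "conj_set ?N (inv\<^bsub>?N\<^esub> ?D) ?W2 = wreath_GL e l H2' K2"
      unfolding invD H2'_def by (rule wreath_conj_diag[OF H2 b' sym_subgroup(1)[OF K2]])
    finally have "wreath_GL d (m * l) H1 K1' \<subseteq> wreath_GL (d * m) l H2' K2" unfolding km e .
    then obtain X where X: "subgroup X (sym_group m)" "K1' \<subseteq> wreath_Sym m l X K2" "wreath_GL d m H1 X \<subseteq> H2'"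
      using wreath_GL_subsetD[OF H1 H2'[unfolded e] K1'[unfolded km] K2 d m l] by blast
    have "K1 = conj_set (sym_group k) s K1'"
      unfolding K1'_def using conj_set_inv(1)[OF sym_group_is_group sc(1) K1c] by simp
    then have "K1 \<subseteq> conj_set (sym_group k) s (wreath_Sym m l X K2)" using conj_set_mono[OF X(2)] by simp
    then show ?thesis using km X(1,3) sc(1) b' unfolding H2'_def by blast
  qed
qed

section \<open>The two equivalences: standard position and up to conjugacy\<close>

theorem corollary4p2:
  fixes n d k e l :: nat
    and H1 H2 :: "'a::field mat set"
    and K1 K2 :: "(nat \<Rightarrow> nat) set"
  assumes "0 < n" "0 < d" "0 < e" "0 < l"
    and "n = d * k" and "1 < k"
    and "primitive_group d H1" and "H1 \<noteq> {1\<^sub>m d}"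
    and "subgroup K1 (sym_group k)" and "transitive_perms k K1"
    and "\<not> (d = 1 \<and> n = k \<and> even n \<and> card H1 = 2 \<and> preserves_pairing n K1)"
  shows
    \<comment> \<open>wreath products formed with respect to the standard bases and blocks\<close>
    "((n = e * l \<and> 1 < l \<and> subgroup H2 (GL e) \<and> subgroup K2 (sym_group l) \<and>
       imprimitive_group n (wreath_GL e l H2 K2) \<and>
       wreath_GL d k H1 K1 \<subseteq> wreath_GL e l H2 K2)
      \<longleftrightarrow>
      (n = e * l \<and> subgroup H2 (GL e) \<and> subgroup K2 (sym_group l) \<and> 1 < l \<and> l dvd k \<and>
       (\<exists>X Y. subgroup X (sym_group (k div l)) \<and> subgroup Y (sym_group l) \<and> Y \<subseteq> K2 \<and>
          K1 \<subseteq> wreath_Sym (k div l) l X Y \<and>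
          wreath_GL d (k div l) H1 X \<subseteq> H2)))
     \<and>
     \<comment> \<open>wreath products regarded as subgroups up to conjugacy\<close>
     ((n = e * l \<and> 1 < l \<and> subgroup H2 (GL e) \<and> subgroup K2 (sym_group l) \<and>
       (\<exists>g\<in>carrier (GL n).
          imprimitive_group n (conj_set (GL n) g (wreath_GL e l H2 K2)) \<and>
          wreath_GL d k H1 K1 \<subseteq> conj_set (GL n) g (wreath_GL e l H2 K2)))
      \<longleftrightarrow>
      (n = e * l \<and> subgroup H2 (GL e) \<and> subgroup K2 (sym_group l) \<and> 1 < l \<and> l dvd k \<and>
       (\<exists>X Y. subgroup X (sym_group (k div l)) \<and> subgroup Y (sym_group l) \<and> Y \<subseteq> K2 \<and>
          (\<exists>s\<in>carrier (sym_group k).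
             K1 \<subseteq> conj_set (sym_group k) s (wreath_Sym (k div l) l X Y)) \<and>
          (\<exists>t\<in>carrier (GL e).
             wreath_GL d (k div l) H1 X \<subseteq> conj_set (GL e) t H2))))"
    (is "(?A1 \<longleftrightarrow> ?B1) \<and> (?A2 \<longleftrightarrow> ?B2)")
proof -
  note prim = assms(7) and nt = assms(8) and K1 = assms(9,10) and n = assms(5)
  let ?W1 = "wreath_GL d k H1 K1" and ?W2 = "wreath_GL e l H2 K2"
  have k: "0 < k" using assms(6) by simp
  have irr: "irreducible_group d H1" using prim by (simp add: primitive_group_def)
  have H1: "subgroup H1 (GL d)" using irr by (simp add: irreducible_group_def)
  have exc: "\<not> (d = 1 \<and> even k \<and> card H1 = 2 \<and> preserves_pairing k K1)"
    using assms(11) n by auto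
  have irrW: "irreducible_group n ?W1"
    unfolding n by (rule wreath_irreducible[OF irr nt K1 k])
  \<comment> \<open>The larger group inherits irreducibility from \<open>?W1\<close> and permutes
    the conjugated standard summands, so its imprimitivity follows from the inclusion.\<close>
  have imprim: "imprimitive_group n (conj_set (GL n) g ?W2)"
    if nel: "n = e * l" and l: "1 < l" and H2: "subgroup H2 (GL e)" and K2: "subgroup K2 (sym_group l)"
      and g: "g \<in> carrier (GL n)" and sub: "?W1 \<subseteq> conj_set (GL n) g ?W2" for g
    unfolding nel
  proof (rule imprimitive_conj[OF _ order.refl g[unfolded nel] K2 l])
    show "irreducible_group (e * l) (conj_set (GL (e * l)) g ?W2)"
      using irreducible_superset[OF irrW _ sub] conj_set_subgroup[OF GL_group wreath_subgroup[OF H2 K2] g[unfolded nel]]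
      unfolding nel by blast
  qed
  have std: "conj_set (GL n) (1\<^sub>m n) ?W2 = ?W2"
    if nel: "n = e * l" and H2: "subgroup H2 (GL e)" and K2: "subgroup K2 (sym_group l)"
    using conj_set_one[OF GL_group GL_subgroup(1)[OF wreath_subgroup[OF H2 K2]]] unfolding nel GL_one .
  have "?A1 \<longleftrightarrow> ?B1"
  proof
    assume A: ?A1
    then have nel: "n = e * l" and l: "1 < l" and H2: "subgroup H2 (GL e)" and K2: "subgroup K2 (sym_group l)"
      and sub: "?W1 \<subseteq> ?W2" by blast+
    have dk: "d * k = e * l" using n nel by simp
    \<comment> \<open>Standard position is the case of conjugation by the identity, so the index
      computation applies to it as well.\<close>
    have sub': "?W1 \<subseteq> conj_set (GL (e * l)) (1\<^sub>m (e * l)) ?W2"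
      using sub std[OF nel H2 K2] unfolding nel by simp
    show ?B1
    proof (rule refinement_index[OF prim nt K1 k exc dk assms(4) GL_one_closed K2 sub'])
      fix m assume m: "0 < m" and km: "k = m * l" and e: "e = d * m"
      have kl: "k div l = m" using km assms(4) by simp
      obtain X where "subgroup X (sym_group m)" "K1 \<subseteq> wreath_Sym m l X K2" "wreath_GL d m H1 X \<subseteq> H2"
        using wreath_GL_subsetD[OF H1 H2[unfolded e] K1(1)[unfolded km] K2 assms(2) m assms(4) sub[unfolded km e]] by blast
      then show ?B1 unfolding kl using nel H2 K2 l km by (metis dvd_triv_right order.refl)
    qed
  next
    assume B: ?B1
    then obtain X Y where nel: "n = e * l" and l: "1 < l" and H2: "subgroup H2 (GL e)" and K2: "subgroup K2 (sym_group l)"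
      and dvd: "l dvd k" and X: "subgroup X (sym_group (k div l))" and Y: "subgroup Y (sym_group l)" "Y \<subseteq> K2"
      and K: "K1 \<subseteq> wreath_Sym (k div l) l X Y" and H: "wreath_GL d (k div l) H1 X \<subseteq> H2" by blast
    have kl: "k div l * l = k" using dvd by simp
    have "e * l = d * (k div l) * l" using nel n kl by (simp add: mult.assoc)
    then have e: "d * (k div l) = e" using assms(4) by simp
    have sub: "?W1 \<subseteq> ?W2" using wreath_GL_mono[OF H K Y(2) X Y(1)] unfolding kl e .
    have "1\<^sub>m n \<in> carrier (GL n)" by (rule GL_one_closed)
    from imprim[OF nel l H2 K2 this] sub show ?A1
      unfolding std[OF nel H2 K2] using nel l H2 K2 by blast
  qed
  moreover have "?A2 \<longleftrightarrow> ?B2"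
  proof
    assume A: ?A2
    then obtain g where nel: "n = e * l" and l: "1 < l" and H2: "subgroup H2 (GL e)" and K2: "subgroup K2 (sym_group l)"
      and g: "g \<in> carrier (GL n)" and sub: "?W1 \<subseteq> conj_set (GL n) g ?W2" by blast
    have dk: "d * k = e * l" using n nel by simp
    obtain m X s t where km: "k = m * l" and R: "subgroup X (sym_group m)" "s \<in> carrier (sym_group k)" "t \<in> carrier (GL e)"
      "K1 \<subseteq> conj_set (sym_group k) s (wreath_Sym m l X K2)" "wreath_GL d m H1 X \<subseteq> conj_set (GL e) t H2"
      using conjugate_refinement[OF prim nt K1 k exc dk assms(4) g[unfolded nel] H2 K2 sub[unfolded nel]] by blast
    have kl: "k div l = m" using km assms(4) by simp
    have "l dvd k" using km by simp
    then show ?B2 unfolding kl using nel H2 K2 l R by blast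
  next
    assume B: ?B2
    then obtain X Y s t where nel: "n = e * l" and l: "1 < l" and H2: "subgroup H2 (GL e)" and K2: "subgroup K2 (sym_group l)"
      and dvd: "l dvd k" and X: "subgroup X (sym_group (k div l))" and Y: "subgroup Y (sym_group l)" "Y \<subseteq> K2"
      and s: "s \<in> carrier (sym_group k)" and K: "K1 \<subseteq> conj_set (sym_group k) s (wreath_Sym (k div l) l X Y)"
      and t: "t \<in> carrier (GL e)" and H: "wreath_GL d (k div l) H1 X \<subseteq> conj_set (GL e) t H2" by blast
    let ?s = "inv\<^bsub>sym_group k\<^esub> s" and ?P = "bmat d k (\<lambda>_. 1\<^sub>m d) s" and ?D = "bmat e l (\<lambda>_. t) id"
    have kl: "k div l * l = k" using dvd by simp
    have "e * l = d * (k div l) * l" using nel n kl by (simp add: mult.assoc)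
    then have e: "d * (k div l) = e" using assms(4) by simp
    have sp: "s permutes {1..k}" using s sym_carrier by blast
    have sc: "?s \<in> carrier (sym_group k)" using sym_inv(1)[OF sp] sym_carrier by blast
    have K1c: "K1 \<subseteq> carrier (sym_group k)" using sym_subgroup(1)[OF K1(1)] sym_carrier by blast
    have WSc: "wreath_Sym (k div l) l X Y \<subseteq> carrier (sym_group k)"
      unfolding wreath_Sym_def kl by blast
    \<comment> \<open>Undoing \<open>s\<close> first puts \<open>K1\<close> in standard position,
      where \<open>wreath_GL_mono\<close> applies.\<close>
    define K1' where "K1' = conj_set (sym_group k) ?s K1"
    have K1': "subgroup K1' (sym_group k)"
      unfolding K1'_def by (rule conj_set_subgroup[OF sym_group_is_group K1(1) sc])
    have K1_eq: "K1 = conj_set (sym_group k) s K1'"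
      unfolding K1'_def using conj_set_inv(1)[OF sym_group_is_group s K1c] by simp
    have K': "K1' \<subseteq> wreath_Sym (k div l) l X Y"
      unfolding K1'_def using conj_set_mono[OF K] conj_set_inv(2)[OF sym_group_is_group s WSc] by blast
    have D: "?D \<in> carrier (GL n)" unfolding nel by (rule bmat_inverse(1)[OF t permutes_id])
    have P: "?P \<in> carrier (GL n)" unfolding n by (rule bmat_inverse(1)[OF GL_one_closed sp])
    have W2c: "?W2 \<subseteq> carrier (GL n)" unfolding nel by (rule GL_subgroup(1)[OF wreath_subgroup[OF H2 K2]])
    \<comment> \<open>The conjugating matrix is \<open>?P * ?D\<close>: the permutation matrix of
      \<open>s\<close> accounts for (ii), the diagonal matrix of \<open>t\<close> for (iii).\<close>
    have "?W1 \<subseteq> conj_set (GL n) ?P (wreath_GL d k H1 K1')"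
      unfolding n using wreath_conj_perm[OF H1 sp sym_subgroup(1)[OF K1']] K1_eq by metis
    also have "\<dots> \<subseteq> conj_set (GL n) ?P (wreath_GL e l (conj_set (GL e) t H2) K2)"
      using wreath_GL_mono[OF H K' Y(2) X Y(1)] unfolding kl e by (rule conj_set_mono)
    also have "\<dots> = conj_set (GL n) ?P (conj_set (GL n) ?D ?W2)"
      unfolding nel by (rule arg_cong[OF wreath_conj_diag[OF H2 t sym_subgroup(1)[OF K2], symmetric]])
    also have "\<dots> = conj_set (GL n) (?P * ?D) ?W2"
      using conj_set_mult[OF GL_group P D W2c] by (simp add: GL_mult)
    finally have sub: "?W1 \<subseteq> conj_set (GL n) (?P * ?D) ?W2" .
    have "?P * ?D \<in> carrier (GL n)" by (rule GL_mult_closed[OF P D])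
    then show ?A2 using imprim[OF nel l H2 K2 _ sub] sub nel l H2 K2 by blast
  qed
  ultimately show ?thesis by blast
qed

end
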